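(* Let $\Sigma=(\mathbb{P},\{A_i,B_i,C_i,0\}_{i=0}^{n_\mathrm{p}})$ be an LPV-SSA representation, $x_\mathrm{o}$ an initial state of $\Sigma$ and $\mathfrak{F}:\mathcal{U}\times\mathcal{P}\to\mathcal{Y}$ an input-output function. Then $\Sigma$ is a realization of $\mathfrak{F}$ from $x_\mathrm{o}$ if and only if $\mathfrak{F}$ has an impulse response representation (IIR) and, for all $i,j\in\mathbb{I}_0^{n_\mathrm{p}}$ and $s\in\mathcal{S}(\mathbb{I}_0^{n_\mathrm{p}})$, this IIR satisfies $$\eta_{i,\mathfrak{F}}(s)=C_iA_sx_\mathrm{o},\qquad \theta_{i,j,\mathfrak{F}}(s)=C_iA_sB_j,$$ where $A_\epsilon$ is the identity matrix and $A_s=A_{s_n}A_{s_{n-1}}\cdots A_{s_1}$ for $s=s_1\cdots s_n$, $s_1,\ldots,s_n\in\mathbb{I}_0^{n_\mathrm{p}}$, $n>0$.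
   Context: Time is either continuous (CT: $\mathbb{T}=[0,\infty)$, $\xi=\frac{d}{dt}$) or discrete (DT: $\mathbb{T}=\mathbb{N}=\{0,1,\ldots\}$, $(\xi z)(t)=z(t+1)$); the statement is asserted in each of the two cases. The scheduling set $\mathbb{P}\subseteq\mathbb{R}^{n_\mathrm{p}}$ is fixed and its affine hull is $\mathbb{R}^{n_\mathrm{p}}$; $n_\mathrm{u},n_\mathrm{y}$ are fixed. In CT, $\mathcal{U},\mathcal{P},\mathcal{Y}$ are the sets of piecewise-continuous functions from $[0,\infty)$ to $\mathbb{R}^{n_\mathrm{u}}$, $\mathbb{P}$, $\mathbb{R}^{n_\mathrm{y}}$ respectively (finitely many discontinuities on each compact interval, with finite one-sided limits there); in DT they are the sets of all functions from $\mathbb{N}$ to these sets. An LPV-SSA representation $\Sigma=(\mathbb{P},\{A_i,B_i,C_i,0\}_{i=0}^{n_\mathrm{p}})$ of state dimension $n_\mathrm{x}$ is the system $\xi x(t)=A(p(t))x(t)+B(p(t))u(t)$, $y(t)=C(p(t))x(t)$, where $A(\mathbf{p})=A_0+\sum_{i=1}^{n_\mathrm{p}}A_i\mathbf{p}_i$, and similarly $B(\mathbf{p})$, $C(\mathbf{p})$, with constant matrices $A_i\in\mathbb{R}^{n_\mathrm{x}\times n_\mathrm{x}}$, $B_i\in\mathbb{R}^{n_\mathrm{x}\times n_\mathrm{u}}$, $C_i\in\mathbb{R}^{n_\mathrm{y}\times n_\mathrm{x}}$. For $x_\mathrm{o}\in\mathbb{R}^{n_\mathrm{x}}$ and $(u,p)\in\mathcal{U}\times\mathcal{P}$,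 let $x$ be the unique state trajectory with $x(0)=x_\mathrm{o}$ (in CT: locally absolutely continuous, satisfying the state equation for almost all $t$), and put $\mathfrak{Y}_{\Sigma,x_\mathrm{o}}(u,p)(t)=C(p(t))x(t)$. $\Sigma$ is a realization of $\mathfrak{F}$ from $x_\mathrm{o}$ if $\mathfrak{F}=\mathfrak{Y}_{\Sigma,x_\mathrm{o}}$. Let $\mathbb{I}_0^{n_\mathrm{p}}=\{0,\ldots,n_\mathrm{p}\}$ and let $\mathcal{S}(\mathbb{I}_0^{n_\mathrm{p}})$ be the set of finite sequences over it, including the empty sequence $\epsilon$; $|s|$ is the length of $s$. Write $p_0(t)=1$ and $p_i(t)$ for the $i$th component of $p(t)$. For $s\in\mathcal{S}(\mathbb{I}_0^{n_\mathrm{p}})$ and $\tau\le t$: in CT, $(w_\epsilon\diamond p)(t,\tau)=1$ and $(w_{s_1\cdots s_n}\diamond p)(t,\tau)=\int_\tau^t p_{s_n}(\delta)(w_{s_1\cdots s_{n-1}}\diamond p)(\delta,\tau)\,d\delta$; in DT, $(w_{s_1\cdots s_n}\diamond p)(t,\tau)=p_{s_1}(\tau)p_{s_2}(\tau+1)\cdots p_{s_n}(t)$ if $n=t-\tau+1$ and $0$ otherwise (for $t=\tau-1$: value $1$ for $s=\epsilon$ and $0$ otherwise). $\mathfrak{F}$ has an IIR if there is a function $\theta_{\mathfrak{F}}:\mathcal{S}(\mathbb{I}_0^{n_\mathrm{p}})\to\mathbb{R}^{(n_\mathrm{p}+1)n_\mathrm{y}\times(n_\mathrm{u}(n_\mathrm{p}+1)+1)}$,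 whose $i$th block row ($i=0,\ldots,n_\mathrm{p}$) is $[\eta_{i,\mathfrak{F}}(s)\ \theta_{i,0,\mathfrak{F}}(s)\ \cdots\ \theta_{i,n_\mathrm{p},\mathfrak{F}}(s)]$ with $\eta_{i,\mathfrak{F}}(s)\in\mathbb{R}^{n_\mathrm{y}}$, $\theta_{i,j,\mathfrak{F}}(s)\in\mathbb{R}^{n_\mathrm{y}\times n_\mathrm{u}}$, such that (1) there are $K,R>0$ with $\|\theta_{\mathfrak{F}}(s)\|_F\le KR^{|s|}$ for all $s$ (Frobenius norm); (2) for all $(u,p)\in\mathcal{U}\times\mathcal{P}$, $t\in\mathbb{T}$: in CT, $\mathfrak{F}(u,p)(t)=(g\diamond p)(t)+\int_0^t(h\diamond p)(\delta,t)u(\delta)\,d\delta$ with $(g\diamond p)(t)=\sum_{i}\sum_{s}p_i(t)\eta_{i,\mathfrak{F}}(s)(w_s\diamond p)(t,0)$ and $(h\diamond p)(\delta,t)=\sum_{i,j}\sum_s\theta_{i,j,\mathfrak{F}}(s)p_i(t)p_j(\delta)(w_s\diamond p)(t,\delta)$; in DT, $\mathfrak{F}(u,p)(t)=(g\diamond p)(t)+\sum_{\delta=0}^{t-1}(h\diamond p)(\delta,t)u(\delta)$ with $(g\diamond p)(t)=\sum_{i,s}\eta_{i,\mathfrak{F}}(s)p_i(t)(w_s\diamond p)(t-1,0)$ and $(h\diamond p)(\delta,t)=\sum_{i,j,s}\theta_{i,j,\mathfrak{F}}(s)p_i(t)p_j(\delta)(w_s\diamond p)(t-1,\delta+1)$;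 here $i,j$ range over $\mathbb{I}_0^{n_\mathrm{p}}$ and $s$ over $\mathcal{S}(\mathbb{I}_0^{n_\mathrm{p}})$. The function $\theta_{\mathfrak{F}}$ is uniquely determined by $\mathfrak{F}$. *)

theory Defs
  imports "HOL-Analysis.Analysis"
begin

text \<open>
  The index set \<open>{0, \<dots>, n\<^sub>p}\<close> is the type \<open>'p option\<close>: \<open>None\<close> is the index \<open>0\<close> and the
  indices \<open>Some i\<close> are the coordinates of \<open>real ^ 'p\<close>.  Finite sequences of indices are
  lists \<open>[s\<^sub>1, \<dots>, s\<^sub>n]\<close>, read from left to right.
\<close>

record ('p, 'x, 'u, 'y) lpv_ssa =
  Amat :: "'p option \<Rightarrow> real ^ 'x ^ 'x"
  Bmat :: "'p option \<Rightarrow> real ^ 'u ^ 'x"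
  Cmat :: "'p option \<Rightarrow> real ^ 'x ^ 'y"

definition affine_mat :: "('p::finite option \<Rightarrow> real ^ 'n ^ 'm) \<Rightarrow> real ^ 'p \<Rightarrow> real ^ 'n ^ 'm" where
  "affine_mat M v = M None + (\<Sum>i\<in>UNIV. (v $ i) *\<^sub>R M (Some i))"

text \<open>The component \<open>p\<^sub>i\<close>, with the convention \<open>p\<^sub>0 = 1\<close>.\<close>

primrec pcomp :: "'p option \<Rightarrow> real ^ 'p \<Rightarrow> real" where
  "pcomp None v = 1"
| "pcomp (Some i) v = v $ i"

text \<open>\<open>word_mat A [s\<^sub>1, \<dots>, s\<^sub>n] = A s\<^sub>n ** \<dots> ** A s\<^sub>1\<close>.\<close>

primrec word_mat :: "('p option \<Rightarrow> real ^ 'x ^ 'x) \<Rightarrow> 'p option list \<Rightarrow> real ^ 'x ^ 'x" where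
  "word_mat A [] = mat 1"
| "word_mat A (i # s) = word_mat A s ** A i"

text \<open>
  Rows are indexed by pairs (block row \<open>i\<close>, output component); the column \<open>Inl ()\<close> holds
  \<open>\<eta>\<^sub>i\<close>, and the columns \<open>Inr (j, _)\<close> hold \<open>\<theta>\<^sub>i\<^sub>,\<^sub>j\<close>.
\<close>

type_synonym ('p, 'u, 'y) iir_coeff =
  "'p option list \<Rightarrow> real ^ (unit + 'p option \<times> 'u) ^ ('p option \<times> 'y)"

definition eta_part ::
    "('p::finite, 'u::finite, 'y::finite) iir_coeff \<Rightarrow> 'p option \<Rightarrow> 'p option list \<Rightarrow> real ^ 'y" where
  "eta_part \<theta> i s = (\<chi> k. \<theta> s $ (i, k) $ Inl ())"

definition theta_part ::
    "('p::finite, 'u::finite, 'y::finite) iir_coeff \<Rightarrow> 'p option \<Rightarrow> 'p option \<Rightarrow> 'p option list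
      \<Rightarrow> real ^ 'u ^ 'y" where
  "theta_part \<theta> i j s = (\<chi> k l. \<theta> s $ (i, k) $ Inr (j, l))"

text \<open>The library norm of a matrix in \<open>real ^ 'n ^ 'm\<close> is the Frobenius norm.\<close>

lemma norm_matrix_eq_Frobenius:
  fixes M :: "real ^ 'n ^ 'm"
  shows "norm M = sqrt (\<Sum>i\<in>UNIV. \<Sum>j\<in>UNIV. (M $ i $ j)\<^sup>2)"
  by (simp add: norm_vec_def L2_set_def sum_nonneg)

definition exp_bounded :: "('p::finite, 'u::finite, 'y::finite) iir_coeff \<Rightarrow> bool" where
  "exp_bounded \<theta> \<longleftrightarrow> (\<exists>K>0. \<exists>R>0. \<forall>s. norm (\<theta> s) \<le> K * R ^ length s)"

text \<open>
  Functions on \<open>[0, \<infinity>)\<close> are functions on \<open>real\<close> that are \<open>undefined\<close> outside \<open>{0..}\<close>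
  (\<open>extensional\<close>), so that an input-output map cannot depend on values at negative times.
  Continuity at \<open>0\<close> is continuity from the right.
\<close>

definition pw_continuous :: "(real \<Rightarrow> 'a::topological_space) \<Rightarrow> bool" where
  "pw_continuous f \<longleftrightarrow>
     (\<forall>a b. 0 \<le> a \<longrightarrow> finite {t \<in> {a..b}. \<not> continuous (at t within {0..}) f}) \<and>
     (\<forall>t\<ge>0. \<not> continuous (at t within {0..}) f \<longrightarrow>
        (\<exists>l. (f \<longlongrightarrow> l) (at_right t)) \<and> (0 < t \<longrightarrow> (\<exists>l. (f \<longlongrightarrow> l) (at_left t))))"

definition ct_signals :: "'a::topological_space set \<Rightarrow> (real \<Rightarrow> 'a) set" where
  "ct_signals V = {f \<in> {0..} \<rightarrow>\<^sub>E V. pw_continuous f}"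

text \<open>
  Below, \<open>D\<close> ranges over the finite families of non-overlapping compact subintervals of
  \<open>{a..b}\<close>.
\<close>

definition abs_continuous_on :: "real \<Rightarrow> real \<Rightarrow> (real \<Rightarrow> 'a::real_normed_vector) \<Rightarrow> bool" where
  "abs_continuous_on a b f \<longleftrightarrow>
     (\<forall>\<epsilon>>0. \<exists>\<delta>>0. \<forall>D E. D division_of E \<longrightarrow> E \<subseteq> {a..b} \<longrightarrow> (\<Sum>k\<in>D. Sup k - Inf k) < \<delta> \<longrightarrow>
        (\<Sum>k\<in>D. norm (f (Sup k) - f (Inf k))) < \<epsilon>)"

definition ct_trajectory ::
    "('p::finite, 'x::finite, 'u::finite, 'y::finite) lpv_ssa \<Rightarrow> real ^ 'x
      \<Rightarrow> (real \<Rightarrow> real ^ 'u) \<Rightarrow> (real \<Rightarrow> real ^ 'p) \<Rightarrow> (real \<Rightarrow> real ^ 'x) \<Rightarrow> bool" where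
  "ct_trajectory S x\<^sub>0 u p x \<longleftrightarrow>
     x \<in> extensional {0..} \<and> x 0 = x\<^sub>0 \<and>
     (\<forall>a b. 0 \<le> a \<longrightarrow> abs_continuous_on a b x) \<and>
     (AE t in lborel. 0 \<le> t \<longrightarrow>
        (x has_vector_derivative
           (affine_mat (Amat S) (p t) *v x t + affine_mat (Bmat S) (p t) *v u t))
        (at t within {0..}))"

definition ct_state ::
    "('p::finite, 'x::finite, 'u::finite, 'y::finite) lpv_ssa \<Rightarrow> real ^ 'x
      \<Rightarrow> (real \<Rightarrow> real ^ 'u) \<Rightarrow> (real \<Rightarrow> real ^ 'p) \<Rightarrow> real \<Rightarrow> real ^ 'x" where
  "ct_state S x\<^sub>0 u p = (THE x. ct_trajectory S x\<^sub>0 u p x)"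

definition ct_io_maps ::
    "(real ^ 'p) set \<Rightarrow> ((real \<Rightarrow> real ^ 'u) \<times> (real \<Rightarrow> real ^ 'p) \<Rightarrow> real \<Rightarrow> real ^ 'y) set" where
  "ct_io_maps P = ct_signals UNIV \<times> ct_signals P \<rightarrow> ct_signals UNIV"

definition ct_realization ::
    "(real ^ 'p) set \<Rightarrow> ('p::finite, 'x::finite, 'u::finite, 'y::finite) lpv_ssa \<Rightarrow> real ^ 'x
      \<Rightarrow> ((real \<Rightarrow> real ^ 'u) \<times> (real \<Rightarrow> real ^ 'p) \<Rightarrow> real \<Rightarrow> real ^ 'y) \<Rightarrow> bool" where
  "ct_realization P S x\<^sub>0 F \<longleftrightarrow>
     (\<forall>u\<in>ct_signals UNIV. \<forall>p\<in>ct_signals P. \<forall>t\<ge>0.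
        F (u, p) t = affine_mat (Cmat S) (p t) *v ct_state S x\<^sub>0 u p t)"

function ct_w :: "(real \<Rightarrow> real ^ 'p) \<Rightarrow> 'p option list \<Rightarrow> real \<Rightarrow> real \<Rightarrow> real" where
  "ct_w p s t \<tau> =
     (if s = [] then 1
      else integral {\<tau>..t} (\<lambda>\<delta>. pcomp (last s) (p \<delta>) * ct_w p (butlast s) \<delta> \<tau>))"
  by auto
termination
  by (relation "Wellfounded.measure (\<lambda>(p, s, t, \<tau>). length s)") auto

declare ct_w.simps [simp del]

lemma ct_w_Nil: "ct_w p [] t \<tau> = 1"
  and ct_w_snoc: "ct_w p (s @ [i]) t \<tau> = integral {\<tau>..t} (\<lambda>\<delta>. pcomp i (p \<delta>) * ct_w p s \<delta> \<tau>)"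
  by (simp_all add: ct_w.simps [of p "[]"] ct_w.simps [of p "s @ [i]"])

definition ct_g ::
    "('p::finite, 'u::finite, 'y::finite) iir_coeff \<Rightarrow> (real \<Rightarrow> real ^ 'p) \<Rightarrow> real \<Rightarrow> real ^ 'y" where
  "ct_g \<theta> p t =
     (\<Sum>i\<in>UNIV. \<Sum>\<^sub>\<infinity>s\<in>UNIV. (pcomp i (p t) * ct_w p s t 0) *\<^sub>R eta_part \<theta> i s)"

definition ct_h ::
    "('p::finite, 'u::finite, 'y::finite) iir_coeff \<Rightarrow> (real \<Rightarrow> real ^ 'p) \<Rightarrow> real \<Rightarrow> real
      \<Rightarrow> real ^ 'u ^ 'y" where
  "ct_h \<theta> p \<delta> t =
     (\<Sum>i\<in>UNIV. \<Sum>j\<in>UNIV. \<Sum>\<^sub>\<infinity>s\<in>UNIV.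
        (pcomp i (p t) * pcomp j (p \<delta>) * ct_w p s t \<delta>) *\<^sub>R theta_part \<theta> i j s)"

definition is_ct_iir ::
    "(real ^ 'p) set
      \<Rightarrow> ((real \<Rightarrow> real ^ 'u) \<times> (real \<Rightarrow> real ^ 'p) \<Rightarrow> real \<Rightarrow> real ^ 'y)
      \<Rightarrow> ('p::finite, 'u::finite, 'y::finite) iir_coeff \<Rightarrow> bool" where
  "is_ct_iir P F \<theta> \<longleftrightarrow> exp_bounded \<theta> \<and>
     (\<forall>u\<in>ct_signals UNIV. \<forall>p\<in>ct_signals P. \<forall>t\<ge>0.
        F (u, p) t = ct_g \<theta> p t + integral {0..t} (\<lambda>\<delta>. ct_h \<theta> p \<delta> t *v u \<delta>))"

definition has_ct_iir ::
    "(real ^ 'p) set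
      \<Rightarrow> ((real \<Rightarrow> real ^ 'u) \<times> (real \<Rightarrow> real ^ 'p::finite) \<Rightarrow> real \<Rightarrow> real ^ 'y) \<Rightarrow> bool" where
  "has_ct_iir P F \<longleftrightarrow> (\<exists>\<theta>. is_ct_iir P F \<theta>)"

text \<open>
  The coefficient function \<open>\<theta>\<^sub>F\<close> of \<open>F\<close>; it is unique when the affine hull of \<open>P\<close> is the
  whole space.
\<close>

definition ct_iir ::
    "(real ^ 'p) set
      \<Rightarrow> ((real \<Rightarrow> real ^ 'u) \<times> (real \<Rightarrow> real ^ 'p) \<Rightarrow> real \<Rightarrow> real ^ 'y)
      \<Rightarrow> ('p::finite, 'u::finite, 'y::finite) iir_coeff" where
  "ct_iir P F = (THE \<theta>. is_ct_iir P F \<theta>)"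

definition dt_signals :: "'a set \<Rightarrow> (nat \<Rightarrow> 'a) set" where
  "dt_signals V = UNIV \<rightarrow> V"

primrec dt_state ::
    "('p::finite, 'x::finite, 'u::finite, 'y::finite) lpv_ssa \<Rightarrow> real ^ 'x
      \<Rightarrow> (nat \<Rightarrow> real ^ 'u) \<Rightarrow> (nat \<Rightarrow> real ^ 'p) \<Rightarrow> nat \<Rightarrow> real ^ 'x" where
  "dt_state S x\<^sub>0 u p 0 = x\<^sub>0"
| "dt_state S x\<^sub>0 u p (Suc t) =
     affine_mat (Amat S) (p t) *v dt_state S x\<^sub>0 u p t + affine_mat (Bmat S) (p t) *v u t"

definition dt_io_maps ::
    "(real ^ 'p) set \<Rightarrow> ((nat \<Rightarrow> real ^ 'u) \<times> (nat \<Rightarrow> real ^ 'p) \<Rightarrow> nat \<Rightarrow> real ^ 'y) set" where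
  "dt_io_maps P = dt_signals UNIV \<times> dt_signals P \<rightarrow> dt_signals UNIV"

definition dt_realization ::
    "(real ^ 'p) set \<Rightarrow> ('p::finite, 'x::finite, 'u::finite, 'y::finite) lpv_ssa \<Rightarrow> real ^ 'x
      \<Rightarrow> ((nat \<Rightarrow> real ^ 'u) \<times> (nat \<Rightarrow> real ^ 'p) \<Rightarrow> nat \<Rightarrow> real ^ 'y) \<Rightarrow> bool" where
  "dt_realization P S x\<^sub>0 F \<longleftrightarrow>
     (\<forall>u\<in>dt_signals UNIV. \<forall>p\<in>dt_signals P. \<forall>t.
        F (u, p) t = affine_mat (Cmat S) (p t) *v dt_state S x\<^sub>0 u p t)"

text \<open>The first time argument is an integer because the value \<open>-1\<close> occurs.\<close>

definition dt_w :: "(nat \<Rightarrow> real ^ 'p) \<Rightarrow> 'p option list \<Rightarrow> int \<Rightarrow> nat \<Rightarrow> real" where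
  "dt_w p s t \<tau> =
     (if int (length s) = t - int \<tau> + 1
      then (\<Prod>k<length s. pcomp (s ! k) (p (\<tau> + k))) else 0)"

definition dt_g ::
    "('p::finite, 'u::finite, 'y::finite) iir_coeff \<Rightarrow> (nat \<Rightarrow> real ^ 'p) \<Rightarrow> nat \<Rightarrow> real ^ 'y" where
  "dt_g \<theta> p t =
     (\<Sum>i\<in>UNIV. \<Sum>\<^sub>\<infinity>s\<in>UNIV. (pcomp i (p t) * dt_w p s (int t - 1) 0) *\<^sub>R eta_part \<theta> i s)"

definition dt_h ::
    "('p::finite, 'u::finite, 'y::finite) iir_coeff \<Rightarrow> (nat \<Rightarrow> real ^ 'p) \<Rightarrow> nat \<Rightarrow> nat
      \<Rightarrow> real ^ 'u ^ 'y" where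
  "dt_h \<theta> p \<delta> t =
     (\<Sum>i\<in>UNIV. \<Sum>j\<in>UNIV. \<Sum>\<^sub>\<infinity>s\<in>UNIV.
        (pcomp i (p t) * pcomp j (p \<delta>) * dt_w p s (int t - 1) (\<delta> + 1)) *\<^sub>R theta_part \<theta> i j s)"

definition is_dt_iir ::
    "(real ^ 'p) set
      \<Rightarrow> ((nat \<Rightarrow> real ^ 'u) \<times> (nat \<Rightarrow> real ^ 'p) \<Rightarrow> nat \<Rightarrow> real ^ 'y)
      \<Rightarrow> ('p::finite, 'u::finite, 'y::finite) iir_coeff \<Rightarrow> bool" where
  "is_dt_iir P F \<theta> \<longleftrightarrow> exp_bounded \<theta> \<and>
     (\<forall>u\<in>dt_signals UNIV. \<forall>p\<in>dt_signals P. \<forall>t.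
        F (u, p) t = dt_g \<theta> p t + (\<Sum>\<delta><t. dt_h \<theta> p \<delta> t *v u \<delta>))"

definition has_dt_iir ::
    "(real ^ 'p) set
      \<Rightarrow> ((nat \<Rightarrow> real ^ 'u) \<times> (nat \<Rightarrow> real ^ 'p::finite) \<Rightarrow> nat \<Rightarrow> real ^ 'y) \<Rightarrow> bool" where
  "has_dt_iir P F \<longleftrightarrow> (\<exists>\<theta>. is_dt_iir P F \<theta>)"

definition dt_iir ::
    "(real ^ 'p) set
      \<Rightarrow> ((nat \<Rightarrow> real ^ 'u) \<times> (nat \<Rightarrow> real ^ 'p) \<Rightarrow> nat \<Rightarrow> real ^ 'y)
      \<Rightarrow> ('p::finite, 'u::finite, 'y::finite) iir_coeff" where
  "dt_iir P F = (THE \<theta>. is_dt_iir P F \<theta>)"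

end

theory Submission
  imports Defs
begin

text \<open>
  In continuous time, the trajectory and the output are both written as series of iterated
  integrals over an enlarged alphabet, with letters \<open>i\<close> for the signals \<open>p\<^sub>i\<close> and \<open>(j, l)\<close> for
  the signals \<open>p\<^sub>j u\<^sub>l\<close>.  Integration by parts turns \<open>\<integral>\<^sub>0\<^sup>t (w\<^sub>s \<diamond> p)(t, \<delta>) p\<^sub>j(\<delta>) u\<^sub>l(\<delta>) d\<delta>\<close> into
  a single iterated integral, so that the right-hand side of an IIR becomes
  \<open>\<Sum>\<^sub>i p\<^sub>i(t) \<Sigma>\<^sub>i(t)\<close> with series \<open>\<Sigma>\<^sub>i\<close> over this alphabet.  For the coefficients \<open>A\<^sub>s x\<^sub>o\<close>,
  \<open>A\<^sub>s B\<^sub>j\<close> the series satisfies the integral form of the state equation, whose solution is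
  unique.  Hence being a realization means having an IIR with the stated coefficients, and it
  remains to see that coefficients are unique.  Changing \<open>p\<close> at the single time \<open>t\<close> separates the
  block rows because \<open>P\<close> affinely spans the space.  If a series vanishes for all signals, switch
  to arbitrary constant values after time \<open>t\<close> and differentiate at \<open>t\<close> from the right: the series
  with the outermost letter of every word removed vanish as well, and evaluating at \<open>t = 0\<close> gives
  the claim by induction on words.  In discrete time the series are finite sums and changing \<open>p\<close>
  at one time replaces differentiation.
\<close>

section \<open>Piecewise-continuous functions\<close>

text \<open>The obstacle in continuous time is the order of integration. Iterated integrals are
  built from the outermost letter and solve an integral equation in their upper limit, whereas the
  convolution kernel meets the input at its lower limit \<open>\<delta>\<close>. Putting the input
  letter at the inner end of a word makes both sides series in one upper limit with lower limit 0.
  Integration by parts can replace Fubini on a triangle because iterated integrals are finite sums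
  of products of functions of one limit each.

  Convergence rests on a factorial: n ordered times in [0, T] form a simplex of volume T^n / n!,
  which beats both the number of words of length n and the geometric growth of the coefficients.

  Trajectories satisfy the state equation only almost everywhere, so their uniqueness rests on the
  fundamental theorem of calculus for absolutely continuous functions. Since \<open>P\<close> may be
  a finite set, uniqueness of the coefficients works with jumps between points of \<open>P\<close>
  instead of perturbations of a value.\<close>

lemma pw_continuous_limits:
  assumes "pw_continuous f" "0 \<le> t"
  shows pw_continuous_limit_right: "\<exists>l. (f \<longlongrightarrow> l) (at_right t)"
    and pw_continuous_limit_left: "0 < t \<Longrightarrow> \<exists>l. (f \<longlongrightarrow> l) (at_left t)"
proof -
  have "(\<exists>l. (f \<longlongrightarrow> l) (at_right t)) \<and> (0 < t \<longrightarrow> (\<exists>l. (f \<longlongrightarrow> l) (at_left t)))"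
  \<comment> \<open>At a point of continuity both limits are \<open>f t\<close>, so later arguments
    never have to ask whether t is a jump.\<close>
  proof (cases "continuous (at t within {0..}) f")
    case True
    then have lim: "(f \<longlongrightarrow> f t) (at t within {0..})" by (simp add: continuous_within)
    have "(f \<longlongrightarrow> f t) (at_right t)"
      by (rule tendsto_within_subset[OF lim]) (use assms in auto)
    moreover have "(f \<longlongrightarrow> f t) (at_left t)" if "0 < t"
    proof -
      have "at t within {0..} = at t" using that by (intro at_within_interior) auto
      with lim show ?thesis by (auto simp: filterlim_at_split)
    qed
    ultimately show ?thesis by blast
  next
    case False
    with assms show ?thesis unfolding pw_continuous_def by blast
  qed
  then show "\<exists>l. (f \<longlongrightarrow> l) (at_right t)" "0 < t \<Longrightarrow> \<exists>l. (f \<longlongrightarrow> l) (at_left t)"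
    by blast+
qed

lemma pw_continuous_finite:
  assumes "pw_continuous f" "0 \<le> a"
  shows "finite {t \<in> {a..b}. \<not> continuous (at t within {0..}) f}"
  using assms unfolding pw_continuous_def by blast

lemma pw_continuous_continuous_on:
  assumes "continuous_on {0..} f"
  shows "pw_continuous f"
proof -
  have "{t \<in> {a..b}. \<not> continuous (at t within {0..}) f} = {}" if "0 \<le> a" for a b
    using assms that unfolding continuous_on_eq_continuous_within by auto
  then show ?thesis
    using assms unfolding pw_continuous_def continuous_on_eq_continuous_within
    by (metis atLeast_iff finite.emptyI)
qed

lemma pw_continuous_compose:
  fixes f :: "real \<Rightarrow> 'a::t2_space"
  assumes f: "pw_continuous f" and g: "continuous_on UNIV g"
  shows "pw_continuous (\<lambda>t. g (f t))"
proof -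
  have isCont: "isCont g x" for x
    using g by (simp add: continuous_on_eq_continuous_at)
  show ?thesis
    unfolding pw_continuous_def
  proof (intro conjI allI impI)
    fix a b :: real assume "0 \<le> a"
    have "continuous (at t within {0..}) (\<lambda>t. g (f t))" if "continuous (at t within {0..}) f" for t
      using continuous_within_compose3[OF isCont that] .
    then have "{t \<in> {a..b}. \<not> continuous (at t within {0..}) (\<lambda>t. g (f t))} \<subseteq> {t \<in> {a..b}. \<not> continuous (at t within {0..}) f}"
      by blast
    then show "finite {t \<in> {a..b}. \<not> continuous (at t within {0..}) (\<lambda>t. g (f t))}"
      using pw_continuous_finite[OF f \<open>0 \<le> a\<close>] finite_subset by blast
  next
    fix t :: real assume "0 \<le> t"
    then obtain l where "(f \<longlongrightarrow> l) (at_right t)" using pw_continuous_limit_right[OF f] by blast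
    then show "\<exists>l. ((\<lambda>t. g (f t)) \<longlongrightarrow> l) (at_right t)"
      by (intro exI[of _ "g l"] isCont_tendsto_compose[OF isCont])
  next
    fix t :: real assume "0 \<le> t" "0 < t"
    then obtain l where "(f \<longlongrightarrow> l) (at_left t)" using pw_continuous_limit_left[OF f] by blast
    then show "\<exists>l. ((\<lambda>t. g (f t)) \<longlongrightarrow> l) (at_left t)"
      by (intro exI[of _ "g l"] isCont_tendsto_compose[OF isCont])
  qed
qed

text \<open>Pairing reduces every continuous binary operation to
  \<open>pw_continuous_compose\<close>; sums and bilinear products of signals are obtained in this
  way.\<close>

lemma pw_continuous_Pair:
  assumes f: "pw_continuous f" and g: "pw_continuous g"
  shows "pw_continuous (\<lambda>t. (f t, g t))"
  unfolding pw_continuous_def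
proof (intro conjI allI impI)
  fix a b :: real assume "0 \<le> a"
  have "{t \<in> {a..b}. \<not> continuous (at t within {0..}) (\<lambda>t. (f t, g t))} \<subseteq>
      {t \<in> {a..b}. \<not> continuous (at t within {0..}) f} \<union> {t \<in> {a..b}. \<not> continuous (at t within {0..}) g}"
    using continuous_Pair by blast
  then show "finite {t \<in> {a..b}. \<not> continuous (at t within {0..}) (\<lambda>t. (f t, g t))}"
    using pw_continuous_finite[OF f \<open>0 \<le> a\<close>] pw_continuous_finite[OF g \<open>0 \<le> a\<close>] finite_subset
    by blast
next
  fix t :: real assume "0 \<le> t"
  then obtain l m where "(f \<longlongrightarrow> l) (at_right t)" "(g \<longlongrightarrow> m) (at_right t)"
    using pw_continuous_limit_right[OF f] pw_continuous_limit_right[OF g] by blast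
  then show "\<exists>l. ((\<lambda>t. (f t, g t)) \<longlongrightarrow> l) (at_right t)"
    by (intro exI[of _ "(l, m)"] tendsto_Pair)
next
  fix t :: real assume "0 \<le> t" "0 < t"
  then obtain l m where "(f \<longlongrightarrow> l) (at_left t)" "(g \<longlongrightarrow> m) (at_left t)"
    using pw_continuous_limit_left[OF f] pw_continuous_limit_left[OF g] by blast
  then show "\<exists>l. ((\<lambda>t. (f t, g t)) \<longlongrightarrow> l) (at_left t)"
    by (intro exI[of _ "(l, m)"] tendsto_Pair)
qed

lemma (in bounded_bilinear) pw_continuous:
  assumes "pw_continuous f" "pw_continuous g"
  shows "pw_continuous (\<lambda>t. prod (f t) (g t))"
proof -
  have "continuous_on UNIV (\<lambda>z. prod (fst z) (snd z))"
    by (intro continuous_on continuous_intros)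
  from pw_continuous_compose[OF pw_continuous_Pair[OF assms] this] show ?thesis by simp
qed

lemmas pw_continuous_scaleR = bounded_bilinear.pw_continuous[OF bounded_bilinear_scaleR]

lemma pw_continuous_add:
  fixes f g :: "real \<Rightarrow> 'a::real_normed_vector"
  assumes "pw_continuous f" "pw_continuous g"
  shows "pw_continuous (\<lambda>t. f t + g t)"
proof -
  have "continuous_on UNIV (\<lambda>z :: 'a \<times> 'a. fst z + snd z)"
    by (intro continuous_intros)
  from pw_continuous_compose[OF pw_continuous_Pair[OF assms] this] show ?thesis by simp
qed

lemma pw_continuous_mult:
  fixes f g :: "real \<Rightarrow> real"
  assumes "pw_continuous f" "pw_continuous g"
  shows "pw_continuous (\<lambda>t. f t * g t)"
  using pw_continuous_scaleR[OF assms] by simp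

text \<open>Nothing is asked of \<open>h\<close> at t, which becomes at most one more discontinuity;
  near every other point \<open>h\<close> coincides with \<open>f\<close> or with \<open>g\<close>.
  Hence the switching time may belong to either phase.\<close>

lemma pw_continuous_switch:
  assumes f: "pw_continuous f" and g: "pw_continuous g"
    and hf: "\<And>r. r < t \<Longrightarrow> h r = f r" and hg: "\<And>r. t < r \<Longrightarrow> h r = g r"
  shows "pw_continuous h"
  unfolding pw_continuous_def
proof (intro conjI allI impI)
  fix a b :: real assume "0 \<le> a"
  have cf: "continuous (at r within {0..}) h" if "continuous (at r within {0..}) f" "r < t" "0 \<le> r" for r
  proof -
    have "eventually (\<lambda>s. h s = f s) (at r within {0..})"
      using that(2) eventually_at_topological[of "\<lambda>s. h s = f s" r "{0..}"] hf
      by (meson lessThan_iff open_lessThan)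
    then show ?thesis
      using that unfolding continuous_within
      by (simp add: hf filterlim_cong)
  qed
  have cg: "continuous (at r within {0..}) h" if "continuous (at r within {0..}) g" "t < r" "0 \<le> r" for r
  proof -
    have "eventually (\<lambda>s. h s = g s) (at r within {0..})"
      using that(2) eventually_at_topological[of "\<lambda>s. h s = g s" r "{0..}"] hg
      by (meson greaterThan_iff open_greaterThan)
    then show ?thesis
      using that unfolding continuous_within
      by (simp add: hg filterlim_cong)
  qed
  have "{r \<in> {a..b}. \<not> continuous (at r within {0..}) h} \<subseteq> insert t
      ({t \<in> {a..b}. \<not> continuous (at t within {0..}) f} \<union> {t \<in> {a..b}. \<not> continuous (at t within {0..}) g})"
    using cf cg \<open>0 \<le> a\<close> by fastforce
  then show "finite {r \<in> {a..b}. \<not> continuous (at r within {0..}) h}"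
    using pw_continuous_finite[OF f \<open>0 \<le> a\<close>] pw_continuous_finite[OF g \<open>0 \<le> a\<close>]
    by (meson finite.insertI finite_UnI finite_subset)
next
  fix r :: real assume r: "0 \<le> r"
  show "\<exists>l. (h \<longlongrightarrow> l) (at_right r)"
  proof (cases "r < t")
    case True
    have "eventually (\<lambda>s. h s = f s) (at_right r)"
      using True hf by (auto simp: eventually_at_right_field)
    then show ?thesis using pw_continuous_limit_right[OF f r] by (simp add: filterlim_cong)
  next
    case False
    have "eventually (\<lambda>s. h s = g s) (at_right r)"
      using False hg by (auto simp: eventually_at_right_field intro!: exI[of _ "r + 1"])
    then show ?thesis using pw_continuous_limit_right[OF g r] by (simp add: filterlim_cong)
  qed
next
  fix r :: real assume r: "0 \<le> r" "0 < r"
  show "\<exists>l. (h \<longlongrightarrow> l) (at_left r)"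
  proof (cases "r \<le> t")
    case True
    have "eventually (\<lambda>s. h s = f s) (at_left r)"
      using True hf by (auto simp: eventually_at_left_field intro!: exI[of _ "r - 1"])
    then show ?thesis using pw_continuous_limit_left[OF f r] by (simp add: filterlim_cong)
  next
    case False
    have "eventually (\<lambda>s. h s = g s) (at_left r)"
      using False hg by (auto simp: eventually_at_left_field intro!: exI[of _ t])
    then show ?thesis using pw_continuous_limit_left[OF g r] by (simp add: filterlim_cong)
  qed
qed

text \<open>The one-sided limits and the value at a point bound \<open>f\<close> in a neighbourhood
  of it, and compactness of {0..T} leaves finitely many neighbourhoods.\<close>

lemma pw_continuous_bounded:
  fixes f :: "real \<Rightarrow> 'a::real_normed_vector"
  assumes f: "pw_continuous f"
  obtains M where "0 < M" "\<And>t. t \<in> {0..T} \<Longrightarrow> norm (f t) \<le> M"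
proof -
  have loc: "\<exists>U M. open U \<and> t \<in> U \<and> (\<forall>s\<in>U \<inter> {0..}. norm (f s) \<le> M)" if t: "t \<in> {0..T}" for t
  proof -
    obtain l where l: "(f \<longlongrightarrow> l) (at_right t)" using pw_continuous_limit_right[OF f] t by auto
    have "eventually (\<lambda>s. norm (f s) < norm l + 1) (at_right t)"
      by (rule order_tendstoD(2)[OF tendsto_norm[OF l]]) simp
    then obtain b where b: "t < b" "\<And>s. t < s \<Longrightarrow> s < b \<Longrightarrow> norm (f s) < norm l + 1"
      unfolding eventually_at_right_field by blast
    obtain a M where a: "a < t" "\<And>s. a < s \<Longrightarrow> s < t \<Longrightarrow> 0 \<le> s \<Longrightarrow> norm (f s) \<le> M"
    proof (cases "0 < t")
      case True
      then obtain l where l: "(f \<longlongrightarrow> l) (at_left t)" using pw_continuous_limit_left[OF f] t by auto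
      have "eventually (\<lambda>s. norm (f s) < norm l + 1) (at_left t)"
        by (rule order_tendstoD(2)[OF tendsto_norm[OF l]]) simp
      then obtain a where "a < t" "\<And>s. a < s \<Longrightarrow> s < t \<Longrightarrow> norm (f s) < norm l + 1"
        unfolding eventually_at_left_field by blast
      with that show ?thesis by (meson less_imp_le)
    next
      case False
      \<comment> \<open>Here t = 0, and no time in {0..} lies to its left, so the bound 0 holds
        vacuously.\<close>
      with t that[of "t - 1" 0] show ?thesis by auto
    qed
    have "norm (f s) \<le> max (norm (f t)) (max M (norm l + 1))" if "s \<in> {a<..<b} \<inter> {0..}" for s
      using that a(2)[of s] b(2)[of s] by (cases s t rule: linorder_cases) auto
    moreover have "t \<in> {a<..<b}" using a b by simp
    ultimately show ?thesis
      using open_greaterThanLessThan[of a b]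
      by (intro exI[of _ "{a<..<b}"] exI[of _ "max (norm (f t)) (max M (norm l + 1))"]) blast
  qed
  then obtain U M where UM: "\<And>t. t \<in> {0..T} \<Longrightarrow> open (U t) \<and> t \<in> U t \<and> (\<forall>s\<in>U t \<inter> {0..}. norm (f s) \<le> M t)"
    by metis
  obtain C where C: "C \<subseteq> {0..T}" "finite C" "{0..T} \<subseteq> (\<Union>c\<in>C. U c)"
    by (rule compactE_image[of "{0..T}" "{0..T}" U]) (use UM in auto)
  \<comment> \<open>The added 1 makes the bound strictly positive.\<close>
  have "norm (f t) \<le> 1 + (\<Sum>c\<in>C. \<bar>M c\<bar>)" if t: "t \<in> {0..T}" for t
  proof -
    obtain c where c: "c \<in> C" "t \<in> U c" using C t by blast
    then have "norm (f t) \<le> M c" using UM C t by auto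
    also have "\<dots> \<le> \<bar>M c\<bar>" by simp
    also have "\<dots> \<le> (\<Sum>c\<in>C. \<bar>M c\<bar>)" using c C by (intro member_le_sum) auto
    finally show ?thesis by simp
  qed
  moreover have "0 < 1 + (\<Sum>c\<in>C. \<bar>M c\<bar>)" by (simp add: add_pos_nonneg sum_nonneg)
  ultimately show ?thesis using that by blast
qed

text \<open>Continuity off the finite set \<open>D\<close> gives measurability there, boundedness
  gives a constant majorant, and adding \<open>D\<close> back changes nothing because it is
  negligible.\<close>

lemma pw_continuous_integrable:
  fixes f :: "real \<Rightarrow> 'a::euclidean_space"
  assumes f: "pw_continuous f" and "0 \<le> a"
  shows "f integrable_on {a..b}"
proof -
  define D where "D = {t \<in> {a..b}. \<not> continuous (at t within {0..}) f}"
  have fin: "finite D" unfolding D_def by (rule pw_continuous_finite[OF assms])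
  obtain M where M: "\<And>t. t \<in> {0..b} \<Longrightarrow> norm (f t) \<le> M"
    using pw_continuous_bounded[OF f] by blast
  have S: "{a..b} - D \<in> sets lebesgue"
    using negligible_imp_sets[OF negligible_finite[OF fin]] by (intro sets.Diff) auto
  have "continuous_on ({a..b} - D) f"
    unfolding continuous_on_eq_continuous_within
  proof
    fix x assume "x \<in> {a..b} - D"
    then have "continuous (at x within {0..}) f" by (simp add: D_def)
    then show "continuous (at x within {a..b} - D) f"
      using \<open>0 \<le> a\<close> by (rule_tac continuous_within_subset) auto
  qed
  then have "f \<in> borel_measurable (lebesgue_on ({a..b} - D))"
    using S by (rule continuous_imp_measurable_on_sets_lebesgue)
  moreover have "(\<lambda>_. M) integrable_on ({a..b} - D)"
    using fin integrable_const_ivl[of M a b] by (subst integrable_spike_set_eq[of _ "{a..b}"])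
      (auto intro: negligible_subset negligible_finite)
  ultimately have "f integrable_on ({a..b} - D)"
    using M \<open>0 \<le> a\<close> S by (rule_tac measurable_bounded_by_integrable_imp_integrable) auto
  then show ?thesis
    using fin by (subst (asm) integrable_spike_set_eq[of _ "{a..b}"])
      (auto intro: negligible_subset negligible_finite)
qed

section \<open>Absolutely continuous functions\<close>

text \<open>Fundamental theorem of calculus for absolutely continuous functions, proved on the
  Riemann sums of the gauge integral, so that integrability of \<open>f'\<close> is part of the
  conclusion. A cell tagged outside \<open>N\<close> has an error of at most e/2 times its length,
  by differentiability at the tag. The cells tagged in \<open>N\<close> lie in an open set so small
  that absolute continuity makes the increments of \<open>f\<close> over them add up to less than e
  (b - a) / 2.\<close>

lemma abs_continuous_on_imp_has_integral:
  fixes f :: "real \<Rightarrow> 'a::banach"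
  assumes ab: "a \<le> b" and ac: "abs_continuous_on a b f" and N: "negligible N"
    and deriv: "\<And>x. x \<in> {a..b} - N \<Longrightarrow> (f has_vector_derivative f' x) (at x within {a..b})"
  shows "(f' has_integral (f b - f a)) {a..b}"
proof (cases "a = b")
  case True
  then show ?thesis using has_integral_refl(2)[of f' b] by simp
next
  case False
  with ab have lt: "a < b" by simp
  \<comment> \<open>With the value 0 on \<open>N\<close>, a cell tagged in \<open>N\<close> adds
    nothing to the Riemann sum, and only the increment of \<open>f\<close> over it has to be
    estimated.\<close>
  define g where "g x = (if x \<in> N then 0 else f' x)" for x
  have "(g has_integral (f b - f a)) {a..b}"
    unfolding has_integral_factor_content_real
  proof (intro allI impI)
    fix e :: real
    assume e: "0 < e"
    have "0 < e * (b - a) / 2" using e lt by simp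
    with ac obtain \<delta> where \<delta>: "\<delta> > 0"
      and acD: "\<And>D E. \<lbrakk>D division_of E; E \<subseteq> {a..b}; (\<Sum>k\<in>D. Sup k - Inf k) < \<delta>\<rbrakk>
                  \<Longrightarrow> (\<Sum>k\<in>D. norm (f (Sup k) - f (Inf k))) < e * (b - a) / 2"
      unfolding abs_continuous_on_def by meson
    \<comment> \<open>Outer regularity bounds only the measure of \<open>T - N\<close>; as
      \<open>N\<close> is null, \<open>T\<close> itself has measure below
      \<open>\<delta>\<close>.\<close>
    have Nn: "N \<in> null_sets lebesgue" using N by (simp add: negligible_iff_null_sets)
    then obtain T where T: "open T" "N \<subseteq> T" "T - N \<in> lmeasurable"
      and mT: "emeasure lebesgue (T - N) < ennreal \<delta>"
      using sets_lebesgue_outer_open[OF null_setsD2[OF Nn] \<delta>] by blast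
    have mT': "emeasure lebesgue T < ennreal \<delta>"
    proof -
      have "emeasure lebesgue (T - N) = emeasure lebesgue T"
        using Nn T(1) by (intro emeasure_Diff_null_set) auto
      with mT show ?thesis by simp
    qed
    then have Tl: "T \<in> lmeasurable"
      using T(1) by (intro fmeasurableI) (auto simp: less_top[symmetric] intro: order.strict_trans)
    have mTm: "measure lebesgue T < \<delta>"
      using mT' Tl \<delta> by (simp add: emeasure_eq_measure2 ennreal_less_iff)
    have "\<exists>d>0. x \<in> {a..b} - N \<longrightarrow> (\<forall>y\<in>{a..b}. norm (y - x) < d \<longrightarrow>
            norm (f y - f x - (y - x) *\<^sub>R f' x) \<le> e / 2 * norm (y - x))" for x
    proof (cases "x \<in> {a..b} - N")
      case True
      with deriv[OF True, unfolded has_vector_derivative_def has_derivative_within_alt] half_gt_zero[OF e]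
      show ?thesis by blast
    qed (auto intro: zero_less_one)
    then obtain d1 where d1: "\<And>x. 0 < d1 x"
      "\<And>x y. \<lbrakk>x \<in> {a..b} - N; y \<in> {a..b}; norm (y - x) < d1 x\<rbrakk> \<Longrightarrow>
            norm (f y - f x - (y - x) *\<^sub>R f' x) \<le> e / 2 * norm (y - x)"
      by metis
    have "\<exists>d>0. x \<in> N \<longrightarrow> ball x d \<subseteq> T" for x
    proof (cases "x \<in> N")
      case True
      with T show ?thesis using openE[of T x] by blast
    qed (auto intro: zero_less_one)
    then obtain d2 where d2: "\<And>x. 0 < d2 x" "\<And>x. x \<in> N \<Longrightarrow> ball x (d2 x) \<subseteq> T"
      by metis
    define \<gamma> where "\<gamma> x = ball x (min (d1 x) (d2 x))" for x
    have gauge: "gauge \<gamma>"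
      unfolding \<gamma>_def using d1(1) d2(1) by (intro gauge_ball_dependent) auto
    have main: "norm ((\<Sum>(x, K)\<in>p. measure lborel K *\<^sub>R g x) - (f b - f a)) \<le> e * measure lborel {a..b}"
      if p: "p tagged_division_of {a..b}" and fine: "\<gamma> fine p" for p
    proof -
      have fin: "finite p" using p by (rule tagged_division_of_finite)
      have ba: "b - a = (\<Sum>(x,K)\<in>p. Sup K - Inf K)" "f b - f a = (\<Sum>(x,K)\<in>p. f (Sup K) - f (Inf K))"
        using additive_tagged_division_1[where f="\<lambda>x. x", OF ab p] additive_tagged_division_1[where f=f, OF ab p]
        by auto
      have Kint: "\<exists>u v. K = {u..v} \<and> u \<le> v \<and> x \<in> K \<and> K \<subseteq> {a..b}" if xK: "(x, K) \<in> p" for x K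
      proof -
        obtain u v where "K = {u..v}" using tagged_division_ofD(4)[OF p xK] by auto
        with tagged_division_ofD(2,3)[OF p xK] show ?thesis by auto
      qed
      \<comment> \<open>Disjointness of interiors only separates cells of positive length, and
        \<open>snd\<close> has to be injective on \<open>q\<close>. The cells of measure zero that
        are left out carry no increment of \<open>f\<close>.\<close>
      define q where "q = {(x, K) \<in> p. x \<in> N \<and> measure lborel K \<noteq> 0}"
      have qp: "q \<subseteq> p" by (auto simp: q_def)
      have qpart: "q tagged_partial_division_of {a..b}"
        by (rule tagged_partial_division_subset[OF conjunct1[OF p[unfolded tagged_division_of_def]] qp])
      have inj: "inj_on snd q"
      proof (rule inj_onI)
        fix z w assume z: "z \<in> q" and w: "w \<in> q" and eq: "snd z = snd w"
        obtain x K y where zw: "z = (x, K)" "w = (y, K)" using eq by (metis prod.collapse)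
        show "z = w"
        proof (rule ccontr)
          assume "z \<noteq> w"
          then have "interior K \<inter> interior K = {}"
            using tagged_partial_division_ofD(5)[OF qpart, of x K y K] z w unfolding zw by simp
          moreover obtain u v where "K = cbox u v"
            using tagged_partial_division_ofD(4)[OF qpart, of x K] z unfolding zw by blast
          ultimately have "measure lborel K = 0" by (simp add: content_eq_0_interior)
          with z show False by (simp add: q_def zw)
        qed
      qed
      define D where "D = snd ` q"
      have D: "D division_of \<Union>D" unfolding D_def using qpart by (rule partial_division_of_tagged_division)
      have DK: "\<exists>u v. K = {u..v} \<and> u \<le> v \<and> K \<subseteq> T \<and> K \<subseteq> {a..b}" if KD: "K \<in> D" for K
      proof -
        obtain x where x: "(x, K) \<in> p" "x \<in> N" using KD by (auto simp: D_def q_def)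
        have "K \<subseteq> \<gamma> x" using fine x(1) by (auto simp: fine_def)
        also have "\<gamma> x \<subseteq> T" using d2(2)[OF x(2)] by (auto simp: \<gamma>_def)
        finally show ?thesis using Kint[OF x(1)] by blast
      qed
      have Dab: "\<Union>D \<subseteq> {a..b}" and DT: "\<Union>D \<subseteq> T" using DK by blast+
      have "(\<Sum>K\<in>D. Sup K - Inf K) = (\<Sum>K\<in>D. measure lborel K)"
        by (intro sum.cong refl) (auto dest!: DK)
      also have "\<dots> = measure lebesgue (\<Union>D)"
        unfolding content_division[OF D, symmetric] by (intro sum.cong refl) (auto dest!: DK)
      also have "\<dots> \<le> measure lebesgue T"
        using DT Tl lmeasurable_division[OF D] by (intro measure_mono_fmeasurable) (auto dest: fmeasurableD)
      finally have "(\<Sum>K\<in>D. Sup K - Inf K) < \<delta>" using mTm by simp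
      from acD[OF D Dab this] have sN: "(\<Sum>(x,K)\<in>q. norm (f (Sup K) - f (Inf K))) < e * (b - a) / 2"
        unfolding D_def using inj by (simp add: sum.reindex split_def)
      have bnd: "norm (measure lborel K *\<^sub>R g x - (f (Sup K) - f (Inf K)))
          \<le> e / 2 * (Sup K - Inf K) + (if (x, K) \<in> q then norm (f (Sup K) - f (Inf K)) else 0)"
        if xK: "(x, K) \<in> p" for x K
      proof -
        obtain u v where k: "K = {u..v}" "u \<le> v" "x \<in> K" "K \<subseteq> {a..b}" using Kint[OF xK] by blast
        show ?thesis
        proof (cases "x \<in> N")
          case True
          show ?thesis
          proof (cases "(x, K) \<in> q")
            case True with e k \<open>x \<in> N\<close> show ?thesis by (simp add: g_def norm_minus_commute)
          next
            case False
            with xK \<open>x \<in> N\<close> have "measure lborel K = 0" by (auto simp: q_def)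
            with k have "u = v" by simp
            with k show ?thesis using False by simp
          qed
        next
          case False
          then have nq: "(x, K) \<notin> q" by (auto simp: q_def)
          have "K \<subseteq> \<gamma> x" using fine xK by (auto simp: fine_def)
          moreover have "u \<in> K" "v \<in> K" using k by auto
          ultimately have "u \<in> \<gamma> x" "v \<in> \<gamma> x" by auto
          then have uv: "norm (u - x) < d1 x" "norm (v - x) < d1 x"
            by (auto simp: \<gamma>_def dist_real_def)
          have xN: "x \<in> {a..b} - N" and uab: "u \<in> {a..b}" "v \<in> {a..b}" using k False by auto
          \<comment> \<open>The cell is split at its tag: since x lies between u and v, the two
            errors add up to e/2 times v - u.\<close>
          have "norm ((v - u) *\<^sub>R f' x - (f v - f u)) = norm (f u - f x - (u - x) *\<^sub>R f' x - (f v - f x - (v - x) *\<^sub>R f' x))"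
            by (auto simp: algebra_simps)
          also have "\<dots> \<le> norm (f u - f x - (u - x) *\<^sub>R f' x) + norm (f v - f x - (v - x) *\<^sub>R f' x)"
            by (rule norm_triangle_ineq4)
          also have "\<dots> \<le> e / 2 * norm (u - x) + e / 2 * norm (v - x)"
            using d1(2)[OF xN uab(1) uv(1)] d1(2)[OF xN uab(2) uv(2)] by simp
          also have "\<dots> = e / 2 * (v - u)"
            using k by (auto simp: field_simps)
          finally show ?thesis using k False nq by (simp add: g_def)
        qed
      qed
      have "norm ((\<Sum>(x, K)\<in>p. measure lborel K *\<^sub>R g x) - (f b - f a))
          = norm (\<Sum>(x, K)\<in>p. measure lborel K *\<^sub>R g x - (f (Sup K) - f (Inf K)))"
        by (simp add: ba(2) split_def sum_subtractf)
      also have "\<dots> \<le> (\<Sum>(x, K)\<in>p. e / 2 * (Sup K - Inf K) + (if (x, K) \<in> q then norm (f (Sup K) - f (Inf K)) else 0))"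
        by (rule sum_norm_le, clarify) (rule bnd)
      also have "\<dots> = e / 2 * (b - a) + (\<Sum>(x, K)\<in>p. if (x, K) \<in> q then norm (f (Sup K) - f (Inf K)) else 0)"
        by (simp add: ba(1) split_def sum.distrib sum_distrib_left)
      also have "(\<Sum>(x, K)\<in>p. if (x, K) \<in> q then norm (f (Sup K) - f (Inf K)) else 0) = (\<Sum>(x,K)\<in>q. norm (f (Sup K) - f (Inf K)))"
        using fin qp by (intro sum.mono_neutral_cong_right) auto
      finally show ?thesis using sN ab by (simp add: field_simps)
    qed
    show "\<exists>d. gauge d \<and> (\<forall>p. p tagged_division_of {a..b} \<and> d fine p \<longrightarrow>
        norm ((\<Sum>(x, K)\<in>p. measure lborel K *\<^sub>R g x) - (f b - f a)) \<le> e * measure lborel {a..b})"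
      by (intro exI[of _ \<gamma>] conjI allI impI gauge main) auto
  qed
  then show ?thesis
    by (rule has_integral_spike[OF N, rotated]) (simp add: g_def)
qed

section \<open>Series of iterated integrals\<close>

lemma continuous_on_indefinite_integral:
  fixes \<phi> :: "real \<Rightarrow> 'a::euclidean_space"
  assumes \<phi>: "pw_continuous \<phi>" and "0 \<le> \<tau>"
  shows "continuous_on {0..} (\<lambda>t. integral {\<tau>..t} \<phi>)"
proof -
  have 0: "continuous_on {0..} (\<lambda>t. integral {0..t} \<phi>)"
    unfolding continuous_on_eq_continuous_within
  proof
    fix t :: real assume "t \<in> {0..}"
    then have "continuous (at t within {0..t+1}) (\<lambda>t. integral {0..t} \<phi>)"
      using indefinite_integral_continuous_1[OF pw_continuous_integrable[OF \<phi> order_refl], of "t + 1"]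
      by (auto simp: continuous_on_eq_continuous_within)
    moreover have "at t within {0..t+1} = at t within {0..}"
      by (rule at_within_nhd[of _ "{..<t+1}"]) auto
    ultimately show "continuous (at t within {0..}) (\<lambda>t. integral {0..t} \<phi>)" by simp
  qed
  \<comment> \<open>For t < \<open>\<tau>\<close> the interval \<open>{\<tau>..t}\<close> is empty
    and the integral is 0; \<open>max\<close> reproduces this value from integrals with lower limit
    0.\<close>
  have "continuous_on {0..} (\<lambda>t. integral {0..max \<tau> t} \<phi> - integral {0..\<tau>} \<phi>)"
    by (intro continuous_on_diff continuous_on_const continuous_on_compose2[OF 0] continuous_intros) auto
  moreover have "integral {0..max \<tau> t} \<phi> - integral {0..\<tau>} \<phi> = integral {\<tau>..t} \<phi>" for t
  proof (cases "\<tau> \<le> t")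
    case True
    then show ?thesis
      using Henstock_Kurzweil_Integration.integral_combine[OF \<open>0 \<le> \<tau>\<close> True pw_continuous_integrable[OF \<phi> order_refl]]
      by (simp add: max_absorb2 algebra_simps)
  qed auto
  ultimately show ?thesis by simp
qed

lemma indefinite_integral_has_vector_derivative:
  fixes \<phi> :: "real \<Rightarrow> 'a::euclidean_space"
  assumes \<phi>: "pw_continuous \<phi>" and "0 \<le> \<tau>" "\<tau> \<le> t" and cont: "continuous (at t within {0..}) \<phi>"
  shows "((\<lambda>u. integral {\<tau>..u} \<phi>) has_vector_derivative \<phi> t) (at t within {\<tau>..})"
proof -
  have "continuous (at t within {\<tau>..t+1} - {}) \<phi>"
    using cont by (rule continuous_within_subset) (use assms in auto)
  then have "((\<lambda>u. integral {\<tau>..u} \<phi>) has_vector_derivative \<phi> t) (at t within {\<tau>..t+1} - {})"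
    using assms by (intro integral_has_vector_derivative_continuous_at pw_continuous_integrable) auto
  moreover have "at t within {\<tau>..t+1} = at t within {\<tau>..}"
    by (rule at_within_nhd[of _ "{..<t+1}"]) auto
  ultimately show ?thesis by simp
qed

text \<open>Letters are in the reverse of the order of \<open>ct_w\<close>: the first letter belongs to the
  outermost integral.\<close>

primrec iter_int :: "('a \<Rightarrow> real \<Rightarrow> real) \<Rightarrow> 'a list \<Rightarrow> real \<Rightarrow> real \<Rightarrow> real" where
  "iter_int f [] \<tau> t = 1"
| "iter_int f (a # s) \<tau> t = integral {\<tau>..t} (\<lambda>r. f a r * iter_int f s \<tau> r)"

lemma continuous_on_iter_int:
  assumes pw: "\<And>a. pw_continuous (f a)" and \<tau>: "0 \<le> \<tau>"
  shows "continuous_on {0..} (iter_int f s \<tau>)"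
proof (induction s)
  case (Cons a s)
  then show ?case
    using continuous_on_indefinite_integral[OF pw_continuous_mult[OF pw pw_continuous_continuous_on] \<tau>]
    by simp
qed simp

lemma pw_continuous_iter_int_integrand:
  assumes "\<And>a. pw_continuous (f a)" and "0 \<le> \<tau>"
  shows "pw_continuous (\<lambda>r. f a r * iter_int f s \<tau> r)"
  by (rule pw_continuous_mult[OF assms(1) pw_continuous_continuous_on[OF continuous_on_iter_int[OF assms]]])

text \<open>The inequality \<open>r < t\<close> is strict because a single time is negligible in
  every integral. This is what leaves the value of a signal at the final time free.\<close>

lemma iter_int_cong:
  assumes "\<And>a r. \<tau> \<le> r \<Longrightarrow> r < t \<Longrightarrow> f a r = g a r"
  shows "iter_int f s \<tau> t = iter_int g s \<tau> t"
  using assms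
proof (induction s arbitrary: t)
  case (Cons a s)
  have "f a r * iter_int f s \<tau> r = g a r * iter_int g s \<tau> r" if "r \<in> {\<tau>..t} - {t}" for r
    using that Cons.IH[of r] Cons.prems by auto
  then have "integral {\<tau>..t} (\<lambda>r. f a r * iter_int f s \<tau> r) = integral {\<tau>..t} (\<lambda>r. g a r * iter_int g s \<tau> r)"
    by (intro integral_spike[of "{t}"]) auto
  then show ?case by simp
qed simp

text \<open>The induction step shared by two factorial estimates: the size of iterated integrals and
  the bound on solutions of the homogeneous state equation.\<close>

lemma has_integral_power_over_fact:
  fixes M :: real
  assumes "\<tau> \<le> t"
  shows "((\<lambda>r. M * ((M * (r - \<tau>)) ^ n / fact n)) has_integral (M * (t - \<tau>)) ^ Suc n / fact (Suc n)) {\<tau>..t}"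
proof -
  let ?F = "\<lambda>r. (M * (r - \<tau>)) ^ Suc n / fact (Suc n)"
  have "((\<lambda>r. M * ((M * (r - \<tau>)) ^ n / fact n)) has_integral (?F t - ?F \<tau>)) {\<tau>..t}"
  proof (rule fundamental_theorem_of_calculus[OF assms])
    fix r
    have "(?F has_real_derivative (real (Suc n) * (M * (r - \<tau>)) ^ n * M / fact (Suc n))) (at r within {\<tau>..t})"
      by (rule derivative_eq_intros refl | simp)+
    also have "real (Suc n) * (M * (r - \<tau>)) ^ n * M / fact (Suc n) = M * ((M * (r - \<tau>)) ^ n / fact n)"
      by (simp add: field_simps del: of_nat_Suc)
    finally show "(?F has_vector_derivative M * ((M * (r - \<tau>)) ^ n / fact n)) (at r within {\<tau>..t})"
      by (simp add: has_real_derivative_iff_has_vector_derivative)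
  qed
  then show ?thesis by simp
qed

text \<open>The domain of integration is the simplex of ordered times between \<open>\<tau>\<close>
  and t, and the integrand is a product of one factor per letter.\<close>

lemma iter_int_bound:
  assumes pw: "\<And>a. pw_continuous (f a)" and M: "\<And>a r. r \<in> {0..T} \<Longrightarrow> \<bar>f a r\<bar> \<le> M"
    and "0 \<le> \<tau>" "\<tau> \<le> t" "t \<le> T"
  shows "\<bar>iter_int f s \<tau> t\<bar> \<le> (M * (t - \<tau>)) ^ length s / fact (length s)"
  using assms(4,5)
proof (induction s arbitrary: t)
  case (Cons a s)
  let ?n = "length s"
  have M0: "0 \<le> M" using M[of 0 undefined] \<open>0 \<le> \<tau>\<close> Cons.prems by auto
  let ?F = "\<lambda>r. (M * (r - \<tau>)) ^ Suc ?n / fact (Suc ?n)"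
  let ?F' = "\<lambda>r. M * ((M * (r - \<tau>)) ^ ?n / fact ?n)"
  have F: "(?F' has_integral ?F t) {\<tau>..t}"
    by (rule has_integral_power_over_fact[OF \<open>\<tau> \<le> t\<close>])
  have "norm (integral {\<tau>..t} (\<lambda>r. f a r * iter_int f s \<tau> r)) \<le> integral {\<tau>..t} ?F'"
  proof (rule integral_norm_bound_integral)
    show "(\<lambda>r. f a r * iter_int f s \<tau> r) integrable_on {\<tau>..t}"
      by (intro pw_continuous_integrable pw_continuous_iter_int_integrand pw \<open>0 \<le> \<tau>\<close>)
    show "?F' integrable_on {\<tau>..t}" using F by blast
    show "norm (f a r * iter_int f s \<tau> r) \<le> ?F' r" if "r \<in> {\<tau>..t}" for r
      unfolding real_norm_def abs_mult
      using that Cons.prems \<open>0 \<le> \<tau>\<close> M0 by (intro mult_mono M Cons.IH) auto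
  qed
  also have "\<dots> = ?F t" using F by (rule integral_unique)
  finally show ?case by simp
qed simp

section \<open>Convergence of series over words and termwise integration\<close>

text \<open>With N letters there are N^n words of length n, so every finite partial sum is at most
  exp (N X).\<close>

lemma summable_on_words:
  fixes X :: real
  assumes "0 \<le> X"
  shows "(\<lambda>s::'a::finite list. X ^ length s / fact (length s)) summable_on UNIV"
proof (rule nonneg_bdd_above_summable_on)
  let ?b = "\<lambda>s::'a list. X ^ length s / fact (length s)"
  show "bdd_above (sum ?b ` {F. F \<subseteq> UNIV \<and> finite F})"
  proof (rule bdd_aboveI2)
    fix F :: "'a list set" assume "F \<in> {F. F \<subseteq> UNIV \<and> finite F}"
    then have fin: "finite F" by simp
    define n where "n = Max (length ` F)"
    let ?N = "real (CARD('a))"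
    have "finite {s::'a list. length s \<le> n}"
      using finite_lists_length_le[of "UNIV :: 'a set" n] by simp
    then have "sum ?b F \<le> sum ?b {s. length s \<le> n}"
      using fin assms by (intro sum_mono2) (auto simp: n_def)
    also have "{s::'a list. length s \<le> n} = (\<Union>k\<le>n. {s. length s = k})" by auto
    also have "sum ?b \<dots> = (\<Sum>k\<le>n. \<Sum>s\<in>{s::'a list. length s = k}. ?b s)"
      using finite_lists_length_eq[of "UNIV :: 'a set"] by (intro sum.UNION_disjoint) auto
    also have "\<dots> = (\<Sum>k\<le>n. (?N * X) ^ k / fact k)"
      using card_lists_length_eq[of "UNIV :: 'a set"] by (intro sum.cong) (auto simp: power_mult_distrib)
    also have "\<dots> = (\<Sum>k<Suc n. inverse (fact k) * (?N * X) ^ k)"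
      by (simp add: lessThan_Suc_atMost field_simps)
    also have "\<dots> \<le> (\<Sum>k. inverse (fact k) * (?N * X) ^ k)"
      using assms by (intro sum_le_suminf summable_exp) auto
    finally show "sum ?b F \<le> (\<Sum>k. inverse (fact k) * (?N * X) ^ k)" .
  qed
qed (use assms in simp)

text \<open>The growth condition of \<open>exp_bounded\<close> for any alphabet and any normed value
  space. Strict positivity of the constants is dropped so that linear images and shifts inherit the
  condition directly.\<close>

definition geom_bounded :: "('a list \<Rightarrow> 'v::real_normed_vector) \<Rightarrow> bool" where
  "geom_bounded c \<longleftrightarrow> (\<exists>K R. 0 \<le> R \<and> (\<forall>s. norm (c s) \<le> K * R ^ length s))"

lemma geom_bounded_Cons:
  assumes "geom_bounded c"
  shows "geom_bounded (\<lambda>s. c (a # s))"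
proof -
  obtain K R where "0 \<le> R" "\<And>s. norm (c s) \<le> K * R ^ length s"
    using assms unfolding geom_bounded_def by blast
  then have "0 \<le> R" "\<And>s. norm (c (a # s)) \<le> (K * R) * R ^ length s"
    by (metis length_Cons mult.assoc power_Suc)+
  then show ?thesis unfolding geom_bounded_def by blast
qed

text \<open>One summable majorant serves all limits 0 \<le> \<tau> \<le> t \<le> T. The M-test needs
  this uniformity in the upper limit, and termwise integration of the convolution needs it in the
  lower one.\<close>

lemma iter_int_dominated:
  fixes f :: "'a::finite \<Rightarrow> real \<Rightarrow> real" and c :: "'a list \<Rightarrow> 'v::real_normed_vector"
  assumes pw: "\<And>a. pw_continuous (f a)" and c: "geom_bounded c"
  obtains m where "m summable_on UNIV"
    "\<And>s \<tau> t. \<lbrakk>0 \<le> \<tau>; \<tau> \<le> t; t \<le> T\<rbrakk> \<Longrightarrow> norm (iter_int f s \<tau> t *\<^sub>R c s) \<le> m s"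
    "\<And>s. 0 \<le> m s"
proof -
  obtain K R where R: "0 \<le> R" and K: "\<And>s. norm (c s) \<le> K * R ^ length s"
    using c unfolding geom_bounded_def by blast
  have K0: "0 \<le> K" using K[of "[]"] by (simp add: order_trans[OF norm_ge_zero])
  have "\<exists>M>0. \<forall>t\<in>{0..T}. norm (f a t) \<le> M" for a
    using pw_continuous_bounded[OF pw] by metis
  then obtain Ma where Ma: "\<And>a. 0 < Ma a" "\<And>a t. t \<in> {0..T} \<Longrightarrow> norm (f a t) \<le> Ma a" by metis
  define M where "M = (\<Sum>a\<in>UNIV. Ma a)"
  have "Ma a \<le> M" for a unfolding M_def using Ma(1) by (intro member_le_sum) (auto intro: less_imp_le)
  then have M: "\<bar>f a t\<bar> \<le> M" if "t \<in> {0..T}" for a t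
    using order_trans[OF Ma(2)[OF that]] by simp
  have M0: "0 \<le> M" unfolding M_def using Ma(1) by (intro sum_nonneg) (auto intro: less_imp_le)
  \<comment> \<open>Each letter contributes at most M |T| through its integral and R through the
    coefficient; the absolute value keeps the majorant nonnegative for every T.\<close>
  define X where "X = M * \<bar>T\<bar> * R"
  have X0: "0 \<le> X" unfolding X_def using M0 R by simp
  show ?thesis
  proof (rule that)
    show "(\<lambda>s::'a list. K * (X ^ length s / fact (length s))) summable_on UNIV"
      by (intro summable_on_cmult_right summable_on_words X0)
    show "0 \<le> K * (X ^ length s / fact (length s))" for s :: "'a list" using K0 X0 by simp
    fix s \<tau> t assume t: "0 \<le> \<tau>" "\<tau> \<le> t" "t \<le> T"
    have "norm (iter_int f s \<tau> t *\<^sub>R c s) \<le> (M * (t - \<tau>)) ^ length s / fact (length s) * (K * R ^ length s)"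
      unfolding norm_scaleR
      using M0 t by (intro mult_mono iter_int_bound[of f, OF pw M t] K) auto
    also have "\<dots> \<le> (M * \<bar>T\<bar>) ^ length s / fact (length s) * (K * R ^ length s)"
      using M0 t K0 R by (intro mult_right_mono divide_right_mono power_mono mult_left_mono) auto
    also have "\<dots> = K * (X ^ length s / fact (length s))"
      by (simp add: X_def power_mult_distrib)
    finally show "norm (iter_int f s \<tau> t *\<^sub>R c s) \<le> K * (X ^ length s / fact (length s))" .
  qed
qed

text \<open>By the M-test the finite partial sums converge uniformly along the net of finite
  subsets, and uniform limits pass through an integral over a bounded interval.\<close>

lemma infsum_integral:
  fixes \<phi> :: "'i \<Rightarrow> real \<Rightarrow> 'v::banach"
  assumes int: "\<And>i. \<phi> i integrable_on {a..b}"
    and bound: "\<And>i r. r \<in> {a..b} \<Longrightarrow> norm (\<phi> i r) \<le> m i" and m: "m summable_on UNIV"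
  shows "(\<lambda>r. \<Sum>\<^sub>\<infinity>i. \<phi> i r) integrable_on {a..b}"
    and "integral {a..b} (\<lambda>r. \<Sum>\<^sub>\<infinity>i. \<phi> i r) = (\<Sum>\<^sub>\<infinity>i. integral {a..b} (\<phi> i))"
proof -
  let ?g = "\<lambda>r. \<Sum>\<^sub>\<infinity>i. \<phi> i r"
  have lim: "uniform_limit {a..b} (\<lambda>X r. \<Sum>i\<in>X. \<phi> i r) ?g (finite_subsets_at_top UNIV)"
    using bound m by (intro Weierstrass_m_test_general) auto
  have fin: "eventually finite (finite_subsets_at_top (UNIV :: 'i set))"
    by (auto simp: eventually_finite_subsets_at_top)
  have close: "eventually (\<lambda>X. finite X \<and> (\<forall>r\<in>{a..b}. norm ((\<Sum>i\<in>X. \<phi> i r) - ?g r) < e)) (finite_subsets_at_top UNIV)"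
    if "0 < e" for e
    using eventually_conj[OF fin uniform_limitD[OF lim that]] by (simp add: dist_norm)
  have sint: "(\<lambda>r. \<Sum>i\<in>X. \<phi> i r) integrable_on {a..b}" if "finite X" for X
    using that int by (intro integrable_sum) auto
  show gint: "?g integrable_on {a..b}"
  proof (rule integrable_uniform_limit[of a b, simplified])
    fix e :: real assume "0 < e"
    then obtain X where "finite X" "\<forall>r\<in>{a..b}. norm ((\<Sum>i\<in>X. \<phi> i r) - ?g r) < e"
      using eventually_happens[OF close] by auto
    then show "\<exists>h. (\<forall>x\<in>{a..b}. norm (?g x - h x) \<le> e) \<and> h integrable_on {a..b}"
      by (intro exI[of _ "\<lambda>r. \<Sum>i\<in>X. \<phi> i r"]) (auto simp: norm_minus_commute sint less_imp_le)
  qed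
  have "((\<lambda>i. integral {a..b} (\<phi> i)) has_sum integral {a..b} ?g) UNIV"
    unfolding has_sum_def tendsto_iff dist_norm
  proof (intro allI impI)
    fix e :: real assume e: "0 < e"
    \<comment> \<open>The added 1 keeps the quotient meaningful when a = b and makes the final
      inequality strict.\<close>
    define d where "d = e / (\<bar>b - a\<bar> + 1)"
    have "0 < d" using e by (simp add: d_def)
    from close[OF this] show "eventually (\<lambda>X. norm ((\<Sum>i\<in>X. integral {a..b} (\<phi> i)) - integral {a..b} ?g) < e)
        (finite_subsets_at_top UNIV)"
    proof eventually_elim
      fix X assume X: "finite X \<and> (\<forall>r\<in>{a..b}. norm ((\<Sum>i\<in>X. \<phi> i r) - ?g r) < d)"
      have "(\<Sum>i\<in>X. integral {a..b} (\<phi> i)) - integral {a..b} ?g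
          = integral {a..b} (\<lambda>r. (\<Sum>i\<in>X. \<phi> i r) - ?g r)"
        using X int gint sint
        by (simp add: Henstock_Kurzweil_Integration.integral_sum Henstock_Kurzweil_Integration.integral_diff)
      also have "norm \<dots> \<le> integral {a..b} (\<lambda>r. d)"
        using X sint gint by (intro integral_norm_bound_integral integrable_diff) (auto simp: less_imp_le)
      also have "\<dots> \<le> d * \<bar>b - a\<bar>"
        using \<open>0 < d\<close> by (cases "a \<le> b") (auto simp: mult.commute)
      also have "\<dots> < e" using e by (simp add: d_def field_simps)
      finally show "norm ((\<Sum>i\<in>X. integral {a..b} (\<phi> i)) - integral {a..b} ?g) < e" .
    qed
  qed
  then show "integral {a..b} ?g = (\<Sum>\<^sub>\<infinity>i. integral {a..b} (\<phi> i))"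
    by (simp add: infsumI)
qed

text \<open>The algebraic half of \<open>series_integral_equation\<close>: the empty word yields the
  initial value, and each first letter yields one summand of the integrand.\<close>

lemma infsum_list:
  fixes \<phi> :: "'a::finite list \<Rightarrow> 'v::banach"
  assumes sm: "\<phi> summable_on UNIV"
  shows "infsum \<phi> UNIV = \<phi> [] + (\<Sum>a\<in>UNIV. \<Sum>\<^sub>\<infinity>s. \<phi> (a # s))"
proof -
  let ?C = "\<lambda>(a::'a, s). a # s"
  have inj: "inj ?C" by (auto simp: inj_on_def)
  have U: "(UNIV :: 'a list set) = {[]} \<union> range ?C"
    by (auto simp: image_iff) (metis list.exhaust)
  have sC: "\<phi> summable_on range ?C" using summable_on_subset_banach[OF sm] by blast
  then have s2: "(\<lambda>(a, s). \<phi> (a # s)) summable_on UNIV \<times> UNIV"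
    by (subst (asm) summable_on_reindex[OF inj]) (simp add: o_def case_prod_unfold)
  have "infsum \<phi> UNIV = infsum \<phi> {[]} + infsum \<phi> (range ?C)"
    unfolding U by (intro infsum_Un_disjoint sC) auto
  also have "infsum \<phi> (range ?C) = infsum (\<lambda>(a, s). \<phi> (a # s)) (UNIV \<times> UNIV)"
    by (subst infsum_reindex[OF inj]) (simp add: o_def case_prod_unfold)
  also have "\<dots> = infsum (\<lambda>a. infsum (\<lambda>s. \<phi> (a # s)) UNIV) UNIV"
    using infsum_Sigma'_banach[OF s2] by simp
  finally show ?thesis by simp
qed

text \<open>A Chen-Fliess series in the signals \<open>f\<close>, started at time 0.\<close>

definition series :: "('a \<Rightarrow> real \<Rightarrow> real) \<Rightarrow> ('a list \<Rightarrow> 'v::real_normed_vector) \<Rightarrow> real \<Rightarrow> 'v" where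
  "series f c t = (\<Sum>\<^sub>\<infinity>s. iter_int f s 0 t *\<^sub>R c s)"

lemma series_summable:
  fixes f :: "'a::finite \<Rightarrow> real \<Rightarrow> real" and c :: "'a list \<Rightarrow> 'v::banach"
  assumes pw: "\<And>a. pw_continuous (f a)" and c: "geom_bounded c" and t: "0 \<le> t"
  shows "(\<lambda>s. iter_int f s 0 t *\<^sub>R c s) summable_on UNIV"
proof -
  obtain m where m: "m summable_on UNIV" "\<And>s \<tau> r. \<lbrakk>0 \<le> \<tau>; \<tau> \<le> r; r \<le> t\<rbrakk> \<Longrightarrow> norm (iter_int f s \<tau> r *\<^sub>R c s) \<le> m s"
    "\<And>s. 0 \<le> m s"
    using iter_int_dominated[of f c t, OF pw c] by blast
  have "(\<lambda>s. norm (iter_int f s 0 t *\<^sub>R c s)) summable_on UNIV"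
    by (rule Infinite_Sum.abs_summable_on_comparison_test'[OF m(1)]) (use m(2)[of 0 t] t in auto)
  then show ?thesis by (rule abs_summable_summable)
qed

lemma continuous_on_series:
  fixes f :: "'a::finite \<Rightarrow> real \<Rightarrow> real" and c :: "'a list \<Rightarrow> 'v::banach"
  assumes pw: "\<And>a. pw_continuous (f a)" and c: "geom_bounded c"
  shows "continuous_on {0..} (series f c)"
  unfolding continuous_on_eq_continuous_within
proof
  fix t :: real assume t: "t \<in> {0..}"
  obtain m where m: "m summable_on UNIV" "\<And>s \<tau> r. \<lbrakk>0 \<le> \<tau>; \<tau> \<le> r; r \<le> t + 1\<rbrakk> \<Longrightarrow> norm (iter_int f s \<tau> r *\<^sub>R c s) \<le> m s"
    "\<And>s. 0 \<le> m s"
    using iter_int_dominated[of f c "t + 1", OF pw c] by blast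
  have "uniform_limit {0..t+1} (\<lambda>X r. \<Sum>s\<in>X. iter_int f s 0 r *\<^sub>R c s) (series f c) (finite_subsets_at_top UNIV)"
    unfolding series_def using m by (intro Weierstrass_m_test_general) auto
  moreover have "continuous_on {0..t+1} (\<lambda>r. \<Sum>s\<in>X. iter_int f s 0 r *\<^sub>R c s)" for X
    by (intro continuous_intros continuous_on_subset[OF continuous_on_iter_int[OF pw order_refl]]) auto
  ultimately have "continuous_on {0..t+1} (series f c)"
    by (intro uniform_limit_theorem) (auto intro: always_eventually)
  then have "continuous (at t within {0..t+1}) (series f c)"
    using t by (auto simp: continuous_on_eq_continuous_within)
  moreover have "at t within {0..t+1} = at t within {0..}"
    by (rule at_within_nhd[of _ "{..<t+1}"]) auto
  ultimately show "continuous (at t within {0..}) (series f c)" by simp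
qed

text \<open>The first letter belongs to the outermost integral, so differentiating the series
  deletes first letters. Applied to the coefficients of the state, this becomes the state equation;
  applied to a vanishing series, it is the step of the uniqueness proof.\<close>

lemma series_integral_equation:
  fixes f :: "'a::finite \<Rightarrow> real \<Rightarrow> real" and c :: "'a list \<Rightarrow> 'v::euclidean_space"
  assumes pw: "\<And>a. pw_continuous (f a)" and c: "geom_bounded c" and t: "0 \<le> t"
  shows "series f c t = c [] + integral {0..t} (\<lambda>r. \<Sum>a\<in>UNIV. f a r *\<^sub>R series f (\<lambda>s. c (a # s)) r)"
proof -
  have int: "(\<lambda>r. f a r *\<^sub>R series f (\<lambda>s. c (a # s)) r) integrable_on {0..t}" for a
    by (intro pw_continuous_integrable pw_continuous_scaleR pw pw_continuous_continuous_on
        continuous_on_series geom_bounded_Cons c order_refl)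
  have tail: "(\<Sum>\<^sub>\<infinity>s. iter_int f (a # s) 0 t *\<^sub>R c (a # s)) = integral {0..t} (\<lambda>r. f a r *\<^sub>R series f (\<lambda>s. c (a # s)) r)" for a
  proof -
    obtain m where m: "m summable_on UNIV"
      "\<And>s \<tau> r. \<lbrakk>0 \<le> \<tau>; \<tau> \<le> r; r \<le> t\<rbrakk> \<Longrightarrow> norm (iter_int f s \<tau> r *\<^sub>R c (a # s)) \<le> m s"
      "\<And>s. 0 \<le> m s"
      using iter_int_dominated[of f "\<lambda>s. c (a # s)" t, OF pw geom_bounded_Cons[OF c]] by blast
    obtain M where M: "0 < M" "\<And>r. r \<in> {0..t} \<Longrightarrow> norm (f a r) \<le> M"
      using pw_continuous_bounded[OF pw[of a], of t] by blast
    let ?\<phi> = "\<lambda>s r. f a r *\<^sub>R (iter_int f s 0 r *\<^sub>R c (a # s))"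
    have \<phi>int: "?\<phi> s integrable_on {0..t}" for s
      by (rule pw_continuous_integrable[OF pw_continuous_scaleR[OF pw pw_continuous_continuous_on] order_refl])
        (intro continuous_on_scaleR continuous_on_iter_int[OF pw] continuous_on_const order_refl)
    have bnd: "norm (?\<phi> s r) \<le> M * m s" if "r \<in> {0..t}" for s r
      unfolding norm_scaleR[of "f a r"]
      using M(1) that by (intro mult_mono M(2)[unfolded real_norm_def] m(2)) auto
    have eq: "(\<Sum>\<^sub>\<infinity>s. ?\<phi> s r) = f a r *\<^sub>R series f (\<lambda>s. c (a # s)) r" for r
      unfolding series_def by (rule infsum_scaleR_right)
    have "integral {0..t} (\<lambda>r. f a r *\<^sub>R series f (\<lambda>s. c (a # s)) r) = (\<Sum>\<^sub>\<infinity>s. integral {0..t} (?\<phi> s))"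
      unfolding eq[symmetric]
      by (rule infsum_integral(2)[OF \<phi>int bnd summable_on_cmult_right[OF m(1)]])
    also have "\<dots> = (\<Sum>\<^sub>\<infinity>s. iter_int f (a # s) 0 t *\<^sub>R c (a # s))"
    proof (rule infsum_cong)
      fix s
      have "(\<lambda>r. f a r * iter_int f s 0 r) integrable_on {0..t}"
        by (rule pw_continuous_integrable[OF pw_continuous_iter_int_integrand[OF pw order_refl] order_refl])
      from integral_unique[OF has_integral_scaleR_left[OF integrable_integral[OF this]]]
      show "integral {0..t} (?\<phi> s) = iter_int f (a # s) 0 t *\<^sub>R c (a # s)"
        by simp
    qed
    finally show ?thesis by simp
  qed
  show ?thesis
    unfolding series_def[of f c] infsum_list[OF series_summable[OF pw c t]] tail
    using int by (subst Henstock_Kurzweil_Integration.integral_sum) auto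
qed

lemma series_cong:
  assumes "\<And>a r. 0 \<le> r \<Longrightarrow> r < t \<Longrightarrow> f a r = g a r"
  shows "series f c t = series g c t"
  unfolding series_def using iter_int_cong[of 0 t f g, OF assms] by simp

lemma series_zero: "series f c 0 = c []"
proof -
  have "iter_int f s 0 0 = 0" if "s \<noteq> []" for s
    using that by (cases s) auto
  then have "series f c 0 = (\<Sum>\<^sub>\<infinity>s\<in>{[]}. c s)"
    unfolding series_def by (intro infsum_cong_neutral) auto
  then show ?thesis by simp
qed

lemma series_bounded_linear:
  fixes f :: "'a::finite \<Rightarrow> real \<Rightarrow> real" and c :: "'a list \<Rightarrow> 'v::banach"
  assumes pw: "\<And>a. pw_continuous (f a)" and c: "geom_bounded c" and t: "0 \<le> t" and L: "bounded_linear L"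
  shows "series f (\<lambda>s. L (c s)) t = L (series f c t)"
proof -
  have "((\<lambda>s. L (iter_int f s 0 t *\<^sub>R c s)) has_sum L (series f c t)) UNIV"
    unfolding series_def by (rule has_sum_bounded_linear[OF L has_sum_infsum[OF series_summable[OF pw c t]]])
  from infsumI[OF this] show ?thesis
    unfolding series_def[of f "\<lambda>s. L (c s)"] linear_cmul[OF bounded_linear.linear[OF L]] .
qed

lemma series_diff:
  fixes f :: "'a::finite \<Rightarrow> real \<Rightarrow> real" and c d :: "'a list \<Rightarrow> 'v::banach"
  assumes pw: "\<And>a. pw_continuous (f a)" and c: "geom_bounded c" and d: "geom_bounded d" and t: "0 \<le> t"
  shows "series f (\<lambda>s. c s - d s) t = series f c t - series f d t"
proof -
  have "((\<lambda>s. - (iter_int f s 0 t *\<^sub>R d s)) has_sum - series f d t) UNIV"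
    unfolding series_def has_sum_uminus minus_minus by (rule has_sum_infsum[OF series_summable[OF pw d t]])
  with has_sum_infsum[OF series_summable[OF pw c t]]
  have "((\<lambda>s. iter_int f s 0 t *\<^sub>R c s + - (iter_int f s 0 t *\<^sub>R d s)) has_sum (series f c t + - series f d t)) UNIV"
    unfolding series_def by (rule has_sum_add)
  from infsumI[OF this] show ?thesis
    unfolding series_def[of f "\<lambda>s. c s - d s"] by (simp add: scaleR_diff_right)
qed

section \<open>Integration over the lower limit\<close>

text \<open>Both sides integrate \<phi>(r) \<psi>(\<delta>) over the triangle \<tau> \<le> \<delta>
  \<le> r \<le> t. For such a product the exchange is integration by parts for the primitives
  \<open>?U\<close> and \<open>?V\<close>.\<close>

lemma integral_triangle_swap:
  fixes \<phi> \<psi> :: "real \<Rightarrow> real"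
  assumes \<phi>: "pw_continuous \<phi>" and \<psi>: "pw_continuous \<psi>" and t: "0 \<le> \<tau>" "\<tau> \<le> t"
  shows "integral {\<tau>..t} (\<lambda>\<delta>. integral {\<delta>..t} \<phi> * \<psi> \<delta>) = integral {\<tau>..t} (\<lambda>r. \<phi> r * integral {\<tau>..r} \<psi>)"
proof -
  let ?U = "\<lambda>r. integral {\<tau>..r} \<phi>" and ?V = "\<lambda>r. integral {\<tau>..r} \<psi>"
  \<comment> \<open>The primitives are known to be differentiable only off this finite set, while
    their product is continuous across it, which is enough for the fundamental theorem.\<close>
  define D where "D = {r \<in> {\<tau>..t}. \<not> continuous (at r within {0..}) \<phi>} \<union> {r \<in> {\<tau>..t}. \<not> continuous (at r within {0..}) \<psi>}"
  have cU: "continuous_on {0..} ?U" and cV: "continuous_on {0..} ?V"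
    by (rule continuous_on_indefinite_integral[OF \<phi> t(1)], rule continuous_on_indefinite_integral[OF \<psi> t(1)])
  have "((\<lambda>r. ?U r * \<psi> r + \<phi> r * ?V r) has_integral (?U t * ?V t - ?U \<tau> * ?V \<tau>)) {\<tau>..t}"
  proof (rule fundamental_theorem_of_calculus_interior_strong)
    show "finite D" unfolding D_def using pw_continuous_finite[OF \<phi> t(1)] pw_continuous_finite[OF \<psi> t(1)] by simp
    show "continuous_on {\<tau>..t} (\<lambda>r. ?U r * ?V r)"
      using cU cV t(1) by (intro continuous_on_mult; elim continuous_on_subset) auto
    fix x assume x: "x \<in> {\<tau><..<t} - D"
    have "at x within {\<tau>..} = at x" using x by (intro at_within_interior) auto
    then have "(?U has_vector_derivative \<phi> x) (at x)" "(?V has_vector_derivative \<psi> x) (at x)"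
      using indefinite_integral_has_vector_derivative[OF \<phi> t(1), of x]
        indefinite_integral_has_vector_derivative[OF \<psi> t(1), of x] x by (auto simp: D_def)
    then show "((\<lambda>r. ?U r * ?V r) has_vector_derivative (?U x * \<psi> x + \<phi> x * ?V x)) (at x)"
      by (rule has_vector_derivative_mult)
  qed (use t in auto)
  moreover have i1: "(\<lambda>r. ?U r * \<psi> r) integrable_on {\<tau>..t}" and i2: "(\<lambda>r. \<phi> r * ?V r) integrable_on {\<tau>..t}"
    by (rule pw_continuous_integrable[OF pw_continuous_mult[OF pw_continuous_continuous_on[OF cU] \<psi>] t(1)],
        rule pw_continuous_integrable[OF pw_continuous_mult[OF \<phi> pw_continuous_continuous_on[OF cV]] t(1)])
  ultimately have eq: "integral {\<tau>..t} (\<lambda>r. ?U r * \<psi> r) + integral {\<tau>..t} (\<lambda>r. \<phi> r * ?V r) = ?U t * ?V t"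
    by (simp add: integral_unique Henstock_Kurzweil_Integration.integral_add[symmetric])
  have "integral {\<delta>..t} \<phi> * \<psi> \<delta> = ?U t * \<psi> \<delta> - ?U \<delta> * \<psi> \<delta>" if "\<delta> \<in> {\<tau>..t}" for \<delta>
    using Henstock_Kurzweil_Integration.integral_combine[of \<tau> \<delta> t \<phi>] pw_continuous_integrable[OF \<phi> t(1)] that
    by (auto simp: algebra_simps simp flip: distrib_left)
  then have "integral {\<tau>..t} (\<lambda>\<delta>. integral {\<delta>..t} \<phi> * \<psi> \<delta>) = integral {\<tau>..t} (\<lambda>\<delta>. ?U t * \<psi> \<delta> - ?U \<delta> * \<psi> \<delta>)"
    by (intro Henstock_Kurzweil_Integration.integral_cong) auto
  also have "\<dots> = ?U t * ?V t - integral {\<tau>..t} (\<lambda>\<delta>. ?U \<delta> * \<psi> \<delta>)"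
    using i1 pw_continuous_integrable[OF \<psi> t(1)] by (subst Henstock_Kurzweil_Integration.integral_diff) (auto intro: integrable_on_mult_right)
  finally show ?thesis using eq by simp
qed

text \<open>Splitting the two limits into separate factors reduces the exchange of integrals in
  \<open>iter_int_snoc\<close> to product integrands, and shows that an iterated integral is well
  behaved in its lower limit.\<close>

lemma iter_int_separable:
  assumes pw: "\<And>a. pw_continuous (f a)"
  shows "\<exists>(n::nat) \<alpha> \<beta>. (\<forall>k. continuous_on {0..} (\<alpha> k)) \<and> (\<forall>k. continuous_on {0..} (\<beta> k)) \<and>
    (\<forall>\<tau> t. 0 \<le> \<tau> \<longrightarrow> \<tau> \<le> t \<longrightarrow> iter_int f s \<tau> t = (\<Sum>k<n. \<alpha> k t * \<beta> k \<tau>))"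
proof (induction s)
  case Nil
  show ?case
    by (rule exI[of _ 1], rule exI[of _ "\<lambda>_ _. 1"], rule exI[of _ "\<lambda>_ _. 1"]) auto
next
  case (Cons a s)
  then obtain n :: nat and \<alpha> \<beta> where \<alpha>: "\<And>k. continuous_on {0..} (\<alpha> k)" and \<beta>: "\<And>k. continuous_on {0..} (\<beta> k)"
    and eq: "\<And>\<tau> t. 0 \<le> \<tau> \<Longrightarrow> \<tau> \<le> t \<Longrightarrow> iter_int f s \<tau> t = (\<Sum>k<n. \<alpha> k t * \<beta> k \<tau>)"
    by blast
  define A where "A k t = integral {0..t} (\<lambda>r. f a r * \<alpha> k r)" for k t
  have pwA: "pw_continuous (\<lambda>r. f a r * \<alpha> k r)" for k
    by (intro pw_continuous_mult pw pw_continuous_continuous_on \<alpha>)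
  have cA: "continuous_on {0..} (A k)" for k
    unfolding A_def by (intro continuous_on_indefinite_integral pwA order_refl)
  \<comment> \<open>The integral from \<open>\<tau>\<close> to t is a difference of values of
    \<open>A k\<close> at t and at \<open>\<tau>\<close>. The terms at \<open>\<tau>\<close> depend
    on \<open>\<tau>\<close> alone and are collected in one extra product, of index n and with first
    factor 1.\<close>
  define \<alpha>' where "\<alpha>' k = (if k < n then A k else (\<lambda>_. 1))" for k
  define \<beta>' where "\<beta>' k = (if k < n then \<beta> k else (\<lambda>\<tau>. - (\<Sum>j<n. A j \<tau> * \<beta> j \<tau>)))" for k
  have "iter_int f (a # s) \<tau> t = (\<Sum>k<Suc n. \<alpha>' k t * \<beta>' k \<tau>)" if \<tau>: "0 \<le> \<tau>" "\<tau> \<le> t" for \<tau> t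
  proof -
    have "iter_int f (a # s) \<tau> t = integral {\<tau>..t} (\<lambda>r. \<Sum>k<n. (f a r * \<alpha> k r) * \<beta> k \<tau>)"
      unfolding iter_int.simps
      using \<tau> by (intro Henstock_Kurzweil_Integration.integral_cong) (auto simp: eq sum_distrib_left mult.assoc)
    also have "\<dots> = (\<Sum>k<n. integral {\<tau>..t} (\<lambda>r. f a r * \<alpha> k r) * \<beta> k \<tau>)"
      using \<tau> by (subst Henstock_Kurzweil_Integration.integral_sum)
        (auto intro!: integrable_on_mult_left pw_continuous_integrable pwA)
    also have "\<dots> = (\<Sum>k<n. (A k t - A k \<tau>) * \<beta> k \<tau>)"
      using Henstock_Kurzweil_Integration.integral_combine[OF \<tau> pw_continuous_integrable[OF pwA order_refl]]
      by (intro sum.cong) (auto simp: A_def algebra_simps simp flip: distrib_left)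
    also have "\<dots> = (\<Sum>k<Suc n. \<alpha>' k t * \<beta>' k \<tau>)"
      by (simp add: \<alpha>'_def \<beta>'_def left_diff_distrib sum_subtractf)
    finally show ?thesis .
  qed
  moreover have "continuous_on {0..} (\<alpha>' k)" "continuous_on {0..} (\<beta>' k)" for k
    unfolding \<alpha>'_def \<beta>'_def using cA \<beta> by (auto intro!: continuous_intros)
  ultimately show ?case by blast
qed

text \<open>\<open>iter_int\<close> recurses on the outermost letter, but the input of a convolution
  enters at the inner end; integrating over the lower limit supplies that innermost letter. In the
  induction, \<open>integral_triangle_swap\<close> pulls the outermost letter out of the integral
  over \<open>\<delta>\<close>, and the hypothesis applies to what remains inside.\<close>

lemma iter_int_snoc:
  assumes pw: "\<And>a. pw_continuous (f a)" and t: "0 \<le> \<tau>" "\<tau> \<le> t"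
  shows "integral {\<tau>..t} (\<lambda>\<delta>. iter_int f s \<delta> t * f b \<delta>) = iter_int f (s @ [b]) \<tau> t"
  using t(2)
proof (induction s arbitrary: t)
  case Nil
  then show ?case by simp
next
  case (Cons a s)
  obtain n :: nat and \<alpha> \<beta> where \<alpha>: "\<And>k. continuous_on {0..} (\<alpha> k)" and \<beta>: "\<And>k. continuous_on {0..} (\<beta> k)"
    and eq: "\<And>\<tau> t. 0 \<le> \<tau> \<Longrightarrow> \<tau> \<le> t \<Longrightarrow> iter_int f s \<tau> t = (\<Sum>k<n. \<alpha> k t * \<beta> k \<tau>)"
    using iter_int_separable[of f s, OF pw] by blast
  have p1: "pw_continuous (\<lambda>r. f a r * \<alpha> k r)" for k
    by (intro pw_continuous_mult pw pw_continuous_continuous_on \<alpha>)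
  have p2: "pw_continuous (\<lambda>\<delta>. \<beta> k \<delta> * f b \<delta>)" for k
    by (rule pw_continuous_mult[OF pw_continuous_continuous_on[OF \<beta>] pw])
  have c1: "continuous_on {0..t} (\<lambda>\<delta>. integral {\<delta>..t} (\<lambda>r. f a r * \<alpha> k r))" for k
    by (rule indefinite_integral_continuous_1'[OF pw_continuous_integrable[OF p1 order_refl]])
  have i1: "(\<lambda>\<delta>. integral {\<delta>..t} (\<lambda>r. f a r * \<alpha> k r) * (\<beta> k \<delta> * f b \<delta>)) integrable_on {\<tau>..t}" for k
  proof -
    \<comment> \<open>Regularity is available for integrals as functions of the upper limit, so the
      one over \<open>{\<delta>..t}\<close> is rewritten as a difference of two integrals starting
      at 0.\<close>
    have "pw_continuous (\<lambda>\<delta>. (integral {0..t} (\<lambda>r. f a r * \<alpha> k r) - integral {0..\<delta>} (\<lambda>r. f a r * \<alpha> k r)) * (\<beta> k \<delta> * f b \<delta>))"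
      by (intro pw_continuous_mult[OF pw_continuous_continuous_on p2] continuous_on_diff continuous_on_const
          continuous_on_indefinite_integral p1 order_refl)
    from pw_continuous_integrable[OF this t(1)] show ?thesis
    proof (rule integrable_eq)
      fix \<delta> assume "\<delta> \<in> {\<tau>..t}"
      then show "(integral {0..t} (\<lambda>r. f a r * \<alpha> k r) - integral {0..\<delta>} (\<lambda>r. f a r * \<alpha> k r)) * (\<beta> k \<delta> * f b \<delta>)
        = integral {\<delta>..t} (\<lambda>r. f a r * \<alpha> k r) * (\<beta> k \<delta> * f b \<delta>)"
        using Henstock_Kurzweil_Integration.integral_combine[of 0 \<delta> t "\<lambda>r. f a r * \<alpha> k r"] t(1)
          pw_continuous_integrable[OF p1 order_refl] by auto
    qed
  qed
  have c2: "continuous_on {0..} (\<lambda>r. integral {\<tau>..r} (\<lambda>\<delta>. \<beta> k \<delta> * f b \<delta>))" for k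
    by (intro continuous_on_indefinite_integral p2 t)
  have "integral {\<tau>..t} (\<lambda>\<delta>. iter_int f (a # s) \<delta> t * f b \<delta>)
      = integral {\<tau>..t} (\<lambda>\<delta>. \<Sum>k<n. integral {\<delta>..t} (\<lambda>r. f a r * \<alpha> k r) * (\<beta> k \<delta> * f b \<delta>))"
  proof (intro Henstock_Kurzweil_Integration.integral_cong)
    fix \<delta> assume "\<delta> \<in> {\<tau>..t}"
    then have \<delta>: "0 \<le> \<delta>" using t(1) by simp
    have "iter_int f (a # s) \<delta> t = integral {\<delta>..t} (\<lambda>r. \<Sum>k<n. (f a r * \<alpha> k r) * \<beta> k \<delta>)"
      unfolding iter_int.simps
      using \<delta> by (intro Henstock_Kurzweil_Integration.integral_cong) (auto simp: eq sum_distrib_left mult.assoc)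
    also have "\<dots> = (\<Sum>k<n. integral {\<delta>..t} (\<lambda>r. f a r * \<alpha> k r) * \<beta> k \<delta>)"
      using \<delta> by (subst Henstock_Kurzweil_Integration.integral_sum)
        (auto intro!: integrable_on_mult_left pw_continuous_integrable p1)
    finally show "iter_int f (a # s) \<delta> t * f b \<delta> = (\<Sum>k<n. integral {\<delta>..t} (\<lambda>r. f a r * \<alpha> k r) * (\<beta> k \<delta> * f b \<delta>))"
      by (simp add: sum_distrib_right mult.assoc)
  qed
  also have "\<dots> = (\<Sum>k<n. integral {\<tau>..t} (\<lambda>\<delta>. integral {\<delta>..t} (\<lambda>r. f a r * \<alpha> k r) * (\<beta> k \<delta> * f b \<delta>)))"
    by (intro Henstock_Kurzweil_Integration.integral_sum i1) auto
  also have "\<dots> = (\<Sum>k<n. integral {\<tau>..t} (\<lambda>r. (f a r * \<alpha> k r) * integral {\<tau>..r} (\<lambda>\<delta>. \<beta> k \<delta> * f b \<delta>)))"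
    by (intro sum.cong refl integral_triangle_swap p1 p2 t(1) Cons.prems)
  also have "\<dots> = integral {\<tau>..t} (\<lambda>r. \<Sum>k<n. (f a r * \<alpha> k r) * integral {\<tau>..r} (\<lambda>\<delta>. \<beta> k \<delta> * f b \<delta>))"
    by (intro Henstock_Kurzweil_Integration.integral_sum[symmetric] pw_continuous_integrable t(1)
        pw_continuous_mult[OF p1 pw_continuous_continuous_on] c2) auto
  also have "\<dots> = integral {\<tau>..t} (\<lambda>r. f a r * iter_int f (s @ [b]) \<tau> r)"
  proof (intro Henstock_Kurzweil_Integration.integral_cong)
    fix r assume r: "r \<in> {\<tau>..t}"
    have "iter_int f (s @ [b]) \<tau> r = integral {\<tau>..r} (\<lambda>\<delta>. iter_int f s \<delta> r * f b \<delta>)"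
      using Cons.IH r by simp
    also have "\<dots> = integral {\<tau>..r} (\<lambda>\<delta>. \<Sum>k<n. \<alpha> k r * (\<beta> k \<delta> * f b \<delta>))"
      using t(1) by (intro Henstock_Kurzweil_Integration.integral_cong) (auto simp: eq sum_distrib_right mult.assoc)
    also have "\<dots> = (\<Sum>k<n. \<alpha> k r * integral {\<tau>..r} (\<lambda>\<delta>. \<beta> k \<delta> * f b \<delta>))"
      by (subst Henstock_Kurzweil_Integration.integral_sum)
        (auto intro!: integrable_on_mult_right pw_continuous_integrable p2 t(1))
    finally show "(\<Sum>k<n. (f a r * \<alpha> k r) * integral {\<tau>..r} (\<lambda>\<delta>. \<beta> k \<delta> * f b \<delta>)) = f a r * iter_int f (s @ [b]) \<tau> r"
      by (simp add: sum_distrib_left mult.assoc)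
  qed
  finally show ?case by simp
qed

lemma iter_int_lower_integrable:
  assumes pw: "\<And>a. pw_continuous (f a)" and g: "pw_continuous g" and \<tau>: "0 \<le> \<tau>"
  shows "(\<lambda>\<delta>. iter_int f s \<delta> t * g \<delta>) integrable_on {\<tau>..t}"
proof -
  obtain n :: nat and \<alpha> \<beta> where \<alpha>: "\<And>k. continuous_on {0..} (\<alpha> k)" and \<beta>: "\<And>k. continuous_on {0..} (\<beta> k)"
    and eq: "\<And>\<tau> t. 0 \<le> \<tau> \<Longrightarrow> \<tau> \<le> t \<Longrightarrow> iter_int f s \<tau> t = (\<Sum>k<n. \<alpha> k t * \<beta> k \<tau>)"
    using iter_int_separable[of f s, OF pw] by blast
  have "pw_continuous (\<lambda>\<delta>. (\<Sum>k<n. \<alpha> k t * \<beta> k \<delta>) * g \<delta>)"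
    using \<beta> by (intro pw_continuous_mult[OF pw_continuous_continuous_on g] continuous_intros) auto
  from pw_continuous_integrable[OF this \<tau>] show ?thesis
    by (rule integrable_eq) (use \<tau> in \<open>auto simp: eq\<close>)
qed

text \<open>Signals enter only through two properties: the family is closed under switching to
  constant letter values from \<open>Q\<close>, and these values are rich enough that only the zero
  family of vectors satisfies all linear relations given by them. The coefficients \<open>c\<close>
  vary in the induction since deleting a letter replaces them by a shift.\<close>

lemma series_eq_zeroD:
  fixes \<F> :: "('a::finite \<Rightarrow> real \<Rightarrow> real) set" and c :: "'a list \<Rightarrow> 'v::euclidean_space"
  assumes pw: "\<And>f a. f \<in> \<F> \<Longrightarrow> pw_continuous (f a)"
    and ne: "\<F> \<noteq> {}"
    and switch: "\<And>f q t. \<lbrakk>f \<in> \<F>; q \<in> Q; 0 \<le> t\<rbrakk> \<Longrightarrow> (\<lambda>a r. if r \<le> t then f a r else q a) \<in> \<F>"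
    and span: "\<And>(\<beta> :: 'a \<Rightarrow> 'v) a. (\<And>q. q \<in> Q \<Longrightarrow> (\<Sum>a\<in>UNIV. q a *\<^sub>R \<beta> a) = 0) \<Longrightarrow> \<beta> a = 0"
    and c: "geom_bounded c"
    and zero: "\<And>f t. \<lbrakk>f \<in> \<F>; 0 \<le> t\<rbrakk> \<Longrightarrow> series f c t = 0"
  shows "c s = 0"
  using c zero
proof (induction s arbitrary: c)
  case Nil
  then show ?case using ne series_zero by (metis ex_in_conv order_refl)
next
  case (Cons a s)
  let ?d = "\<lambda>a s. c (a # s)"
  have d: "geom_bounded (?d a)" for a by (rule geom_bounded_Cons[OF Cons.prems(1)])
  have "series f (?d a) t = 0" if f: "f \<in> \<F>" and t: "0 \<le> t" for f t a
  proof (rule span[of "\<lambda>a. series f (?d a) t" for a])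
    fix q assume q: "q \<in> Q"
    define f' where "f' = (\<lambda>a r. if r \<le> t then f a r else q a)"
    have f': "f' \<in> \<F>" unfolding f'_def by (rule switch[OF f q t])
    define \<phi> where "\<phi> r = (\<Sum>a\<in>UNIV. f' a r *\<^sub>R series f' (?d a) r)" for r
    \<comment> \<open>\<open>\<phi>\<close> may jump at t. \<open>\<psi>\<close> takes the new
      letter values already at t, so it is continuous and still has the same integrals over
      intervals starting at t.\<close>
    define \<psi> where "\<psi> r = (\<Sum>a\<in>UNIV. q a *\<^sub>R series f' (?d a) r)" for r
    have c\<psi>: "continuous_on {0..} \<psi>"
      unfolding \<psi>_def by (intro continuous_intros continuous_on_series pw f' d)
    have \<phi>int: "\<phi> integrable_on {0..h}" for h
      unfolding \<phi>_def by (intro integrable_sum pw_continuous_integrable pw_continuous_scaleR pw f'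
        pw_continuous_continuous_on continuous_on_series d order_refl) auto
    \<comment> \<open>The series is zero at every h, so the integral in its equation does not depend
      on h.\<close>
    have int0: "integral {0..h} \<phi> = - c []" if "0 \<le> h" for h
      using series_integral_equation[OF pw[OF f'] Cons.prems(1) that] Cons.prems(2)[OF f' that]
      unfolding \<phi>_def by (simp add: eq_neg_iff_add_eq_0 add.commute)
    have zero: "integral {t..h} \<psi> = 0" if h: "t \<le> h" for h
    proof -
      have "integral {t..h} \<psi> = integral {t..h} \<phi>"
        by (rule integral_spike[of "{t}"]) (auto simp: \<phi>_def \<psi>_def f'_def)
      moreover have "integral {0..t} \<phi> + integral {t..h} \<phi> = integral {0..h} \<phi>"
        by (rule Henstock_Kurzweil_Integration.integral_combine[OF t h \<phi>int])
      ultimately show ?thesis using int0[of t] int0[of h] t h by simp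
    qed
    have "((\<lambda>h. integral {t..h} \<psi>) has_vector_derivative \<psi> t) (at t within {t..t+1})"
      using t by (intro integral_has_vector_derivative continuous_on_subset[OF c\<psi>]) auto
    moreover have "((\<lambda>h. integral {t..h} \<psi>) has_vector_derivative 0) (at t within {t..t+1})"
      by (rule has_vector_derivative_transform[OF _ _ has_vector_derivative_const[of 0]]) (auto simp: zero)
    ultimately have "\<psi> t = 0"
      using vector_derivative_unique_within_closed_interval[of t "t + 1" t] by auto
    moreover have "series f' (?d a) t = series f (?d a) t" for a
      by (rule series_cong) (simp add: f'_def)
    ultimately show "(\<Sum>a\<in>UNIV. q a *\<^sub>R series f (?d a) t) = 0" by (simp add: \<psi>_def)
  qed
  from Cons.IH[OF d this] show ?case by simp
qed

section \<open>Matrix identities and stability of geometric bounds\<close>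

lemma linear_matrix_vector_left: "linear (\<lambda>M :: real ^ 'n ^ 'm. M *v x)"
  by (intro linearI) (simp_all add: matrix_vector_mult_add_rdistrib scaleR_matrix_vector_assoc)

lemma linear_column: "linear (column l :: real ^ 'n ^ 'm \<Rightarrow> real ^ 'm)"
  by (intro linearI) (simp_all add: column_def vec_eq_iff)

lemma column_matrix_mult: "column l (M ** N) = M *v column l (N :: real ^ 'n ^ 'm)"
  by (simp add: column_def vec_eq_iff matrix_matrix_mult_def matrix_vector_mult_def)

lemma matrix_eq_columns: "(\<And>l. column l M = column l N) \<Longrightarrow> M = (N :: real ^ 'n ^ 'm)"
  by (simp add: column_def vec_eq_iff)

lemma affine_mat_eq_sum: "affine_mat M v = (\<Sum>i\<in>UNIV. pcomp i v *\<^sub>R M i)"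
  by (simp add: affine_mat_def UNIV_option_conv sum.reindex)

lemma geom_bounded_bounded_linear:
  assumes L: "bounded_linear L" and c: "geom_bounded c"
  shows "geom_bounded (\<lambda>s. L (c s))"
proof -
  obtain K R where R: "0 \<le> R" and K: "\<And>s. norm (c s) \<le> K * R ^ length s"
    using c unfolding geom_bounded_def by blast
  obtain B where B: "0 < B" "\<And>x. norm (L x) \<le> norm x * B"
    using bounded_linear.pos_bounded[OF L] by blast
  have "norm (L (c s)) \<le> (K * B) * R ^ length s" for s
  proof -
    have "norm (L (c s)) \<le> norm (c s) * B" by (rule B)
    also have "\<dots> \<le> (K * R ^ length s) * B" using K B by (intro mult_right_mono) auto
    finally show ?thesis by (simp add: mult_ac)
  qed
  with R show ?thesis unfolding geom_bounded_def by blast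
qed

lemma geom_bounded_linear:
  fixes L :: "'v::euclidean_space \<Rightarrow> 'w::real_normed_vector"
  assumes "linear L" and "geom_bounded c"
  shows "geom_bounded (\<lambda>s. L (c s))"
  by (rule geom_bounded_bounded_linear[OF assms(1)[unfolded linear_conv_bounded_linear] assms(2)])

lemma geom_bounded_rev:
  assumes "geom_bounded c"
  shows "geom_bounded (\<lambda>s. c (rev s))"
proof -
  obtain K R where "0 \<le> R" and K: "\<And>s. norm (c s) \<le> K * R ^ length s"
    using assms unfolding geom_bounded_def by blast
  moreover have "norm (c (rev s)) \<le> K * R ^ length s" for s
    using K[of "rev s"] by simp
  ultimately show ?thesis unfolding geom_bounded_def by blast
qed

lemma geom_bounded_diff:
  assumes "geom_bounded c" "geom_bounded d"
  shows "geom_bounded (\<lambda>s. c s - d s)"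
proof -
  obtain K R where R: "0 \<le> R" and K: "\<And>s. norm (c s) \<le> K * R ^ length s"
    using assms(1) unfolding geom_bounded_def by blast
  obtain K' R' where R': "0 \<le> R'" and K': "\<And>s. norm (d s) \<le> K' * R' ^ length s"
    using assms(2) unfolding geom_bounded_def by blast
  have K0: "0 \<le> K" "0 \<le> K'"
    using K[of "[]"] K'[of "[]"] by (simp_all add: order_trans[OF norm_ge_zero])
  have "norm (c s - d s) \<le> (K + K') * (R + R') ^ length s" for s
  proof -
    have "norm (c s - d s) \<le> K * R ^ length s + K' * R' ^ length s"
      using norm_triangle_ineq4[of "c s" "d s"] K[of s] K'[of s] by linarith
    also have "\<dots> \<le> K * (R + R') ^ length s + K' * (R + R') ^ length s"
      using R R' K0 by (intro add_mono mult_left_mono power_mono) auto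
    finally show ?thesis by (simp add: distrib_right)
  qed
  then show ?thesis unfolding geom_bounded_def using add_nonneg_nonneg[OF R R'] by blast
qed

section \<open>Words with at most one input letter\<close>

text \<open>The first letter here is integrated last and is therefore the last letter of the
  corresponding \<open>ct_w\<close> word, which is why the recursion appends to the arguments of
  \<open>e\<close> and \<open>h\<close>. Nonzero coefficients occur only for words without input
  letter and for words whose single input letter stands at the inner end. In this form, deleting the
  outermost letter is a computation.\<close>

fun word_coeff :: "('b list \<Rightarrow> 'v) \<Rightarrow> ('b list \<Rightarrow> 'c \<Rightarrow> 'v) \<Rightarrow> ('b + 'c) list \<Rightarrow> 'v::zero" where
  "word_coeff e h [] = e []"
| "word_coeff e h (Inl i # w) = word_coeff (\<lambda>s. e (s @ [i])) (\<lambda>s. h (s @ [i])) w"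
| "word_coeff e h (Inr b # w) = (if w = [] then h [] b else 0)"

lemma word_coeff_Inl: "word_coeff e h (map Inl s) = e (rev s)"
  by (induction s arbitrary: e h) auto

lemma word_coeff_Inr: "word_coeff e h (map Inl s @ [Inr b]) = h (rev s) b"
  by (induction s arbitrary: e h) auto

lemma word_coeff_neq_zeroD:
  "word_coeff e h w \<noteq> 0 \<Longrightarrow> (\<exists>s. w = map Inl s) \<or> (\<exists>s b. w = map Inl s @ [Inr b])"
proof (induction e h w rule: word_coeff.induct)
  case (2 e h i w)
  then have "(\<exists>s. w = map Inl s) \<or> (\<exists>s b. w = map Inl s @ [Inr b])" by simp
  then show ?case
  proof (elim disjE exE)
    fix s assume "w = map Inl s"
    then show ?case by (intro disjI1 exI[of _ "i # s"]) simp
  next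
    fix s b assume "w = map Inl s @ [Inr b]"
    then show ?case by (intro disjI2 exI[of _ "i # s"] exI[of _ b]) simp
  qed
next
  case (3 e h b w)
  then show ?case by (intro disjI2 exI[of _ "[]"] exI[of _ b]) (simp split: if_splits)
qed auto

text \<open>The assumption on \<open>f\<close> takes care of the words that carry no coefficient.
  The maps used for \<open>f\<close> are multiplications by a state or output matrix.\<close>

lemma word_coeff_map:
  assumes "f 0 = 0"
  shows "word_coeff (\<lambda>s. f (e s)) (\<lambda>s b. f (h s b)) w = f (word_coeff e h w)"
  using assms by (induction e h w rule: word_coeff.induct) auto

lemma geom_bounded_word_coeff:
  fixes h :: "'b list \<Rightarrow> 'c::finite \<Rightarrow> 'v::real_normed_vector"
  assumes e: "geom_bounded e" and h: "\<And>b. geom_bounded (\<lambda>s. h s b)"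
  shows "geom_bounded (word_coeff e h)"
proof -
  obtain Ke Re where Re: "0 \<le> Re" and Ke: "\<And>s. norm (e s) \<le> Ke * Re ^ length s"
    using e unfolding geom_bounded_def by blast
  have "\<forall>b. \<exists>K R. 0 \<le> R \<and> (\<forall>s. norm (h s b) \<le> K * R ^ length s)"
    using h unfolding geom_bounded_def by blast
  then obtain Kh Rh where Rh: "\<And>b. 0 \<le> Rh b" and Kh: "\<And>b s. norm (h s b) \<le> Kh b * Rh b ^ length s"
    unfolding choice_iff by blast
  have K0: "0 \<le> Ke" "0 \<le> Kh b" for b
    using Ke[of "[]"] Kh[of "[]" b] by (simp_all add: order_trans[OF norm_ge_zero])
  \<comment> \<open>Sums over the finite set of input letters bound all constants at once. The
    summand 1 makes \<open>R\<close> at least 1, because a word ending in an input letter is one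
    letter longer than the \<open>s\<close> whose bound it inherits.\<close>
  define K R where "K = Ke + (\<Sum>b\<in>UNIV. Kh b)" and "R = 1 + Re + (\<Sum>b\<in>UNIV. Rh b)"
  have nn: "0 \<le> (\<Sum>b\<in>UNIV. Kh b)" "0 \<le> (\<Sum>b\<in>UNIV. Rh b)" using K0 Rh by (auto intro: sum_nonneg)
  have R1: "1 \<le> R" and ReR: "Re \<le> R" and KeK: "Ke \<le> K" and K: "0 \<le> K"
    using nn Re K0 by (auto simp: R_def K_def)
  have RhR: "Rh b \<le> R" and KhK: "Kh b \<le> K" for b
  proof -
    have "Rh b \<le> (\<Sum>b\<in>UNIV. Rh b)" "Kh b \<le> (\<Sum>b\<in>UNIV. Kh b)"
      using Rh K0 by (auto intro: member_le_sum)
    then show "Rh b \<le> R" "Kh b \<le> K" using Re K0(1) by (auto simp: R_def K_def)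
  qed
  have "norm (word_coeff e h w) \<le> K * R ^ length w" for w
  proof (cases "word_coeff e h w = 0")
    case True
    then show ?thesis using K R1 by simp
  next
    case False
    then show ?thesis
    proof (rule word_coeff_neq_zeroD[THEN disjE]; elim exE)
      fix s assume w: "w = map Inl s"
      have "norm (e (rev s)) \<le> Ke * Re ^ length s" using Ke[of "rev s"] by simp
      also have "\<dots> \<le> K * R ^ length s"
        using KeK ReR Re K by (intro mult_mono power_mono) auto
      finally show ?thesis by (simp add: w word_coeff_Inl)
    next
      fix s b assume w: "w = map Inl s @ [Inr b]"
      have "norm (h (rev s) b) \<le> Kh b * Rh b ^ length s" using Kh[of "rev s" b] by simp
      also have "\<dots> \<le> K * R ^ length s"
        using KhK RhR Rh K by (intro mult_mono power_mono) auto
      also have "\<dots> \<le> K * R ^ length w"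
        using K R1 by (intro mult_left_mono power_increasing) (auto simp: w)
      finally show ?thesis by (simp add: w word_coeff_Inr)
    qed
  qed
  then show ?thesis unfolding geom_bounded_def using order_trans[OF zero_le_one R1] by blast
qed

text \<open>The words that can carry a coefficient are parametrized injectively by s and by (b, s);
  \<open>rev\<close> restores the letter order of \<open>ct_w\<close>. The two summands correspond
  to the free response and to the convolution.\<close>

lemma series_word_coeff:
  fixes f :: "'b::finite + 'c::finite \<Rightarrow> real \<Rightarrow> real" and h :: "'b list \<Rightarrow> 'c \<Rightarrow> 'v::banach"
  assumes pw: "\<And>a. pw_continuous (f a)" and t: "0 \<le> t"
    and e: "geom_bounded e" and h: "\<And>b. geom_bounded (\<lambda>s. h s b)"
  shows "series f (word_coeff e h) t = (\<Sum>\<^sub>\<infinity>s. iter_int f (map Inl (rev s)) 0 t *\<^sub>R e s)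
     + (\<Sum>b\<in>UNIV. \<Sum>\<^sub>\<infinity>s. iter_int f (map Inl (rev s) @ [Inr b]) 0 t *\<^sub>R h s b)"
proof -
  let ?\<phi> = "\<lambda>w. iter_int f w 0 t *\<^sub>R word_coeff e h w"
  let ?A = "\<lambda>s. map Inl (rev s) :: ('b + 'c) list"
  let ?B = "\<lambda>(b, s). map Inl (rev s) @ [Inr b] :: ('b + 'c) list"
  have sm: "?\<phi> summable_on UNIV"
    by (rule series_summable[OF pw geom_bounded_word_coeff[OF e h] t])
  have sub: "?\<phi> summable_on X" for X by (rule summable_on_subset_banach[OF sm]) simp
  have map_inj: "map Inl s = (map Inl s' :: ('b + 'c) list) \<longleftrightarrow> s = s'" for s s' :: "'b list"
    by (simp add: inj_map_eq_map)
  have injA: "inj ?A" by (auto simp: inj_on_def map_inj)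
  have injB: "inj ?B" by (auto simp: inj_on_def map_inj)
  have disj: "range ?A \<inter> range ?B = {}"
  proof -
    have "map Inl (rev s) \<noteq> map Inl (rev s') @ [Inr b]" for s s' :: "'b list" and b :: 'c
    proof
      assume "map Inl (rev s) = map Inl (rev s') @ [Inr b]"
      then have "Inr b \<in> set (map Inl (rev s) :: ('b + 'c) list)" by simp
      then show False by auto
    qed
    then show ?thesis by auto
  qed
  have supp: "?\<phi> w = 0" if "w \<notin> range ?A \<union> range ?B" for w
  proof (rule ccontr)
    assume "?\<phi> w \<noteq> 0"
    then have "word_coeff e h w \<noteq> 0" by auto
    from word_coeff_neq_zeroD[OF this] have "w \<in> range ?A \<union> range ?B"
    proof (elim disjE exE)
      fix s assume "w = map Inl s"
      then have "w = ?A (rev s)" by simp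
      then show ?thesis by blast
    next
      fix s b assume "w = map Inl s @ [Inr b]"
      then have "w = ?B (b, rev s)" by simp
      then show ?thesis by blast
    qed
    with that show False by contradiction
  qed
  have sB: "(\<lambda>(b, s). ?\<phi> (?B (b, s))) summable_on UNIV \<times> UNIV"
    using sub[of "range ?B"] by (subst (asm) summable_on_reindex[OF injB]) (simp add: o_def case_prod_unfold)
  have "series f (word_coeff e h) t = infsum ?\<phi> (range ?A \<union> range ?B)"
    unfolding series_def using supp by (intro infsum_cong_neutral) auto
  also have "\<dots> = infsum ?\<phi> (range ?A) + infsum ?\<phi> (range ?B)"
    by (rule infsum_Un_disjoint[OF sub sub disj])
  also have "infsum ?\<phi> (range ?A) = (\<Sum>\<^sub>\<infinity>s. iter_int f (map Inl (rev s)) 0 t *\<^sub>R e s)"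
    by (subst infsum_reindex[OF injA]) (simp add: o_def word_coeff_Inl)
  also have "infsum ?\<phi> (range ?B) = infsum (\<lambda>(b, s). ?\<phi> (?B (b, s))) (UNIV \<times> UNIV)"
    by (subst infsum_reindex[OF injB]) (simp add: o_def case_prod_unfold)
  also have "\<dots> = infsum (\<lambda>b. infsum (\<lambda>s. ?\<phi> (?B (b, s))) UNIV) UNIV"
    using infsum_Sigma'_banach[OF sB] by simp
  finally show ?thesis by (simp add: word_coeff_Inr)
qed

section \<open>Continuous time\<close>

definition letter_signal ::
    "(real \<Rightarrow> real ^ 'u) \<Rightarrow> (real \<Rightarrow> real ^ 'p) \<Rightarrow> 'p option + 'p option \<times> 'u \<Rightarrow> real \<Rightarrow> real" where
  "letter_signal u p a r = (case a of Inl i \<Rightarrow> pcomp i (p r) | Inr (j, l) \<Rightarrow> pcomp j (p r) * u r $ l)"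

lemma pw_continuous_pcomp:
  assumes "pw_continuous p"
  shows "pw_continuous (\<lambda>r. pcomp i (p r))"
proof (rule pw_continuous_compose[OF assms])
  show "continuous_on UNIV (pcomp i)"
    by (cases i) (auto intro: continuous_intros)
qed

lemma pw_continuous_letter_signal:
  assumes u: "pw_continuous u" and p: "pw_continuous p"
  shows "pw_continuous (letter_signal u p a)"
proof (cases a)
  case (Inl i)
  then show ?thesis using pw_continuous_pcomp[OF p, of i] by (simp add: letter_signal_def[abs_def])
next
  case (Inr b)
  have "pw_continuous (\<lambda>r. u r $ snd b)"
    by (rule pw_continuous_compose[OF u]) (intro continuous_intros)
  from pw_continuous_mult[OF pw_continuous_pcomp[OF p, of "fst b"] this] show ?thesis
    by (simp add: Inr letter_signal_def[abs_def] case_prod_unfold)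
qed

lemma iter_int_map: "iter_int f (map g s) \<tau> t = iter_int (\<lambda>a. f (g a)) s \<tau> t"
  by (induction s arbitrary: t) auto

lemma ct_w_eq_iter_int: "ct_w p s t \<tau> = iter_int (\<lambda>i r. pcomp i (p r)) (rev s) \<tau> t"
  by (induction s arbitrary: t rule: rev_induct) (auto simp: ct_w_Nil ct_w_snoc)

lemma ct_w_eq_iter_int_letter: "ct_w p s t \<tau> = iter_int (letter_signal u p) (map Inl (rev s)) \<tau> t"
  by (simp add: ct_w_eq_iter_int iter_int_map letter_signal_def[abs_def])

lemma ct_w_dominated:
  fixes c :: "'p::finite option list \<Rightarrow> 'v::real_normed_vector"
  assumes p: "pw_continuous p" and c: "geom_bounded c"
  shows "\<exists>m. m summable_on UNIV \<and> (\<forall>s. 0 \<le> m s) \<and> 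
    (\<forall>s \<tau> t. 0 \<le> \<tau> \<longrightarrow> \<tau> \<le> t \<longrightarrow> t \<le> T \<longrightarrow> norm (ct_w p s t \<tau> *\<^sub>R c s) \<le> m s)"
proof (rule iter_int_dominated[of "\<lambda>i r. pcomp i (p r)" "\<lambda>s. c (rev s)" T])
  show "pw_continuous (\<lambda>r. pcomp i (p r))" for i by (rule pw_continuous_pcomp[OF p])
  show "geom_bounded (\<lambda>s. c (rev s))" by (rule geom_bounded_rev[OF c])
  fix m assume m: "m summable_on UNIV" "\<And>s. 0 \<le> m s" and
    bound: "\<And>s \<tau> t. \<lbrakk>0 \<le> \<tau>; \<tau> \<le> t; t \<le> T\<rbrakk> \<Longrightarrow> norm (iter_int (\<lambda>i r. pcomp i (p r)) s \<tau> t *\<^sub>R c (rev s)) \<le> m s"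
  have "bij_betw rev (UNIV :: 'p option list set) UNIV"
    by (rule bij_betwI[of _ _ _ rev]) auto
  then have "(\<lambda>s. m (rev s)) summable_on UNIV"
    using m(1) by (subst summable_on_reindex_bij_betw)
  moreover have "norm (ct_w p s t \<tau> *\<^sub>R c s) \<le> m (rev s)" if "0 \<le> \<tau>" "\<tau> \<le> t" "t \<le> T" for s \<tau> t
    using bound[OF that, of "rev s"] by (simp add: ct_w_eq_iter_int)
  ultimately show ?thesis using m(2) by (intro exI[of _ "\<lambda>s. m (rev s)"]) simp
qed

lemma ct_w_summable:
  fixes c :: "'p::finite option list \<Rightarrow> 'v::banach"
  assumes p: "pw_continuous p" and c: "geom_bounded c" and "0 \<le> \<tau>" "\<tau> \<le> t"
  shows "(\<lambda>s. ct_w p s t \<tau> *\<^sub>R c s) summable_on UNIV"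
proof -
  obtain m where m: "m summable_on UNIV"
    "\<forall>s \<tau> r. 0 \<le> \<tau> \<longrightarrow> \<tau> \<le> r \<longrightarrow> r \<le> t \<longrightarrow> norm (ct_w p s r \<tau> *\<^sub>R c s) \<le> m s"
    using ct_w_dominated[OF p c, of t] by blast
  have "(\<lambda>s. norm (ct_w p s t \<tau> *\<^sub>R c s)) summable_on UNIV"
    by (rule Infinite_Sum.abs_summable_on_comparison_test'[OF m(1)]) (use m(2) assms(3,4) in auto)
  then show ?thesis by (rule abs_summable_summable)
qed

lemma linear_eta_part: "linear (\<lambda>M. eta_part (\<lambda>_. M) i s)"
  by (intro linearI) (simp_all add: eta_part_def vec_eq_iff)

lemma linear_theta_part: "linear (\<lambda>M. theta_part (\<lambda>_. M) i j s)"
  by (intro linearI) (simp_all add: theta_part_def vec_eq_iff)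

lemma geom_bounded_parts:
  assumes "exp_bounded \<theta>"
  shows geom_bounded_eta_part: "geom_bounded (eta_part \<theta> i)"
    and geom_bounded_theta_part: "geom_bounded (theta_part \<theta> i j)"
proof -
  have g: "geom_bounded \<theta>"
    using assms unfolding exp_bounded_def geom_bounded_def by (meson less_imp_le)
  show "geom_bounded (eta_part \<theta> i)"
    using geom_bounded_linear[OF linear_eta_part g] by (simp add: eta_part_def[abs_def])
  show "geom_bounded (theta_part \<theta> i j)"
    using geom_bounded_linear[OF linear_theta_part g] by (simp add: theta_part_def[abs_def])
qed

text \<open>The coefficients of block row \<open>i\<close> as coefficients of words over the alphabet of
  \<open>letter_signal\<close>: an input letter can only be integrated first.\<close>

definition iir_word ::
    "('p::finite, 'u::finite, 'y::finite) iir_coeff \<Rightarrow> 'p option \<Rightarrow> ('p option + 'p option \<times> 'u) list \<Rightarrow> real ^ 'y" where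
  "iir_word \<theta> i = word_coeff (eta_part \<theta> i) (\<lambda>s (j, l). column l (theta_part \<theta> i j s))"

lemma geom_bounded_column_theta:
  assumes "exp_bounded \<theta>"
  shows "geom_bounded (\<lambda>s. case b of (j, l) \<Rightarrow> column l (theta_part \<theta> i j s))"
  by (cases b) (simp add: geom_bounded_linear[OF linear_column geom_bounded_theta_part[OF assms]])

lemma geom_bounded_iir_word: "exp_bounded \<theta> \<Longrightarrow> geom_bounded (iir_word \<theta> i)"
  unfolding iir_word_def
  by (intro geom_bounded_word_coeff geom_bounded_eta_part geom_bounded_column_theta)

lemma iir_coeff_eqI:
  assumes eta: "\<And>i s. eta_part \<theta> i s = eta_part \<theta>' i s"
    and theta: "\<And>i j s. theta_part \<theta> i j s = theta_part \<theta>' i j s"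
  shows "\<theta> = \<theta>'"
proof -
  have "\<theta> s $ (i, k) $ z = \<theta>' s $ (i, k) $ z" for s i k z
  proof (cases z)
    case (Inl x)
    then show ?thesis using arg_cong[OF eta[of i s], of "\<lambda>v. v $ k"] by (simp add: eta_part_def)
  next
    case (Inr b)
    then show ?thesis using arg_cong[OF theta[of i "fst b" s], of "\<lambda>v. v $ k $ snd b"]
      by (simp add: theta_part_def)
  qed
  then show ?thesis by (auto simp: fun_eq_iff vec_eq_iff)
qed

text \<open>Every entry of the coefficient matrix is visible in some word: words of scheduling
  letters give \<open>eta_part\<close>, and those ending in (j, l) give column l of
  \<open>theta_part\<close>. Uniqueness may thus be proved on the level of series.\<close>

lemma iir_word_inject:
  assumes eq: "\<And>i w. iir_word \<theta> i w = iir_word \<theta>' i w"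
  shows "\<theta> = \<theta>'"
proof (rule iir_coeff_eqI)
  show "eta_part \<theta> i s = eta_part \<theta>' i s" for i s
    using eq[of i "map Inl (rev s)"] by (simp add: iir_word_def word_coeff_Inl)
  show "theta_part \<theta> i j s = theta_part \<theta>' i j s" for i j s
  proof (rule matrix_eq_columns)
    show "column l (theta_part \<theta> i j s) = column l (theta_part \<theta>' i j s)" for l
      using eq[of i "map Inl (rev s) @ [Inr (j, l)]"] by (simp add: iir_word_def word_coeff_Inr)
  qed
qed

lemma ct_g_eq: "ct_g \<theta> p t = (\<Sum>i\<in>UNIV. pcomp i (p t) *\<^sub>R (\<Sum>\<^sub>\<infinity>s. ct_w p s t 0 *\<^sub>R eta_part \<theta> i s))"
  unfolding ct_g_def by (simp add: infsum_scaleR_right flip: scaleR_scaleR)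

text \<open>Separates the kernel into scalar word integrals multiplied by constant columns, the form
  in which termwise integration and \<open>iter_int_snoc\<close> can act.\<close>

lemma ct_h_mult:
  assumes p: "pw_continuous p" and \<theta>: "exp_bounded \<theta>" and "0 \<le> \<delta>" "\<delta> \<le> t"
  shows "ct_h \<theta> p \<delta> t *v v = (\<Sum>i\<in>UNIV. pcomp i (p t) *\<^sub>R (\<Sum>b\<in>UNIV. \<Sum>\<^sub>\<infinity>s.
           (ct_w p s t \<delta> * (case b of (j, l) \<Rightarrow> pcomp j (p \<delta>) * v $ l)) *\<^sub>R
           (case b of (j, l) \<Rightarrow> column l (theta_part \<theta> i j s))))"
proof -
  let ?H = "\<lambda>i j. \<Sum>\<^sub>\<infinity>s. ct_w p s t \<delta> *\<^sub>R theta_part \<theta> i j s"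
  have col: "column l (?H i j) = (\<Sum>\<^sub>\<infinity>s. ct_w p s t \<delta> *\<^sub>R column l (theta_part \<theta> i j s))" for i j l
  proof -
    have "((\<lambda>s. column l (ct_w p s t \<delta> *\<^sub>R theta_part \<theta> i j s)) has_sum column l (?H i j)) UNIV"
      by (rule has_sum_bounded_linear[OF linear_column[unfolded linear_conv_bounded_linear]
            has_sum_infsum[OF ct_w_summable[OF p geom_bounded_theta_part[OF \<theta>] assms(3,4)]]])
    from infsumI[OF this] show ?thesis by (simp add: linear_cmul[OF linear_column])
  qed
  have Hv: "?H i j *v v = (\<Sum>l\<in>UNIV. v $ l *\<^sub>R (\<Sum>\<^sub>\<infinity>s. ct_w p s t \<delta> *\<^sub>R column l (theta_part \<theta> i j s)))" for i j
    by (simp add: matrix_mult_sum scalar_mult_eq_scaleR col)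
  have "ct_h \<theta> p \<delta> t = (\<Sum>i\<in>UNIV. \<Sum>j\<in>UNIV. (pcomp i (p t) * pcomp j (p \<delta>)) *\<^sub>R ?H i j)"
    unfolding ct_h_def
    by (simp only: infsum_scaleR_right flip: scaleR_scaleR)
  then have "ct_h \<theta> p \<delta> t *v v = (\<Sum>i\<in>UNIV. \<Sum>j\<in>UNIV. (pcomp i (p t) * pcomp j (p \<delta>)) *\<^sub>R (?H i j *v v))"
    by (simp add: linear_sum[OF linear_matrix_vector_left] scaleR_matrix_vector_assoc)
  also have "\<dots> = (\<Sum>i\<in>UNIV. pcomp i (p t) *\<^sub>R (\<Sum>j\<in>UNIV. \<Sum>l\<in>UNIV. (pcomp j (p \<delta>) * v $ l) *\<^sub>R
      (\<Sum>\<^sub>\<infinity>s. ct_w p s t \<delta> *\<^sub>R column l (theta_part \<theta> i j s))))"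
    unfolding Hv by (simp add: scaleR_right.sum mult.assoc)
  also have "\<dots> = (\<Sum>i\<in>UNIV. pcomp i (p t) *\<^sub>R (\<Sum>(j, l)\<in>UNIV. \<Sum>\<^sub>\<infinity>s.
      (ct_w p s t \<delta> * (pcomp j (p \<delta>) * v $ l)) *\<^sub>R column l (theta_part \<theta> i j s)))"
    unfolding sum.cartesian_product UNIV_Times_UNIV infsum_scaleR_right[symmetric] scaleR_scaleR
    by (simp only: mult.commute)
  finally show ?thesis by (simp add: case_prod_unfold)
qed

lemma ct_iir_output:
  assumes u: "pw_continuous u" and p: "pw_continuous p" and \<theta>: "exp_bounded \<theta>" and t: "0 \<le> t"
  shows "ct_g \<theta> p t + integral {0..t} (\<lambda>\<delta>. ct_h \<theta> p \<delta> t *v u \<delta>)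
     = (\<Sum>i\<in>UNIV. pcomp i (p t) *\<^sub>R series (letter_signal u p) (iir_word \<theta> i) t)"
proof -
  let ?f = "letter_signal u p"
  let ?c = "\<lambda>i s b. case b of (j, l) \<Rightarrow> column l (theta_part \<theta> i j s)"
  let ?\<phi> = "\<lambda>i b s \<delta>. (ct_w p s t \<delta> * ?f (Inr b) \<delta>) *\<^sub>R ?c i s b"
  note pw = pw_continuous_letter_signal[OF u p]
  have int: "(\<lambda>\<delta>. \<Sum>\<^sub>\<infinity>s. ?\<phi> i b s \<delta>) integrable_on {0..t} \<and>
      integral {0..t} (\<lambda>\<delta>. \<Sum>\<^sub>\<infinity>s. ?\<phi> i b s \<delta>) = (\<Sum>\<^sub>\<infinity>s. iter_int ?f (map Inl (rev s) @ [Inr b]) 0 t *\<^sub>R ?c i s b)" for i b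
  proof -
    \<comment> \<open>Here the upper limit stays at t and the lower limit runs through the interval
      of integration.\<close>
    obtain m where m: "m summable_on UNIV" "\<forall>s. 0 \<le> m s"
      "\<forall>s \<tau> r. 0 \<le> \<tau> \<longrightarrow> \<tau> \<le> r \<longrightarrow> r \<le> t \<longrightarrow> norm (ct_w p s r \<tau> *\<^sub>R ?c i s b) \<le> m s"
      using ct_w_dominated[OF p geom_bounded_column_theta[OF \<theta>, where b=b], of t] by blast
    obtain M where M: "0 < M" "\<And>r. r \<in> {0..t} \<Longrightarrow> norm (?f (Inr b) r) \<le> M"
      using pw_continuous_bounded[OF pw[of "Inr b"], of t] by blast
    have i0: "(\<lambda>\<delta>. ct_w p s t \<delta> * ?f (Inr b) \<delta>) integrable_on {0..t}" for s
      unfolding ct_w_eq_iter_int_letter[of p s t _ u]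
      by (rule iter_int_lower_integrable[OF pw pw order_refl])
    have i1: "?\<phi> i b s integrable_on {0..t}" for s
      by (rule integrable_on_scaleR_left[OF i0])
    have bnd: "norm (?\<phi> i b s \<delta>) \<le> M * m s" if "\<delta> \<in> {0..t}" for s \<delta>
    proof -
      have "norm (?\<phi> i b s \<delta>) = norm (?f (Inr b) \<delta>) * norm (ct_w p s t \<delta> *\<^sub>R ?c i s b)"
        by (simp add: abs_mult)
      also have "\<dots> \<le> M * m s"
        using M(1) m(3) that by (intro mult_mono M(2)) auto
      finally show ?thesis .
    qed
    have eq: "integral {0..t} (?\<phi> i b s) = iter_int ?f (map Inl (rev s) @ [Inr b]) 0 t *\<^sub>R ?c i s b" for s
    proof -
      have "integral {0..t} (?\<phi> i b s) = integral {0..t} (\<lambda>\<delta>. ct_w p s t \<delta> * ?f (Inr b) \<delta>) *\<^sub>R ?c i s b"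
        by (rule integral_unique[OF has_integral_scaleR_left[OF integrable_integral[OF i0]]])
      also have "integral {0..t} (\<lambda>\<delta>. ct_w p s t \<delta> * ?f (Inr b) \<delta>) = iter_int ?f (map Inl (rev s) @ [Inr b]) 0 t"
        unfolding ct_w_eq_iter_int_letter[of p s t _ u] by (rule iter_int_snoc[OF pw order_refl t])
      finally show ?thesis .
    qed
    note ii = infsum_integral[OF i1 bnd summable_on_cmult_right[OF m(1)]]
    show ?thesis using ii(1) ii(2)[unfolded eq] by (intro conjI)
  qed
  have "integral {0..t} (\<lambda>\<delta>. ct_h \<theta> p \<delta> t *v u \<delta>)
      = integral {0..t} (\<lambda>\<delta>. \<Sum>i\<in>UNIV. pcomp i (p t) *\<^sub>R (\<Sum>b\<in>UNIV. \<Sum>\<^sub>\<infinity>s. ?\<phi> i b s \<delta>))"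
    by (rule Henstock_Kurzweil_Integration.integral_cong) (simp add: ct_h_mult[OF p \<theta>] letter_signal_def)
  also have "\<dots> = (\<Sum>i\<in>UNIV. pcomp i (p t) *\<^sub>R (\<Sum>b\<in>UNIV. \<Sum>\<^sub>\<infinity>s. iter_int ?f (map Inl (rev s) @ [Inr b]) 0 t *\<^sub>R ?c i s b))"
    using int
    by (intro integral_unique has_integral_sum has_integral_cmul)
      (auto simp: has_integral_integrable_integral)
  finally show ?thesis
    unfolding ct_g_eq iir_word_def
      series_word_coeff[OF pw t geom_bounded_eta_part[OF \<theta>] geom_bounded_column_theta[OF \<theta>]]
    by (simp add: scaleR_right_distrib sum.distrib ct_w_eq_iter_int_letter[of p _ t _ u])
qed

section \<open>The state as a series\<close>

lemma bounded_bilinear_matrix_vector_mult: "bounded_bilinear ((*v) :: real ^ 'n ^ 'm \<Rightarrow> real ^ 'n \<Rightarrow> real ^ 'm)"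
  unfolding bilinear_conv_bounded_bilinear[symmetric] bilinear_def
  by (simp add: linear_matrix_vector_left)

lemma bounded_bilinear_matrix_matrix_mult:
  "bounded_bilinear ((**) :: real ^ 'n ^ 'm \<Rightarrow> real ^ 'k ^ 'n \<Rightarrow> real ^ 'k ^ 'm)"
  unfolding bilinear_conv_bounded_bilinear[symmetric] bilinear_def
  by (auto intro!: linearI simp: vec_eq_iff matrix_matrix_mult_def algebra_simps sum.distrib sum_distrib_left)

lemma word_mat_snoc: "word_mat A (s @ [i]) = A i ** word_mat A s"
  by (induction s) (simp_all add: matrix_mul_assoc)

text \<open>Each letter multiplies the norm by at most \<open>R\<close>. The constant
  \<open>B\<close> comes from bounded bilinearity of the matrix product, and the norm of the
  identity stays as a factor since the Frobenius norm does not make it 1 in general.\<close>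

lemma geom_bounded_word_mat:
  fixes A :: "'p::finite option \<Rightarrow> real ^ 'x ^ 'x"
  shows "geom_bounded (word_mat A)"
proof -
  obtain B where B: "0 < B" "\<And>(M :: real ^ 'x ^ 'x) (N :: real ^ 'x ^ 'x). norm (M ** N) \<le> norm M * norm N * B"
    using bounded_bilinear.pos_bounded[OF bounded_bilinear_matrix_matrix_mult] by blast
  define R where "R = (\<Sum>i\<in>UNIV. norm (A i)) * B"
  have R0: "0 \<le> R" unfolding R_def using B by (intro mult_nonneg_nonneg sum_nonneg) auto
  have AR: "norm (A i) * B \<le> R" for i
    unfolding R_def using B(1) by (intro mult_right_mono member_le_sum) auto
  have "norm (word_mat A s) \<le> norm (mat 1 :: real ^ 'x ^ 'x) * R ^ length s" for s
  proof (induction s)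
    case (Cons i s)
    have "norm (word_mat A (i # s)) \<le> norm (word_mat A s) * (norm (A i) * B)"
      using B(2)[of "word_mat A s" "A i"] by (simp add: mult.assoc)
    also have "\<dots> \<le> (norm (mat 1 :: real ^ 'x ^ 'x) * R ^ length s) * R"
      using Cons AR R0 B(1) by (intro mult_mono) auto
    finally show ?case by (simp add: mult_ac)
  qed simp
  with R0 show ?thesis unfolding geom_bounded_def by blast
qed

text \<open>An input letter (j, l) injects column l of \<open>Bmat S j\<close> into the state, and
  the scheduling letters integrated afterwards transport it.\<close>

definition state_word ::
    "('p::finite, 'x::finite, 'u::finite, 'y::finite) lpv_ssa \<Rightarrow> real ^ 'x \<Rightarrow> ('p option + 'p option \<times> 'u) list \<Rightarrow> real ^ 'x" where
  "state_word S x\<^sub>0 = word_coeff (\<lambda>s. word_mat (Amat S) s *v x\<^sub>0)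
     (\<lambda>s (j, l). column l (word_mat (Amat S) s ** Bmat S j))"

lemma geom_bounded_state_word: "geom_bounded (state_word S x\<^sub>0)"
  unfolding state_word_def
proof (rule geom_bounded_word_coeff)
  show "geom_bounded (\<lambda>s. word_mat (Amat S) s *v x\<^sub>0)"
    by (rule geom_bounded_linear[OF linear_matrix_vector_left geom_bounded_word_mat])
  show "geom_bounded (\<lambda>s. case b of (j, l) \<Rightarrow> column l (word_mat (Amat S) s ** Bmat S j))" for b
    unfolding column_matrix_mult
    by (cases b) (simp add: geom_bounded_linear[OF linear_matrix_vector_left geom_bounded_word_mat])
qed

lemma state_word_Nil: "state_word S x\<^sub>0 [] = x\<^sub>0"
  by (simp add: state_word_def)

text \<open>The outermost letter is the last one to act, so its matrix factors out on the left. This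
  lets the integral equation of the series close up on the state itself.\<close>

lemma state_word_Inl: "state_word S x\<^sub>0 (Inl i # w) = Amat S i *v state_word S x\<^sub>0 w"
proof -
  have "state_word S x\<^sub>0 (Inl i # w) = word_coeff (\<lambda>s. Amat S i *v (word_mat (Amat S) s *v x\<^sub>0))
     (\<lambda>s b. Amat S i *v (case b of (j, l) \<Rightarrow> column l (word_mat (Amat S) s ** Bmat S j))) w"
    unfolding state_word_def
    by (simp add: word_mat_snoc matrix_vector_mul_assoc case_prod_unfold
        flip: column_matrix_mult matrix_mul_assoc)
  also have "\<dots> = Amat S i *v state_word S x\<^sub>0 w"
    unfolding state_word_def by (rule word_coeff_map) simp
  finally show ?thesis .
qed

lemma state_word_Inr: "state_word S x\<^sub>0 (Inr (j, l) # w) = (if w = [] then column l (Bmat S j) else 0)"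
  by (simp add: state_word_def)

lemma series_single:
  fixes f :: "'a \<Rightarrow> real \<Rightarrow> real"
  shows "series f (\<lambda>w. if w = [] then c else 0) t = c"
proof -
  have "series f (\<lambda>w. if w = [] then c else 0) t = (\<Sum>\<^sub>\<infinity>w\<in>{[] :: 'a list}. c)"
    unfolding series_def by (rule infsum_cong_neutral) auto
  then show ?thesis by simp
qed

lemma pw_continuous_affine_mat: "pw_continuous p \<Longrightarrow> pw_continuous (\<lambda>t. affine_mat M (p t))"
  by (rule pw_continuous_compose) (auto simp: affine_mat_def intro!: continuous_intros)

abbreviation state_rhs where
  "state_rhs S u p x t \<equiv> affine_mat (Amat S) (p t) *v x t + affine_mat (Bmat S) (p t) *v u t"

lemma pw_continuous_state_rhs:
  assumes "pw_continuous u" "pw_continuous p" "pw_continuous x"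
  shows "pw_continuous (state_rhs S u p x)"
  by (intro pw_continuous_add bounded_bilinear.pw_continuous[OF bounded_bilinear_matrix_vector_mult]
      pw_continuous_affine_mat assms)

text \<open>Deleting a scheduling letter reproduces the state multiplied by \<open>Amat S i\<close>,
  and deleting an input letter leaves a constant column of \<open>Bmat S j\<close>; weighted by the
  letter signals, these sum to the two terms of the right-hand side.\<close>

lemma series_state_equation:
  fixes S :: "('p::finite, 'x::finite, 'u::finite, 'y::finite) lpv_ssa" and x\<^sub>0 :: "real ^ 'x"
  assumes u: "pw_continuous u" and p: "pw_continuous p" and t: "0 \<le> t"
  defines "x \<equiv> series (letter_signal u p) (state_word S x\<^sub>0)"
  shows "x t = x\<^sub>0 + integral {0..t} (state_rhs S u p x)"
proof -
  let ?f = "letter_signal u p"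
  note pw = pw_continuous_letter_signal[OF u p]
  have Inl: "series ?f (\<lambda>w. state_word S x\<^sub>0 (Inl i # w)) r = Amat S i *v x r" if "0 \<le> r" for i r
    unfolding state_word_Inl x_def
    by (rule series_bounded_linear[OF pw geom_bounded_state_word that])
      (rule bounded_bilinear.bounded_linear_right[OF bounded_bilinear_matrix_vector_mult])
  have Inr: "series ?f (\<lambda>w. state_word S x\<^sub>0 (Inr (j, l) # w)) r = column l (Bmat S j)" for j l r
    unfolding state_word_Inr by (rule series_single)
  have "(\<Sum>a\<in>UNIV. ?f a r *\<^sub>R series ?f (\<lambda>w. state_word S x\<^sub>0 (a # w)) r) = state_rhs S u p x r" if r: "r \<in> {0..t}" for r
  proof -
    have "(\<Sum>a\<in>UNIV. ?f a r *\<^sub>R series ?f (\<lambda>w. state_word S x\<^sub>0 (a # w)) r)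
       = (\<Sum>i\<in>UNIV. pcomp i (p r) *\<^sub>R (Amat S i *v x r)) + (\<Sum>(j, l)\<in>UNIV. (pcomp j (p r) * u r $ l) *\<^sub>R column l (Bmat S j))"
      using r by (simp add: UNIV_Plus_UNIV[symmetric] sum.Plus Inl Inr case_prod_unfold letter_signal_def del: UNIV_Plus_UNIV)
        (simp add: Inr[of "fst b" "snd b" for b, simplified])
    also have "(\<Sum>i\<in>UNIV. pcomp i (p r) *\<^sub>R (Amat S i *v x r)) = affine_mat (Amat S) (p r) *v x r"
      by (simp add: affine_mat_eq_sum linear_sum[OF linear_matrix_vector_left] scaleR_matrix_vector_assoc)
    also have "(\<Sum>(j, l)\<in>UNIV. (pcomp j (p r) * u r $ l) *\<^sub>R column l (Bmat S j))
        = (\<Sum>j\<in>UNIV. pcomp j (p r) *\<^sub>R (\<Sum>l\<in>UNIV. u r $ l *\<^sub>R column l (Bmat S j)))"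
      by (simp add: UNIV_Times_UNIV[symmetric] sum.cartesian_product[symmetric] scaleR_right.sum del: UNIV_Times_UNIV)
    also have "\<dots> = affine_mat (Bmat S) (p r) *v u r"
      by (simp add: affine_mat_eq_sum linear_sum[OF linear_matrix_vector_left] flip: scaleR_matrix_vector_assoc)
        (simp add: matrix_mult_sum scalar_mult_eq_scaleR)
    finally show ?thesis .
  qed
  then have "integral {0..t} (\<lambda>r. \<Sum>a\<in>UNIV. ?f a r *\<^sub>R series ?f (\<lambda>w. state_word S x\<^sub>0 (a # w)) r)
      = integral {0..t} (state_rhs S u p x)"
    by (rule Henstock_Kurzweil_Integration.integral_cong)
  then show ?thesis
    using series_integral_equation[of ?f "state_word S x\<^sub>0", OF pw geom_bounded_state_word t]
    by (simp add: x_def state_word_Nil)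
qed

section \<open>Existence and uniqueness of trajectories\<close>

lemma Lipschitz_imp_abs_continuous_on:
  assumes lip: "\<And>s t. \<lbrakk>a \<le> s; s \<le> t; t \<le> b\<rbrakk> \<Longrightarrow> norm (f t - f s) \<le> M * (t - s)"
  shows "abs_continuous_on a b f"
  unfolding abs_continuous_on_def
proof (intro allI impI)
  fix \<epsilon> :: real assume \<epsilon>: "0 < \<epsilon>"
  \<comment> \<open>Using |M| + 1 keeps the constant positive whatever the sign of M.\<close>
  define \<delta> where "\<delta> = \<epsilon> / (\<bar>M\<bar> + 1)"
  have \<delta>: "0 < \<delta>" unfolding \<delta>_def using \<epsilon> by simp
  moreover have "(\<Sum>k\<in>D. norm (f (Sup k) - f (Inf k))) < \<epsilon>"
    if D: "D division_of E" "E \<subseteq> {a..b}" and small: "(\<Sum>k\<in>D. Sup k - Inf k) < \<delta>" for D E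
  proof -
    have k: "a \<le> Inf k \<and> Inf k \<le> Sup k \<and> Sup k \<le> b" if kD: "k \<in> D" for k
    proof -
      obtain c d where cd: "k = {c..d}" using division_ofD(4)[OF D(1) kD] by auto
      moreover have "{c..d} \<subseteq> {a..b}"
        using order_trans[OF division_ofD(2)[OF D(1) kD] D(2)] unfolding cd .
      moreover have "c \<le> d"
        using division_ofD(3)[OF D(1) kD] unfolding cd by simp
      ultimately show ?thesis by simp
    qed
    have "(\<Sum>k\<in>D. norm (f (Sup k) - f (Inf k))) \<le> (\<Sum>k\<in>D. (\<bar>M\<bar> + 1) * (Sup k - Inf k))"
    proof (rule sum_mono)
      fix k assume "k \<in> D"
      from k[OF this] have "norm (f (Sup k) - f (Inf k)) \<le> M * (Sup k - Inf k)" by (intro lip) auto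
      also have "\<dots> \<le> (\<bar>M\<bar> + 1) * (Sup k - Inf k)"
        using k[OF \<open>k \<in> D\<close>] by (intro mult_right_mono) auto
      finally show "norm (f (Sup k) - f (Inf k)) \<le> (\<bar>M\<bar> + 1) * (Sup k - Inf k)" .
    qed
    also have "\<dots> = (\<bar>M\<bar> + 1) * (\<Sum>k\<in>D. Sup k - Inf k)" by (simp add: sum_distrib_left)
    also have "\<dots> < (\<bar>M\<bar> + 1) * \<delta>" using small by (intro mult_strict_left_mono) auto
    also have "\<dots> = \<epsilon>" by (simp add: \<delta>_def)
    finally show ?thesis .
  qed
  ultimately show "\<exists>\<delta>>0. \<forall>D E. D division_of E \<longrightarrow> E \<subseteq> {a..b} \<longrightarrow> (\<Sum>k\<in>D. Sup k - Inf k) < \<delta> \<longrightarrow>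
        (\<Sum>k\<in>D. norm (f (Sup k) - f (Inf k))) < \<epsilon>"
    by (intro exI[of _ \<delta>] conjI allI impI) auto
qed

text \<open>Finitely many discontinuities on each {0..n} make a countable, hence null, set.\<close>

lemma AE_continuous_pw_continuous:
  assumes "pw_continuous f"
  shows "AE t in lborel. 0 \<le> t \<longrightarrow> continuous (at t within {0..}) f"
proof (rule AE_I')
  let ?N = "\<Union>n::nat. {t \<in> {0..real n}. \<not> continuous (at t within {0..}) f}"
  have "countable ?N"
    by (rule countable_UN, simp, rule countable_finite, rule pw_continuous_finite[OF assms order_refl])
  then show "?N \<in> null_sets lborel" by (rule countable_imp_null_set_lborel)
  show "{t \<in> space lborel. \<not> (0 \<le> t \<longrightarrow> continuous (at t within {0..}) f)} \<subseteq> ?N"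
  proof
    fix t assume "t \<in> {t \<in> space lborel. \<not> (0 \<le> t \<longrightarrow> continuous (at t within {0..}) f)}"
    moreover obtain n :: nat where "t \<le> real n" using real_arch_simple by blast
    ultimately show "t \<in> ?N" by auto
  qed
qed

text \<open>The integrand of the state equation is bounded on compact intervals, which makes the
  series Lipschitz there, and it is continuous almost everywhere, which gives the derivative.
  \<open>restrict\<close> meets the convention that trajectories are extensional.\<close>

lemma ct_trajectory_series:
  fixes S :: "('p::finite, 'x::finite, 'u::finite, 'y::finite) lpv_ssa"
  assumes u: "pw_continuous u" and p: "pw_continuous p"
  shows "ct_trajectory S x\<^sub>0 u p (restrict (series (letter_signal u p) (state_word S x\<^sub>0)) {0..})"
proof -
  define x where "x = series (letter_signal u p) (state_word S x\<^sub>0)"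
  let ?\<phi> = "state_rhs S u p x"
  have eq: "x t = x\<^sub>0 + integral {0..t} ?\<phi>" if "0 \<le> t" for t
    unfolding x_def by (rule series_state_equation[OF u p that])
  have "pw_continuous x"
    unfolding x_def
    by (rule pw_continuous_continuous_on[OF continuous_on_series[OF pw_continuous_letter_signal[OF u p] geom_bounded_state_word]])
  then have \<phi>: "pw_continuous ?\<phi>" by (rule pw_continuous_state_rhs[OF u p])
  have "abs_continuous_on a b (restrict x {0..})" if a: "0 \<le> a" for a b
  proof -
    obtain M where M: "0 < M" "\<And>t. t \<in> {0..b} \<Longrightarrow> norm (?\<phi> t) \<le> M"
      using pw_continuous_bounded[OF \<phi>, of b] by blast
    show ?thesis
    proof (rule Lipschitz_imp_abs_continuous_on)
      fix s t assume st: "a \<le> s" "s \<le> t" "t \<le> b"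
      with a have s0: "0 \<le> s" by simp
      have "x t - x s = integral {s..t} ?\<phi>"
        using Henstock_Kurzweil_Integration.integral_combine[OF s0 st(2) pw_continuous_integrable[OF \<phi> order_refl]]
          eq[of s] eq[of t] s0 st by (simp add: algebra_simps)
      moreover have "norm (integral {s..t} ?\<phi>) \<le> integral {s..t} (\<lambda>_. M)"
        by (rule integral_norm_bound_integral[OF pw_continuous_integrable[OF \<phi> s0] integrable_const_ivl])
          (use st s0 M(2) in auto)
      ultimately show "norm (restrict x {0..} t - restrict x {0..} s) \<le> M * (t - s)"
        using st s0 by (simp add: mult.commute)
    qed
  qed
  moreover have "AE t in lborel. 0 \<le> t \<longrightarrow>
      (restrict x {0..} has_vector_derivative state_rhs S u p (restrict x {0..}) t) (at t within {0..})"
  proof (rule AE_mp[OF AE_continuous_pw_continuous[OF \<phi>]], rule AE_I2, intro impI)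
    fix t :: real
    assume t: "0 \<le> t" and "0 \<le> t \<longrightarrow> continuous (at t within {0..}) ?\<phi>"
    then have "((\<lambda>r. integral {0..r} ?\<phi>) has_vector_derivative ?\<phi> t) (at t within {0..})"
      using indefinite_integral_has_vector_derivative[OF \<phi> order_refl] by blast
    then have "((\<lambda>r. x\<^sub>0 + integral {0..r} ?\<phi>) has_vector_derivative ?\<phi> t) (at t within {0..})"
      using has_vector_derivative_add[OF has_vector_derivative_const] by fastforce
    then have "(restrict x {0..} has_vector_derivative ?\<phi> t) (at t within {0..})"
      by (rule has_vector_derivative_transform[rotated 2]) (use t eq in auto)
    then show "(restrict x {0..} has_vector_derivative state_rhs S u p (restrict x {0..}) t) (at t within {0..})"
      using t by simp
  qed
  moreover have "x 0 = x\<^sub>0" using eq[of 0] by simp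
  ultimately show ?thesis unfolding ct_trajectory_def x_def[symmetric] by simp
qed

text \<open>Absolute continuity turns the equation that holds almost everywhere into an integral
  equation, integrability of the right-hand side included.\<close>

lemma ct_trajectory_has_integral:
  assumes x: "ct_trajectory S x\<^sub>0 u p x" and t: "0 \<le> t"
  shows "(state_rhs S u p x has_integral (x t - x\<^sub>0)) {0..t}"
proof -
  have "AE t in lborel. 0 \<le> t \<longrightarrow> (x has_vector_derivative state_rhs S u p x t) (at t within {0..})"
    using x by (simp add: ct_trajectory_def)
  then obtain N where N: "N \<in> null_sets lborel"
    "{t \<in> space lborel. \<not> (0 \<le> t \<longrightarrow> (x has_vector_derivative state_rhs S u p x t) (at t within {0..}))} \<subseteq> N"
    unfolding eventually_ae_filter by blast
  have "negligible N"
    using N(1) by (simp add: negligible_iff_null_sets null_sets_completionI)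
  moreover have "(x has_vector_derivative state_rhs S u p x r) (at r within {0..t})" if "r \<in> {0..t} - N" for r
  proof -
    have "(x has_vector_derivative state_rhs S u p x r) (at r within {0..})" using that N(2) by auto
    then show ?thesis by (rule has_vector_derivative_within_subset) auto
  qed
  moreover have "abs_continuous_on 0 t x" "x 0 = x\<^sub>0" using x by (simp_all add: ct_trajectory_def)
  ultimately show ?thesis using abs_continuous_on_imp_has_integral[OF t, of x N] by auto
qed

text \<open>Inserting the equation into itself n times improves a bound \<open>K\<close> on d to K
  (M t)^n / n!, which tends to 0.\<close>

lemma linear_integral_equation_zero:
  fixes A :: "real \<Rightarrow> real ^ 'n ^ 'n"
  assumes A: "pw_continuous A" and d: "\<And>t. 0 \<le> t \<Longrightarrow> ((\<lambda>r. A r *v d r) has_integral d t) {0..t}" and T: "0 \<le> T"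
  shows "d T = 0"
proof -
  obtain B where B: "0 < B" "\<And>(M :: real ^ 'n ^ 'n) v. norm (M *v v) \<le> norm M * norm v * B"
    using bounded_bilinear.pos_bounded[OF bounded_bilinear_matrix_vector_mult] by blast
  obtain MA where MA: "0 < MA" "\<And>t. t \<in> {0..T} \<Longrightarrow> norm (A t) \<le> MA"
    using pw_continuous_bounded[OF A, of T] by blast
  define M where "M = MA * B"
  have M0: "0 < M" using MA B by (simp add: M_def)
  have AM: "norm (A t *v v) \<le> M * norm v" if "t \<in> {0..T}" for t v
  proof -
    have "norm (A t *v v) \<le> norm (A t) * norm v * B" by (rule B(2))
    also have "\<dots> \<le> MA * norm v * B" using MA(2)[OF that] B(1) by (intro mult_right_mono) auto
    finally show ?thesis by (simp add: M_def mult_ac)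
  qed
  \<comment> \<open>The initial bound \<open>K\<close> requires continuity of d, which d inherits
    from being an indefinite integral.\<close>
  have "continuous_on {0..T} (\<lambda>t. integral {0..t} (\<lambda>r. A r *v d r))"
    using d[OF T] by (intro indefinite_integral_continuous_1) blast
  then have "continuous_on {0..T} d"
    by (rule continuous_on_eq) (use d in \<open>auto intro: integral_unique\<close>)
  then have "bounded (d ` {0..T})"
    by (intro compact_imp_bounded compact_continuous_image) auto
  then obtain K where K: "\<And>t. t \<in> {0..T} \<Longrightarrow> norm (d t) \<le> K"
    unfolding bounded_iff by blast
  have bound: "norm (d t) \<le> K * ((M * t) ^ n / fact n)" if "t \<in> {0..T}" for n t
    using that
  proof (induction n arbitrary: t)
    case 0
    then show ?case using K by simp
  next
    case (Suc n)
    have I: "((\<lambda>r. K * (M * ((M * r) ^ n / fact n))) has_integral K * ((M * t) ^ Suc n / fact (Suc n))) {0..t}"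
      using has_integral_power_over_fact[of 0 t M n] Suc.prems by (intro has_integral_mult_right) simp
    have "norm (integral {0..t} (\<lambda>r. A r *v d r)) \<le> integral {0..t} (\<lambda>r. K * (M * ((M * r) ^ n / fact n)))"
    proof (rule integral_norm_bound_integral)
      show "(\<lambda>r. A r *v d r) integrable_on {0..t}" using d[of t] Suc.prems by auto
      show "(\<lambda>r. K * (M * ((M * r) ^ n / fact n))) integrable_on {0..t}" using I by blast
      fix r assume r: "r \<in> {0..t}"
      then have rT: "r \<in> {0..T}" using Suc.prems by auto
      have "norm (A r *v d r) \<le> M * norm (d r)" by (rule AM[OF rT])
      also have "\<dots> \<le> M * (K * ((M * r) ^ n / fact n))" using Suc.IH[OF rT] M0 by (intro mult_left_mono) auto
      finally show "norm (A r *v d r) \<le> K * (M * ((M * r) ^ n / fact n))" by (simp add: mult_ac)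
    qed
    also have "integral {0..t} (\<lambda>r. A r *v d r) = d t" using d[of t] Suc.prems by (intro integral_unique) auto
    also have "integral {0..t} (\<lambda>r. K * (M * ((M * r) ^ n / fact n))) = K * ((M * t) ^ Suc n / fact (Suc n))"
      by (rule integral_unique[OF I])
    finally show ?case .
  qed
  have "(\<lambda>n. inverse (fact n) * (M * T) ^ n) \<longlonglongrightarrow> 0"
    by (rule summable_LIMSEQ_zero[OF summable_exp])
  then have "(\<lambda>n. K * (inverse (fact n) * (M * T) ^ n)) \<longlonglongrightarrow> 0"
    by (rule tendsto_mult_right_zero)
  then have lim: "(\<lambda>n. K * ((M * T) ^ n / fact n)) \<longlonglongrightarrow> 0"
    by (simp add: divide_inverse mult.commute)
  have "norm (d T) \<le> 0"
    by (rule LIMSEQ_le_const[OF lim]) (use bound[of T] T in auto)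
  then show ?thesis by simp
qed

lemma ct_state_eq_series:
  fixes S :: "('p::finite, 'x::finite, 'u::finite, 'y::finite) lpv_ssa"
  assumes u: "pw_continuous u" and p: "pw_continuous p" and t: "0 \<le> t"
  shows "ct_state S x\<^sub>0 u p t = series (letter_signal u p) (state_word S x\<^sub>0) t"
proof -
  let ?x = "restrict (series (letter_signal u p) (state_word S x\<^sub>0)) {0..}"
  note traj = ct_trajectory_series[OF u p, of S x\<^sub>0]
  have "x = ?x" if x: "ct_trajectory S x\<^sub>0 u p x" for x
  proof (rule extensionalityI)
    show "x \<in> extensional {0..}" "?x \<in> extensional {0..}"
      using x traj by (simp_all add: ct_trajectory_def)
    fix r :: real assume r: "r \<in> {0..}"
    \<comment> \<open>The input term cancels in the difference of two trajectories, which leaves the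
      homogeneous equation with zero initial value.\<close>
    have "x r - ?x r = 0"
    proof (rule linear_integral_equation_zero[OF pw_continuous_affine_mat[OF p, of "Amat S"], of "\<lambda>r. x r - ?x r"])
      fix t :: real assume "0 \<le> t"
      from has_integral_diff[OF ct_trajectory_has_integral[OF x this] ct_trajectory_has_integral[OF traj this]]
      show "((\<lambda>r. affine_mat (Amat S) (p r) *v (x r - ?x r)) has_integral x t - ?x t) {0..t}"
        by (simp add: matrix_vector_mult_diff_distrib)
    qed (use r in simp)
    then show "x r = ?x r" by simp
  qed
  then have "ct_state S x\<^sub>0 u p = ?x"
    unfolding ct_state_def using traj by (intro the_equality)
  then show ?thesis using t by simp
qed

section \<open>The coefficients of a representation\<close>

lemma exp_bounded_eq_geom_bounded: "exp_bounded \<theta> \<longleftrightarrow> geom_bounded \<theta>"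
proof
  assume "exp_bounded \<theta>"
  then obtain K R where KR: "0 < K" "0 < R" "\<forall>s. norm (\<theta> s) \<le> K * R ^ length s"
    unfolding exp_bounded_def by blast
  then have "0 \<le> R" by simp
  with KR(3) show "geom_bounded \<theta>" unfolding geom_bounded_def by blast
next
  assume "geom_bounded \<theta>"
  then obtain K R where R: "0 \<le> R" and K: "\<And>s. norm (\<theta> s) \<le> K * R ^ length s"
    unfolding geom_bounded_def by blast
  have "norm (\<theta> s) \<le> (\<bar>K\<bar> + 1) * (R + 1) ^ length s" for s
  proof -
    have "norm (\<theta> s) \<le> K * R ^ length s" by (rule K)
    also have "\<dots> \<le> (\<bar>K\<bar> + 1) * (R + 1) ^ length s"
      using R by (intro mult_mono power_mono) auto
    finally show ?thesis .
  qed
  moreover have "0 < \<bar>K\<bar> + 1" "0 < R + 1" using R by auto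
  ultimately show "exp_bounded \<theta>" unfolding exp_bounded_def by blast
qed

text \<open>The sub-Markov parameters of the representation, packed into the block layout of
  \<open>iir_coeff\<close>.\<close>

definition ssa_coeff ::
    "('p::finite, 'x::finite, 'u::finite, 'y::finite) lpv_ssa \<Rightarrow> real ^ 'x \<Rightarrow> ('p, 'u, 'y) iir_coeff" where
  "ssa_coeff S x\<^sub>0 s = (\<chi> r z. case z of
       Inl _ \<Rightarrow> (Cmat S (fst r) *v (word_mat (Amat S) s *v x\<^sub>0)) $ snd r
     | Inr b \<Rightarrow> (Cmat S (fst r) ** word_mat (Amat S) s ** Bmat S (fst b)) $ snd r $ snd b)"

lemma eta_part_ssa_coeff: "eta_part (ssa_coeff S x\<^sub>0) i s = Cmat S i *v (word_mat (Amat S) s *v x\<^sub>0)"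
  by (simp add: eta_part_def ssa_coeff_def vec_eq_iff)

lemma theta_part_ssa_coeff: "theta_part (ssa_coeff S x\<^sub>0) i j s = Cmat S i ** word_mat (Amat S) s ** Bmat S j"
  by (simp add: theta_part_def ssa_coeff_def vec_eq_iff)

text \<open>The packed matrix depends linearly on the word matrix, whose geometric bound it
  inherits.\<close>

lemma exp_bounded_ssa_coeff: "exp_bounded (ssa_coeff S x\<^sub>0)"
proof -
  have "linear (\<lambda>M. \<chi> r z. case z of
       Inl _ \<Rightarrow> (Cmat S (fst r) *v (M *v x\<^sub>0)) $ snd r
     | Inr b \<Rightarrow> (Cmat S (fst r) ** M ** Bmat S (fst b)) $ snd r $ snd b)"
    by (intro linearI)
      (auto simp: vec_eq_iff matrix_vector_mult_add_rdistrib matrix_vector_right_distrib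
        bounded_bilinear.add_left[OF bounded_bilinear_matrix_matrix_mult]
        bounded_bilinear.add_right[OF bounded_bilinear_matrix_matrix_mult]
        bounded_bilinear.scaleR_left[OF bounded_bilinear_matrix_matrix_mult]
        bounded_bilinear.scaleR_right[OF bounded_bilinear_matrix_matrix_mult]
        bounded_bilinear.scaleR_left[OF bounded_bilinear_matrix_vector_mult]
        bounded_bilinear.scaleR_right[OF bounded_bilinear_matrix_vector_mult] split: sum.splits)
  from geom_bounded_linear[OF this geom_bounded_word_mat] show ?thesis
    by (simp add: exp_bounded_eq_geom_bounded ssa_coeff_def[abs_def])
qed

lemma iir_word_ssa_coeff: "iir_word (ssa_coeff S x\<^sub>0) i w = Cmat S i *v state_word S x\<^sub>0 w"
proof -
  have "iir_word (ssa_coeff S x\<^sub>0) i w = word_coeff (\<lambda>s. Cmat S i *v (word_mat (Amat S) s *v x\<^sub>0))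
     (\<lambda>s b. Cmat S i *v (case b of (j, l) \<Rightarrow> column l (word_mat (Amat S) s ** Bmat S j))) w"
    by (simp add: iir_word_def eta_part_ssa_coeff[abs_def] theta_part_ssa_coeff case_prod_unfold
        flip: column_matrix_mult matrix_mul_assoc)
  also have "\<dots> = Cmat S i *v state_word S x\<^sub>0 w"
    unfolding state_word_def by (rule word_coeff_map) simp
  finally show ?thesis .
qed

lemma ct_signalsD: "f \<in> ct_signals V \<Longrightarrow> pw_continuous f"
  by (simp add: ct_signals_def)

lemma ct_output_ssa_coeff:
  assumes u: "u \<in> ct_signals UNIV" and p: "p \<in> ct_signals P" and t: "0 \<le> t"
  shows "ct_g (ssa_coeff S x\<^sub>0) p t + integral {0..t} (\<lambda>\<delta>. ct_h (ssa_coeff S x\<^sub>0) p \<delta> t *v u \<delta>)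
    = affine_mat (Cmat S) (p t) *v ct_state S x\<^sub>0 u p t"
proof -
  note u' = ct_signalsD[OF u] and p' = ct_signalsD[OF p]
  have "series (letter_signal u p) (iir_word (ssa_coeff S x\<^sub>0) i) t = Cmat S i *v ct_state S x\<^sub>0 u p t" for i
    unfolding iir_word_ssa_coeff[abs_def] ct_state_eq_series[OF u' p' t]
    by (rule series_bounded_linear[OF pw_continuous_letter_signal[OF u' p'] geom_bounded_state_word t])
      (rule bounded_bilinear.bounded_linear_right[OF bounded_bilinear_matrix_vector_mult])
  then show ?thesis
    unfolding ct_iir_output[OF u' p' exp_bounded_ssa_coeff t]
    by (simp add: affine_mat_eq_sum linear_sum[OF linear_matrix_vector_left] scaleR_matrix_vector_assoc)
qed

section \<open>Uniqueness of the coefficients in continuous time\<close>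

text \<open>The sum is an affine function of v, so its zero set is an affine subspace containing
  \<open>P\<close> and hence is everything. Evaluation at 0 and at the unit vectors then isolates
  the single vectors.\<close>

lemma pcomp_affine_independent:
  fixes \<beta> :: "'p::finite option \<Rightarrow> 'v::real_vector"
  assumes P: "affine hull P = UNIV" and zero: "\<And>v. v \<in> P \<Longrightarrow> (\<Sum>i\<in>UNIV. pcomp i v *\<^sub>R \<beta> i) = 0"
  shows "\<beta> i = 0"
proof -
  let ?Z = "{v. (\<Sum>i\<in>UNIV. pcomp i v *\<^sub>R \<beta> i) = 0}"
  have "affine ?Z"
    unfolding affine_def
  proof (intro ballI allI impI)
    fix x y and a b :: real assume xy: "x \<in> ?Z" "y \<in> ?Z" and ab: "a + b = 1"
    have "pcomp i (a *\<^sub>R x + b *\<^sub>R y) = a * pcomp i x + b * pcomp i y" for i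
      using ab by (cases i) auto
    then have "(\<Sum>i\<in>UNIV. pcomp i (a *\<^sub>R x + b *\<^sub>R y) *\<^sub>R \<beta> i)
        = a *\<^sub>R (\<Sum>i\<in>UNIV. pcomp i x *\<^sub>R \<beta> i) + b *\<^sub>R (\<Sum>i\<in>UNIV. pcomp i y *\<^sub>R \<beta> i)"
      by (simp add: scaleR_left_distrib sum.distrib scaleR_right.sum)
    with xy show "a *\<^sub>R x + b *\<^sub>R y \<in> ?Z" by simp
  qed
  then have "affine hull P \<subseteq> ?Z" using zero by (intro hull_minimal) auto
  then have Z: "(\<Sum>i\<in>UNIV. pcomp i v *\<^sub>R \<beta> i) = 0" for v using P by auto
  have expand: "\<beta> None + (\<Sum>i\<in>UNIV. (v $ i) *\<^sub>R \<beta> (Some i)) = 0" for v :: "real ^ 'p"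
    using Z[of v] by (simp add: UNIV_option_conv sum.reindex)
  have None: "\<beta> None = 0" using expand[of 0] by simp
  show ?thesis
  proof (cases i)
    case (Some k)
    have "(\<Sum>i\<in>UNIV. (axis k 1 $ i) *\<^sub>R \<beta> (Some i)) = (\<Sum>i\<in>UNIV. if i = k then \<beta> (Some k) else 0)"
      by (rule sum.cong) (auto simp: axis_def)
    then show ?thesis using expand[of "axis k 1"] None by (simp add: Some)
  qed (simp add: None)
qed

lemma ct_signals_const:
  assumes "v \<in> V"
  shows "restrict (\<lambda>_. v) {0..} \<in> ct_signals V"
proof -
  have "continuous_on {0..} (restrict (\<lambda>_. v) {0..})"
    by (rule continuous_on_eq[OF continuous_on_const]) simp
  from pw_continuous_continuous_on[OF this] assms show ?thesis
    unfolding ct_signals_def by simp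
qed

text \<open>The first signal keeps its value at t, so the whole history up to t is preserved and the
  constant phase begins just afterwards. The second takes the new value at t itself, as needed when
  the output at t is to see it.\<close>

lemma ct_signals_switch:
  assumes f: "f \<in> ct_signals V" and v: "v \<in> V" and t: "0 \<le> t"
  shows "(\<lambda>r. if r \<le> t then f r else v) \<in> ct_signals V" (is "?g \<in> _")
    and "(\<lambda>r. if 0 \<le> r \<and> r \<ge> t then v else f r) \<in> ct_signals V" (is "?h \<in> _")
proof -
  have pwv: "pw_continuous (\<lambda>_. v)" by (rule pw_continuous_continuous_on) simp
  have pwf: "pw_continuous f" by (rule ct_signalsD[OF f])
  have "pw_continuous ?g" by (rule pw_continuous_switch[OF pwf pwv, of t]) auto
  moreover have "?g \<in> {0..} \<rightarrow>\<^sub>E V"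
    using f v t by (auto simp: ct_signals_def PiE_def extensional_def)
  ultimately show "?g \<in> ct_signals V" by (simp add: ct_signals_def)
  have "pw_continuous ?h" by (rule pw_continuous_switch[OF pwf pwv, of t]) (use t in auto)
  moreover have "?h \<in> {0..} \<rightarrow>\<^sub>E V"
    using f v t by (auto simp: ct_signals_def PiE_def extensional_def)
  ultimately show "?h \<in> ct_signals V" by (simp add: ct_signals_def)
qed

lemma ct_iir_block_rows_eq:
  fixes \<theta> \<theta>' :: "('p::finite, 'u::finite, 'y::finite) iir_coeff"
  assumes P: "affine hull P = UNIV" and "is_ct_iir P F \<theta>" "is_ct_iir P F \<theta>'"
    and u: "u \<in> ct_signals UNIV" and p: "p \<in> ct_signals P" and t: "0 \<le> t"
  shows "series (letter_signal u p) (iir_word \<theta> i) t = series (letter_signal u p) (iir_word \<theta>' i) t"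
proof -
  let ?D = "\<lambda>i. series (letter_signal u p) (iir_word \<theta> i) t - series (letter_signal u p) (iir_word \<theta>' i) t"
  have "?D i = 0"
  proof (rule pcomp_affine_independent[OF P, of ?D])
    fix v assume v: "v \<in> P"
    \<comment> \<open>\<open>p\<close> is overwritten from t on, but the output at t depends only on
      earlier values of the signals and on \<open>q t\<close>.\<close>
    define q where "q = (\<lambda>r. if 0 \<le> r \<and> r \<ge> t then v else p r)"
    have qt: "q t = v" using t by (simp add: q_def)
    have q: "q \<in> ct_signals P" unfolding q_def by (rule ct_signals_switch(2)[OF p v t])
    have same: "series (letter_signal u q) c t = series (letter_signal u p) c t" for c :: "_ \<Rightarrow> real ^ 'y"
      by (rule series_cong) (simp add: q_def letter_signal_def)
    have out: "F (u, q) t = (\<Sum>i\<in>UNIV. pcomp i v *\<^sub>R series (letter_signal u p) (iir_word \<eta> i) t)"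
      if "is_ct_iir P F \<eta>" for \<eta>
    proof -
      have "exp_bounded \<eta>" "F (u, q) t = ct_g \<eta> q t + integral {0..t} (\<lambda>\<delta>. ct_h \<eta> q \<delta> t *v u \<delta>)"
        using that u q t unfolding is_ct_iir_def by blast+
      then show ?thesis
        using ct_iir_output[OF ct_signalsD[OF u] ct_signalsD[OF q] _ t, of \<eta>] by (simp add: same qt)
    qed
    show "(\<Sum>i\<in>UNIV. pcomp i v *\<^sub>R ?D i) = 0"
      using out[OF assms(2)] out[OF assms(3)] by (simp add: scaleR_right_diff_distrib sum_subtractf)
  qed
  then show ?thesis by simp
qed

lemma is_ct_iir_unique:
  fixes P :: "(real ^ 'p::finite) set" and \<theta> \<theta>' :: "('p, 'u::finite, 'y::finite) iir_coeff"
  assumes P: "affine hull P = UNIV" and iir: "is_ct_iir P F \<theta>" "is_ct_iir P F \<theta>'"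
  shows "\<theta> = \<theta>'"
proof (rule iir_word_inject)
  fix i :: "'p option" and w :: "('p option + 'p option \<times> 'u) list"
  let ?\<F> = "{letter_signal u p |(u :: real \<Rightarrow> real ^ 'u) p. u \<in> ct_signals UNIV \<and> p \<in> ct_signals P}"
  \<comment> \<open>The signals are constant here, so the evaluation time 0 is an arbitrary
    choice.\<close>
  let ?Q = "{\<lambda>a. letter_signal (\<lambda>_. w) (\<lambda>_. v) a 0 |(w :: real ^ 'u) v. v \<in> P}"
  have "P \<noteq> {}" using P by auto
  then obtain v0 where v0: "v0 \<in> P" by blast
  have eb: "exp_bounded \<theta>" "exp_bounded \<theta>'" using iir by (simp_all add: is_ct_iir_def)
  note gb = geom_bounded_iir_word[OF eb(1), of i] geom_bounded_iir_word[OF eb(2), of i]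
  have "iir_word \<theta> i w - iir_word \<theta>' i w = 0"
  proof (rule series_eq_zeroD[where \<F> = ?\<F> and Q = ?Q and c = "\<lambda>w. iir_word \<theta> i w - iir_word \<theta>' i w"])
    show "pw_continuous (f a)" if "f \<in> ?\<F>" for f a
      using that by (auto intro: pw_continuous_letter_signal ct_signalsD)
    have "letter_signal (restrict (\<lambda>_. 0 :: real ^ 'u) {0..}) (restrict (\<lambda>_. v0) {0..}) \<in> ?\<F>"
      using ct_signals_const[OF v0] ct_signals_const[OF UNIV_I[of "0 :: real ^ 'u"]] by auto
    then show "?\<F> \<noteq> {}" by auto
    show "geom_bounded (\<lambda>w. iir_word \<theta> i w - iir_word \<theta>' i w)" by (rule geom_bounded_diff[OF gb])
    show "(\<lambda>a r. if r \<le> t then f a r else q a) \<in> ?\<F>" if f: "f \<in> ?\<F>" and q: "q \<in> ?Q" and t: "0 \<le> t" for f q t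
    proof -
      obtain u p where up: "f = letter_signal u p" "u \<in> ct_signals UNIV" "p \<in> ct_signals P" using f by blast
      obtain x v where xv: "q = (\<lambda>a. letter_signal (\<lambda>_. x) (\<lambda>_. v) a 0)" "v \<in> P" using q by blast
      have "(\<lambda>a r. if r \<le> t then f a r else q a)
          = letter_signal (\<lambda>r. if r \<le> t then u r else x) (\<lambda>r. if r \<le> t then p r else v)"
        unfolding up(1) xv(1) by (auto simp: fun_eq_iff letter_signal_def split: sum.split)
      then show ?thesis
        using ct_signals_switch(1)[OF up(2) UNIV_I t, of x] ct_signals_switch(1)[OF up(3) xv(2) t]
        by (intro CollectI exI conjI)
    qed
    show "series f (\<lambda>w. iir_word \<theta> i w - iir_word \<theta>' i w) t = 0" if f: "f \<in> ?\<F>" and t: "0 \<le> t" for f t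
    proof -
      obtain u p where up: "f = letter_signal u p" "u \<in> ct_signals UNIV" "p \<in> ct_signals P" using f by blast
      show ?thesis
        unfolding up(1) series_diff[OF pw_continuous_letter_signal[OF ct_signalsD[OF up(2)] ct_signalsD[OF up(3)]] gb t]
        by (simp add: ct_iir_block_rows_eq[OF P iir up(2,3) t])
    qed
    show "\<beta> a = 0" if zero: "\<And>q. q \<in> ?Q \<Longrightarrow> (\<Sum>a\<in>UNIV. q a *\<^sub>R \<beta> a) = 0"
      for \<beta> :: "'p option + 'p option \<times> 'u \<Rightarrow> real ^ 'y" and a
    proof -
      have sum0: "(\<Sum>i\<in>UNIV. pcomp i v *\<^sub>R (\<beta> (Inl i) + (\<Sum>l\<in>UNIV. x $ l *\<^sub>R \<beta> (Inr (i, l))))) = 0"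
        if "v \<in> P" for v and x :: "real ^ 'u"
      proof -
        have "(\<Sum>a\<in>UNIV. letter_signal (\<lambda>_. x) (\<lambda>_. v) a 0 *\<^sub>R \<beta> a) = 0"
          using that by (intro zero CollectI exI[of _ x] exI[of _ v]) simp
        then show ?thesis
          by (simp add: UNIV_Plus_UNIV[symmetric] sum.Plus letter_signal_def scaleR_right_distrib sum.distrib scaleR_right.sum
              case_prod_unfold UNIV_Times_UNIV[symmetric] sum.cartesian_product' del: UNIV_Plus_UNIV UNIV_Times_UNIV)
      qed
      \<comment> \<open>With the input value x held fixed, varying v in \<open>P\<close> separates
        the indices i. Afterwards x = 0 isolates the scheduling letter and the unit vectors isolate
        the input letters.\<close>
      have each: "\<beta> (Inl i) + (\<Sum>l\<in>UNIV. x $ l *\<^sub>R \<beta> (Inr (i, l))) = 0" for i and x :: "real ^ 'u"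
        by (rule pcomp_affine_independent[OF P, of "\<lambda>i. \<beta> (Inl i) + (\<Sum>l\<in>UNIV. x $ l *\<^sub>R \<beta> (Inr (i, l)))"])
          (rule sum0)
      have Inl: "\<beta> (Inl i) = 0" for i using each[of i 0] by simp
      have Inr: "\<beta> (Inr (j, k)) = 0" for j k
      proof -
        have "(\<Sum>l\<in>UNIV. axis k 1 $ l *\<^sub>R \<beta> (Inr (j, l))) = (\<Sum>l\<in>UNIV. if l = k then \<beta> (Inr (j, k)) else 0)"
          by (rule sum.cong) (auto simp: axis_def)
        then show ?thesis using each[of j "axis k 1"] by (simp add: Inl)
      qed
      show ?thesis by (cases a) (auto simp: Inl Inr)
    qed
  qed
  then show "iir_word \<theta> i w = iir_word \<theta>' i w" by simp
qed

lemma ct_realization_iff: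
  fixes S :: "('p::finite, 'x::finite, 'u::finite, 'y::finite) lpv_ssa"
  assumes P: "affine hull P = UNIV"
  shows "ct_realization P S x\<^sub>0 F \<longleftrightarrow> is_ct_iir P F (ssa_coeff S x\<^sub>0)"
  unfolding ct_realization_def is_ct_iir_def
  by (simp add: ct_output_ssa_coeff exp_bounded_ssa_coeff)

text \<open>Existence of an IIR together with a prescribed value of its definite description
  collapses to the statement that the prescribed coefficients form an IIR.\<close>

lemma the_unique_iff:
  assumes "\<And>x y. Q x \<Longrightarrow> Q y \<Longrightarrow> x = y"
  shows "Q a \<longleftrightarrow> (\<exists>x. Q x) \<and> (THE x. Q x) = a"
  using assms by (metis theI_unique)

section \<open>Discrete time\<close>

text \<open>For the coefficients \<open>word_mat A\<close> this is the transition matrix from time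
  \<open>\<tau>\<close> to time \<open>\<tau> + n\<close>.\<close>

definition word_sum ::
    "(nat \<Rightarrow> real ^ 'p::finite) \<Rightarrow> ('p option list \<Rightarrow> 'v::real_vector) \<Rightarrow> nat \<Rightarrow> nat \<Rightarrow> 'v" where
  "word_sum p c n \<tau> = (\<Sum>s | length s = n. (\<Prod>k<n. pcomp (s ! k) (p (\<tau> + k))) *\<^sub>R c s)"

lemma word_sum_0 [simp]: "word_sum p c 0 \<tau> = c []"
  by (simp add: word_sum_def)

text \<open>The last letter is the one that sees the latest time \<open>\<tau> + n\<close>, so
  removing it matches one step of the state recursion.\<close>

lemma word_sum_Suc:
  "word_sum p c (Suc n) \<tau> = (\<Sum>i\<in>UNIV. pcomp i (p (\<tau> + n)) *\<^sub>R word_sum p (\<lambda>s. c (s @ [i])) n \<tau>)"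
proof -
  let ?snoc = "\<lambda>(i, s). s @ [i]"
  have inj: "inj_on ?snoc (UNIV \<times> {s. length s = n})" by (auto simp: inj_on_def)
  have im: "{s. length s = Suc n} = ?snoc ` (UNIV \<times> {s. length s = n})"
    by (auto simp: length_Suc_conv_rev image_iff)
  have prod: "(\<Prod>k<Suc n. pcomp ((s @ [i]) ! k) (p (\<tau> + k)))
      = pcomp i (p (\<tau> + n)) * (\<Prod>k<n. pcomp (s ! k) (p (\<tau> + k)))" if "length s = n" for s i
  proof -
    have "(\<Prod>k<n. pcomp ((s @ [i]) ! k) (p (\<tau> + k))) = (\<Prod>k<n. pcomp (s ! k) (p (\<tau> + k)))"
      using that by (intro prod.cong) (auto simp: nth_append)
    moreover have "(s @ [i]) ! n = i" using that by (metis nth_append_length)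
    ultimately show ?thesis by (simp add: mult.commute)
  qed
  have "word_sum p c (Suc n) \<tau> = (\<Sum>(i, s)\<in>UNIV \<times> {s. length s = n}.
      (\<Prod>k<Suc n. pcomp ((s @ [i]) ! k) (p (\<tau> + k))) *\<^sub>R c (s @ [i]))"
    unfolding word_sum_def im by (subst sum.reindex[OF inj]) (simp add: o_def case_prod_unfold del: prod.lessThan_Suc)
  also have "\<dots> = (\<Sum>(i, s)\<in>UNIV \<times> {s. length s = n}.
      pcomp i (p (\<tau> + n)) *\<^sub>R (\<Prod>k<n. pcomp (s ! k) (p (\<tau> + k))) *\<^sub>R c (s @ [i]))"
    by (rule sum.cong[OF refl]) (simp add: prod case_prod_unfold mem_Times_iff del: prod.lessThan_Suc)
  finally show ?thesis
    by (simp add: word_sum_def sum.cartesian_product scaleR_right.sum)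
qed

lemma word_sum_cong:
  assumes "\<And>k. \<tau> \<le> k \<Longrightarrow> k < \<tau> + n \<Longrightarrow> p k = q k"
  shows "word_sum p c n \<tau> = word_sum q c n \<tau>"
  unfolding word_sum_def using assms by (intro sum.cong refl arg_cong2[where f=scaleR] prod.cong) auto

lemma word_sum_linear: "linear L \<Longrightarrow> word_sum p (\<lambda>s. L (c s)) n \<tau> = L (word_sum p c n \<tau>)"
  by (simp add: word_sum_def linear_sum linear_cmul)

text \<open>The first argument \<open>int t - 1\<close> makes exactly the words of length
  \<open>t - \<tau>\<close> contribute. For t = \<tau> this is the empty word alone, also at t = 0,
  where the argument is -1.\<close>

lemma infsum_dt_w:
  fixes c :: "'p::finite option list \<Rightarrow> 'v::real_normed_vector"
  assumes "\<tau> \<le> t"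
  shows "(\<Sum>\<^sub>\<infinity>s. (a * dt_w p s (int t - 1) \<tau>) *\<^sub>R c s) = a *\<^sub>R word_sum p c (t - \<tau>) \<tau>"
proof -
  have w: "dt_w p s (int t - 1) \<tau> = (if length s = t - \<tau> then (\<Prod>k<length s. pcomp (s ! k) (p (\<tau> + k))) else 0)" for s
    using assms by (auto simp: dt_w_def)
  have "finite {s :: 'p option list. length s = t - \<tau>}"
    using finite_lists_length_eq[of "UNIV :: 'p option set"] by simp
  moreover have "(\<Sum>\<^sub>\<infinity>s. (a * dt_w p s (int t - 1) \<tau>) *\<^sub>R c s)
      = (\<Sum>\<^sub>\<infinity>s\<in>{s. length s = t - \<tau>}. (a * (\<Prod>k<t - \<tau>. pcomp (s ! k) (p (\<tau> + k)))) *\<^sub>R c s)"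
    by (rule infsum_cong_neutral) (auto simp: w)
  ultimately show ?thesis by (simp add: word_sum_def scaleR_right.sum)
qed

lemma dt_g_eq: "dt_g \<theta> p t = (\<Sum>i\<in>UNIV. pcomp i (p t) *\<^sub>R word_sum p (eta_part \<theta> i) t 0)"
  unfolding dt_g_def by (subst infsum_dt_w) auto

lemma dt_h_eq:
  assumes "\<delta> < t"
  shows "dt_h \<theta> p \<delta> t = (\<Sum>i\<in>UNIV. pcomp i (p t) *\<^sub>R (\<Sum>j\<in>UNIV. pcomp j (p \<delta>) *\<^sub>R
           word_sum p (theta_part \<theta> i j) (t - Suc \<delta>) (Suc \<delta>)))"
  unfolding dt_h_def using assms by (subst infsum_dt_w) (auto simp: scaleR_right.sum)

text \<open>Discrete variation of constants. The input at time \<delta> first affects the state at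
  time \<delta> + 1, hence the transition from \<open>Suc \<delta>\<close>.\<close>

lemma dt_state_eq:
  "dt_state S x\<^sub>0 u p t = word_sum p (word_mat (Amat S)) t 0 *v x\<^sub>0
     + (\<Sum>\<delta><t. word_sum p (word_mat (Amat S)) (t - Suc \<delta>) (Suc \<delta>) *v (affine_mat (Bmat S) (p \<delta>) *v u \<delta>))"
proof (induction t)
  case 0
  show ?case by simp
next
  case (Suc t)
  let ?\<Phi> = "word_sum p (word_mat (Amat S))"
  have step: "?\<Phi> (Suc n) \<tau> = affine_mat (Amat S) (p (\<tau> + n)) ** ?\<Phi> n \<tau>" for n \<tau>
  proof -
    have "word_sum p (\<lambda>s. word_mat (Amat S) (s @ [i])) n \<tau> = Amat S i ** ?\<Phi> n \<tau>" for i
      unfolding word_mat_snoc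
      by (intro word_sum_linear bounded_linear.linear bounded_bilinear.bounded_linear_right[OF bounded_bilinear_matrix_matrix_mult])
    then show ?thesis
      by (simp add: word_sum_Suc affine_mat_eq_sum bounded_bilinear.sum_left[OF bounded_bilinear_matrix_matrix_mult]
          bounded_bilinear.scaleR_left[OF bounded_bilinear_matrix_matrix_mult])
  qed
  have "?\<Phi> (Suc t - Suc \<delta>) (Suc \<delta>) = affine_mat (Amat S) (p t) ** ?\<Phi> (t - Suc \<delta>) (Suc \<delta>)" if "\<delta> < t" for \<delta>
    using step[of "t - Suc \<delta>" "Suc \<delta>"] that by (simp add: Suc_diff_Suc)
  then have "(\<Sum>\<delta><t. ?\<Phi> (Suc t - Suc \<delta>) (Suc \<delta>) *v (affine_mat (Bmat S) (p \<delta>) *v u \<delta>))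
      = affine_mat (Amat S) (p t) *v (\<Sum>\<delta><t. ?\<Phi> (t - Suc \<delta>) (Suc \<delta>) *v (affine_mat (Bmat S) (p \<delta>) *v u \<delta>))"
    by (simp add: bounded_bilinear.sum_right[OF bounded_bilinear_matrix_vector_mult] matrix_vector_mul_assoc matrix_mul_assoc)
  then show ?case
    using Suc by (simp add: step[of t 0, simplified] matrix_vector_right_distrib matrix_vector_mul_assoc)
qed

text \<open>Both parts of \<open>ssa_coeff\<close> are linear in the word matrix, so their word sums
  are transition matrices between constant factors, and the claim is \<open>dt_state_eq\<close>
  multiplied by the output matrix.\<close>

lemma dt_output_ssa_coeff:
  "dt_g (ssa_coeff S x\<^sub>0) p t + (\<Sum>\<delta><t. dt_h (ssa_coeff S x\<^sub>0) p \<delta> t *v u \<delta>)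
    = affine_mat (Cmat S) (p t) *v dt_state S x\<^sub>0 u p t"
proof -
  let ?\<Phi> = "word_sum p (word_mat (Amat S))"
  have g: "word_sum p (eta_part (ssa_coeff S x\<^sub>0) i) n \<tau> = Cmat S i *v (?\<Phi> n \<tau> *v x\<^sub>0)" for i n \<tau>
    unfolding eta_part_ssa_coeff[abs_def]
    using word_sum_linear[OF linear_compose[OF linear_matrix_vector_left matrix_vector_mul_linear]]
    by (simp add: o_def)
  have h: "word_sum p (theta_part (ssa_coeff S x\<^sub>0) i j) n \<tau> = Cmat S i ** ?\<Phi> n \<tau> ** Bmat S j" for i j n \<tau>
    unfolding theta_part_ssa_coeff[abs_def]
    using word_sum_linear[OF linear_compose[OF
        bounded_linear.linear[OF bounded_bilinear.bounded_linear_right[OF bounded_bilinear_matrix_matrix_mult]]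
        bounded_linear.linear[OF bounded_bilinear.bounded_linear_left[OF bounded_bilinear_matrix_matrix_mult]]]]
    by (simp add: o_def)
  have "dt_g (ssa_coeff S x\<^sub>0) p t = affine_mat (Cmat S) (p t) *v (?\<Phi> t 0 *v x\<^sub>0)"
    by (simp add: dt_g_eq g affine_mat_eq_sum linear_sum[OF linear_matrix_vector_left] scaleR_matrix_vector_assoc)
  moreover have "dt_h (ssa_coeff S x\<^sub>0) p \<delta> t *v u \<delta>
      = affine_mat (Cmat S) (p t) *v (?\<Phi> (t - Suc \<delta>) (Suc \<delta>) *v (affine_mat (Bmat S) (p \<delta>) *v u \<delta>))" if "\<delta> < t" for \<delta>
  proof -
    have "dt_h (ssa_coeff S x\<^sub>0) p \<delta> t = affine_mat (Cmat S) (p t) ** ?\<Phi> (t - Suc \<delta>) (Suc \<delta>) ** affine_mat (Bmat S) (p \<delta>)"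
      by (simp add: dt_h_eq[OF that] h affine_mat_eq_sum
          bounded_bilinear.sum_left[OF bounded_bilinear_matrix_matrix_mult]
          bounded_bilinear.sum_right[OF bounded_bilinear_matrix_matrix_mult]
          bounded_bilinear.scaleR_left[OF bounded_bilinear_matrix_matrix_mult]
          bounded_bilinear.scaleR_right[OF bounded_bilinear_matrix_matrix_mult] scaleR_right.sum)
        (subst sum.swap, simp add: mult.commute)
    then show ?thesis by (simp add: matrix_vector_mul_assoc matrix_mul_assoc)
  qed
  ultimately show ?thesis
    by (simp add: dt_state_eq matrix_vector_right_distrib bounded_bilinear.sum_right[OF bounded_bilinear_matrix_vector_mult])
qed

section \<open>Uniqueness of the coefficients in discrete time\<close>

lemma dt_signals_iff: "f \<in> dt_signals V \<longleftrightarrow> (\<forall>t. f t \<in> V)"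
  by (auto simp: dt_signals_def)

text \<open>Only the last letter of a word sees time \<open>\<tau> + n\<close>, so the freedom of
  \<open>p\<close> there separates the words by their last letter and reduces the length by
  one.\<close>

lemma word_sum_eqD:
  fixes c d :: "'a::finite option list \<Rightarrow> 'b::real_vector"
  assumes P: "affine hull P = UNIV"
    and eq: "\<And>p. p \<in> dt_signals P \<Longrightarrow> word_sum p c n \<tau> = word_sum p d n \<tau>" and "length s = n"
  shows "c s = d s"
  using eq \<open>length s = n\<close>
proof (induction n arbitrary: c d s)
  case 0
  have "P \<noteq> {}" using P by auto
  then obtain v where "v \<in> P" by blast
  then have "(\<lambda>_. v) \<in> dt_signals P" by (simp add: dt_signals_iff)
  from 0(1)[OF this] 0(2) show ?case by simp
next
  case (Suc n)
  obtain s' i where s: "s = s' @ [i]" "length s' = n"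
    using Suc.prems(2) by (auto simp: length_Suc_conv_rev)
  have "word_sum p (\<lambda>s. c (s @ [i])) n \<tau> = word_sum p (\<lambda>s. d (s @ [i])) n \<tau>" if p: "p \<in> dt_signals P" for p
  proof -
    let ?D = "\<lambda>i. word_sum p (\<lambda>s. c (s @ [i])) n \<tau> - word_sum p (\<lambda>s. d (s @ [i])) n \<tau>"
    have "?D i = 0"
    proof (rule pcomp_affine_independent[OF P, of ?D])
      fix v assume "v \<in> P"
      define q where "q = p(\<tau> + n := v)"
      have q: "q \<in> dt_signals P" and qv: "q (\<tau> + n) = v"
        using p \<open>v \<in> P\<close> by (simp_all add: q_def dt_signals_iff)
      have same: "word_sum q e n \<tau> = word_sum p e n \<tau>" for e :: "'a option list \<Rightarrow> 'b"
        by (rule word_sum_cong) (simp add: q_def)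
      show "(\<Sum>i\<in>UNIV. pcomp i v *\<^sub>R ?D i) = 0"
        using Suc.prems(1)[OF q] by (simp add: word_sum_Suc same qv scaleR_right_diff_distrib sum_subtractf)
    qed
    then show ?thesis by simp
  qed
  from Suc.IH[OF this s(2)] show ?case by (simp add: s(1))
qed

lemma is_dt_iir_unique:
  fixes P :: "(real ^ 'p::finite) set" and \<theta> \<theta>' :: "('p, 'u::finite, 'y::finite) iir_coeff"
  assumes P: "affine hull P = UNIV" and iir: "is_dt_iir P F \<theta>" "is_dt_iir P F \<theta>'"
  shows "\<theta> = \<theta>'"
proof (rule iir_coeff_eqI)
  have eq: "dt_g \<theta> p t + (\<Sum>\<delta><t. dt_h \<theta> p \<delta> t *v u \<delta>) = dt_g \<theta>' p t + (\<Sum>\<delta><t. dt_h \<theta>' p \<delta> t *v u \<delta>)"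
    if "p \<in> dt_signals P" for u p t
  proof -
    have "u \<in> dt_signals UNIV" by (simp add: dt_signals_iff)
    then have "F (u, p) t = dt_g \<eta> p t + (\<Sum>\<delta><t. dt_h \<eta> p \<delta> t *v u \<delta>)" if "is_dt_iir P F \<eta>" for \<eta>
      using \<open>p \<in> dt_signals P\<close> that unfolding is_dt_iir_def by blast
    from this[OF iir(1)] this[OF iir(2)] show ?thesis by simp
  qed
  \<comment> \<open>The zero input isolates the free response.\<close>
  have g: "dt_g \<theta> p t = dt_g \<theta>' p t" if "p \<in> dt_signals P" for p t
    using eq[OF that, where t=t and u="\<lambda>_. 0"] by simp
  \<comment> \<open>A unit impulse at time 0 in input channel l isolates column l of the kernel. The
    kernel at \<delta> = 0 is enough, since a word of length n occurs in it at output time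
    \<open>Suc n\<close>.\<close>
  have h: "dt_h \<theta> p 0 (Suc n) = dt_h \<theta>' p 0 (Suc n)" if p: "p \<in> dt_signals P" for p n
  proof (rule matrix_eq_columns)
    fix l
    have "(\<Sum>\<delta><Suc n. dt_h \<eta> p \<delta> (Suc n) *v (if \<delta> = 0 then axis l 1 else 0)) = column l (dt_h \<eta> p 0 (Suc n))"
      for \<eta> :: "('p, 'u, 'y) iir_coeff"
      unfolding sum.lessThan_Suc_shift by (simp add: matrix_vector_mult_basis)
    then show "column l (dt_h \<theta> p 0 (Suc n)) = column l (dt_h \<theta>' p 0 (Suc n))"
      using eq[OF p, where t="Suc n" and u="\<lambda>\<delta>. if \<delta> = 0 then axis l 1 else 0"] g[OF p] by simp
  qed
  have upd: "p(k := v) \<in> dt_signals P" if "p \<in> dt_signals P" "v \<in> P" for p k v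
    using that by (simp add: dt_signals_iff)
  fix i s
  show "eta_part \<theta> i s = eta_part \<theta>' i s"
  proof (rule word_sum_eqD[OF P _ refl, where \<tau>=0])
    fix p assume p: "p \<in> dt_signals P"
    let ?t = "length s"
    let ?D = "\<lambda>i. word_sum p (eta_part \<theta> i) ?t 0 - word_sum p (eta_part \<theta>' i) ?t 0"
    have "?D i = 0"
    proof (rule pcomp_affine_independent[OF P, of ?D])
      fix v assume v: "v \<in> P"
      \<comment> \<open>The words involved see only times below \<open>?t\<close>, so the value
        there is free to separate the block rows.\<close>
      define q where "q = p(?t := v)"
      have q: "q \<in> dt_signals P" and qv: "q ?t = v"
        using upd[OF p v] by (simp_all add: q_def)
      have same: "word_sum q e ?t 0 = word_sum p e ?t 0" for e :: "'p option list \<Rightarrow> real ^ 'y"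
        by (rule word_sum_cong) (simp add: q_def)
      show "(\<Sum>i\<in>UNIV. pcomp i v *\<^sub>R ?D i) = 0"
        using g[OF q, of ?t] by (simp add: dt_g_eq same qv scaleR_right_diff_distrib sum_subtractf)
    qed
    then show "word_sum p (eta_part \<theta> i) ?t 0 = word_sum p (eta_part \<theta>' i) ?t 0" by simp
  qed
  fix j
  show "theta_part \<theta> i j s = theta_part \<theta>' i j s"
  proof (rule word_sum_eqD[OF P _ refl, where \<tau>="Suc 0"])
    fix p assume p: "p \<in> dt_signals P"
    let ?n = "length s"
    let ?D = "\<lambda>i j. word_sum p (theta_part \<theta> i j) ?n (Suc 0) - word_sum p (theta_part \<theta>' i j) ?n (Suc 0)"
    have "?D i j = 0"
    proof (rule pcomp_affine_independent[OF P, of "?D i"])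
      fix w assume w: "w \<in> P"
      show "(\<Sum>j\<in>UNIV. pcomp j w *\<^sub>R ?D i j) = 0"
      proof (rule pcomp_affine_independent[OF P, of "\<lambda>i. \<Sum>j\<in>UNIV. pcomp j w *\<^sub>R ?D i j"])
        fix v assume v: "v \<in> P"
        \<comment> \<open>The words see the times 1 to \<open>?n\<close>. The times 0 and
          \<open>Suc ?n\<close> on either side are free; their values separate the index j of the
          input and the index i of the block row.\<close>
        define q where "q = p(0 := w, Suc ?n := v)"
        have q: "q \<in> dt_signals P" and qvw: "q 0 = w" "q (Suc ?n) = v"
          using upd[OF upd[OF p w] v] by (simp_all add: q_def)
        have same: "word_sum q e ?n (Suc 0) = word_sum p e ?n (Suc 0)" for e :: "'p option list \<Rightarrow> real ^ 'u ^ 'y"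
          by (rule word_sum_cong) (simp add: q_def)
        show "(\<Sum>i\<in>UNIV. pcomp i v *\<^sub>R (\<Sum>j\<in>UNIV. pcomp j w *\<^sub>R ?D i j)) = 0"
          using h[OF q, of ?n]
          by (simp add: dt_h_eq same qvw scaleR_right_diff_distrib sum_subtractf)
      qed
    qed
    then show "word_sum p (theta_part \<theta> i j) ?n (Suc 0) = word_sum p (theta_part \<theta>' i j) ?n (Suc 0)" by simp
  qed
qed

lemma dt_realization_iff: "dt_realization P S x\<^sub>0 F \<longleftrightarrow> is_dt_iir P F (ssa_coeff S x\<^sub>0)"
  unfolding dt_realization_def is_dt_iir_def by (simp add: dt_output_ssa_coeff exp_bounded_ssa_coeff)

lemma eq_ssa_coeff_iff:
  "\<theta> = ssa_coeff S x\<^sub>0 \<longleftrightarrow> (\<forall>i j s.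
     eta_part \<theta> i s = Cmat S i *v (word_mat (Amat S) s *v x\<^sub>0) \<and>
     theta_part \<theta> i j s = Cmat S i ** word_mat (Amat S) s ** Bmat S j)"
  by (auto simp: eta_part_ssa_coeff theta_part_ssa_coeff intro: iir_coeff_eqI)

theorem lemma3:
  fixes P :: "(real ^ 'p) set"
    and S :: "('p::finite, 'x::finite, 'u::finite, 'y::finite) lpv_ssa"
    and x\<^sub>0 :: "real ^ 'x"
  assumes "affine hull P = UNIV"
  shows
    "(\<forall>F :: (real \<Rightarrow> real ^ 'u) \<times> (real \<Rightarrow> real ^ 'p) \<Rightarrow> real \<Rightarrow> real ^ 'y. F \<in> ct_io_maps P \<longrightarrow>
        (ct_realization P S x\<^sub>0 F \<longleftrightarrow>
           has_ct_iir P F \<and>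
           (\<forall>i j s.
              eta_part (ct_iir P F) i s = Cmat S i *v (word_mat (Amat S) s *v x\<^sub>0) \<and>
              theta_part (ct_iir P F) i j s = Cmat S i ** word_mat (Amat S) s ** Bmat S j))) \<and>
     (\<forall>F :: (nat \<Rightarrow> real ^ 'u) \<times> (nat \<Rightarrow> real ^ 'p) \<Rightarrow> nat \<Rightarrow> real ^ 'y. F \<in> dt_io_maps P \<longrightarrow>
        (dt_realization P S x\<^sub>0 F \<longleftrightarrow>
           has_dt_iir P F \<and>
           (\<forall>i j s.
              eta_part (dt_iir P F) i s = Cmat S i *v (word_mat (Amat S) s *v x\<^sub>0) \<and>
              theta_part (dt_iir P F) i j s = Cmat S i ** word_mat (Amat S) s ** Bmat S j)))"
  \<comment> \<open>The coefficient formulas fold into one equation with \<open>ssa_coeff\<close>,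
    after which both cases are instances of \<open>the_unique_iff\<close>.\<close>
  unfolding eq_ssa_coeff_iff[symmetric] ct_realization_iff[OF assms] dt_realization_iff
    has_ct_iir_def ct_iir_def has_dt_iir_def dt_iir_def
  by (intro conjI allI impI the_unique_iff is_ct_iir_unique[OF assms] is_dt_iir_unique[OF assms])

end
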